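(* Let $\mathcal{C}$ be a clone on $\{0,1\}$. If $\mathcal{C}$ is included in $\Lambda$, $V$ or $L$, then $\mathcal{C}^{(\geq 4)}$ is reconstructible. Otherwise, $\mathcal{C}^{(\geq n)}$ is not weakly reconstructible for any $n \geq 1$, and $\mathcal{C}$ contains pairs of nonequivalent strongly hypomorphic functions of arbitrarily high arity.
   Context: A Boolean function is a map $f\colon\{0,1\}^n\to\{0,1\}$ for some integer $n\ge 1$, its arity. A clone on $\{0,1\}$ is a class of Boolean functions that contains all projections $(a_1,\dots,a_n)\mapsto a_i$ and is closed under composition $f(g_1,\dots,g_n)(\mathbf a)=f(g_1(\mathbf a),\dots,g_n(\mathbf a))$. For a class $\mathcal C$ of Boolean functions, $\mathcal C^{(\ge n)}$ is the set of members of $\mathcal C$ of arity at least $n$. $\Lambda$ is the clone of all polynomial operations of the two-element meet-semilattice $(\{0,1\};\wedge)$ (i.e. all constant functions and all conjunctions of a nonempty set of arguments); $V$ is the clone of all polynomial operations of the two-element join-semilattice $(\{0,1\};\vee)$ (all constant functions and all disjunctions of a nonempty set of arguments); $L$ is the clone of all polynomial operations of the group of addition modulo $2$ (all affine functions over the two-element field). Functions are allowed to have inessential arguments. Write $[n]=\{1,\dots,n\}$. For $\mathbf a=(a_1,\dots,a_n)$ and $\sigma\colon[m]\to[n]$ let $\mathbf a\sigma=(a_{\sigma(1)},\dots,a_{\sigma(m)})$. A function $f$ of arity $n$ is a minor of a function $g$ of arity $m$, written $f\le g$, if there is a map $\sigma\colon[m]\to[n]$ with $f(\mathbf a)=g(\mathbf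 a\sigma)$ for all $\mathbf a\in\{0,1\}^n$. Functions $f,g$ are equivalent, $f\equiv g$, if $f\le g$ and $g\le f$; for $f,g$ of the same arity $n$ this means that $f(\mathbf a)=g(\mathbf a\sigma)$ for all $\mathbf a$, for some permutation $\sigma$ of $[n]$. For $f$ of arity $n\ge2$ and a two-element set $I=\{i,j\}\subseteq[n]$, $i<j$, the identification minor $f_I$ is the function of arity $n-1$ given by $f_I(a_1,\dots,a_{n-1})=f(a_1,\dots,a_{j-1},a_i,a_j,\dots,a_{n-1})$. The deck of $f$ is the multiset of the equivalence classes $f_I/{\equiv}$, with $I$ ranging over all two-element subsets of $[n]$. Two functions $f,g$ of the same arity $n$ are hypomorphic ($g$ is a reconstruction of $f$) if they have the same deck, and strongly hypomorphic if $f_I\equiv g_I$ for every two-element $I\subseteq[n]$. A function is reconstructible if it is equivalent to all of its reconstructions (among all Boolean functions of the same arity). A class $\mathcal C$ is reconstructible if all its members are reconstructible; it is weakly reconstructible if for every $f\in\mathcal C$, all reconstructions of $f$ that belong to $\mathcal C$ are equivalent to $f$. *)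

theory Defs
  imports Main "HOL-Library.Multiset"
begin

text \<open>
  The set \<open>{0,1}\<close> is \<^typ>\<open>bool\<close> (with \<^const>\<open>False\<close> for 0), an \<open>n\<close>-tuple is a list of length \<open>n\<close>,
  and argument positions are counted from 0, so that \<open>[n]\<close> is \<^term>\<open>{..<n::nat}\<close>.
  The value of a function on lists of the wrong length is normalised to \<^const>\<open>False\<close>, so that
  equality on the type is equality of arities and of the maps on tuples of that length.
\<close>

typedef boolfun =
  "{(n :: nat, F :: bool list \<Rightarrow> bool). n \<ge> 1 \<and> (\<forall>a. length a \<noteq> n \<longrightarrow> F a = False)}"
  by (rule exI [of _ "(1, \<lambda>_. False)"]) simp

definition arity :: "boolfun \<Rightarrow> nat" where
  "arity f = fst (Rep_boolfun f)"

definition app :: "boolfun \<Rightarrow> bool list \<Rightarrow> bool" where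
  "app f = snd (Rep_boolfun f)"

text \<open>The following is meaningful only for \<open>n \<ge> 1\<close>.\<close>

definition mk_fun :: "nat \<Rightarrow> (bool list \<Rightarrow> bool) \<Rightarrow> boolfun" where
  "mk_fun n F = Abs_boolfun (n, \<lambda>a. length a = n \<and> F a)"

lemma arity_mk_fun [simp]: "n \<ge> 1 \<Longrightarrow> arity (mk_fun n F) = n"
  by (simp add: arity_def mk_fun_def Abs_boolfun_inverse)

lemma app_mk_fun [simp]: "n \<ge> 1 \<Longrightarrow> app (mk_fun n F) a \<longleftrightarrow> length a = n \<and> F a"
  by (simp add: app_def mk_fun_def Abs_boolfun_inverse)

lemma arity_ge_1: "arity f \<ge> 1"
  using Rep_boolfun [of f] by (auto simp: arity_def)

lemma app_wrong_length: "length a \<noteq> arity f \<Longrightarrow> \<not> app f a"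
  using Rep_boolfun [of f] by (auto simp: arity_def app_def)

lemma boolfun_eqI:
  assumes "arity f = arity g"
    and "\<And>a. length a = arity f \<Longrightarrow> app f a = app g a"
  shows "f = g"
proof -
  have "app f a = app g a" for a
    using assms app_wrong_length by (cases "length a = arity f") auto
  then have "app f = app g"
    by (rule ext)
  then show ?thesis
    using assms(1) by (simp add: arity_def app_def prod_eq_iff flip: Rep_boolfun_inject)
qed


subsection \<open>Clones\<close>

definition proj :: "nat \<Rightarrow> nat \<Rightarrow> boolfun" where
  "proj n i = mk_fun n (\<lambda>a. a ! i)"

definition comp_fun :: "nat \<Rightarrow> boolfun \<Rightarrow> boolfun list \<Rightarrow> boolfun" where
  "comp_fun n f gs = mk_fun n (\<lambda>a. app f (map (\<lambda>g. app g a) gs))"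

definition clone :: "boolfun set \<Rightarrow> bool" where
  "clone C \<longleftrightarrow>
     (\<forall>n\<ge>1. \<forall>i<n. proj n i \<in> C) \<and>
     (\<forall>f\<in>C. \<forall>n\<ge>1. \<forall>gs. length gs = arity f \<longrightarrow> (\<forall>g\<in>set gs. g \<in> C \<and> arity g = n)
        \<longrightarrow> comp_fun n f gs \<in> C)"

definition const_fun :: "nat \<Rightarrow> bool \<Rightarrow> boolfun" where
  "const_fun n c = mk_fun n (\<lambda>_. c)"

text \<open>
  The polynomial operations of the algebra on \<open>{0,1}\<close> with fundamental operations \<open>F\<close>:
  the least clone containing \<open>F\<close> and all constant functions.
\<close>

definition polynomial_operations :: "boolfun set \<Rightarrow> boolfun set" where
  "polynomial_operations F =
     \<Inter>{C. clone C \<and> F \<subseteq> C \<and> (\<forall>n\<ge>1. \<forall>c. const_fun n c \<in> C)}"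

definition meet_op :: boolfun where
  "meet_op = mk_fun 2 (\<lambda>a. a ! 0 \<and> a ! 1)"

definition join_op :: boolfun where
  "join_op = mk_fun 2 (\<lambda>a. a ! 0 \<or> a ! 1)"

definition add_op :: boolfun where
  "add_op = mk_fun 2 (\<lambda>a. a ! 0 \<noteq> a ! 1)"

definition Lambda_clone :: "boolfun set" where
  "Lambda_clone = polynomial_operations {meet_op}"

definition V_clone :: "boolfun set" where
  "V_clone = polynomial_operations {join_op}"

text \<open>The inverse operation of the group is the identity, and its neutral element is a constant.\<close>

definition L_clone :: "boolfun set" where
  "L_clone = polynomial_operations {add_op}"

definition of_arity_ge :: "boolfun set \<Rightarrow> nat \<Rightarrow> boolfun set" where
  "of_arity_ge C n = {f \<in> C. arity f \<ge> n}"


subsection \<open>Minors, decks and reconstruction\<close>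

definition tuple_map :: "bool list \<Rightarrow> nat \<Rightarrow> (nat \<Rightarrow> nat) \<Rightarrow> bool list" where
  "tuple_map a m \<sigma> = map (\<lambda>k. a ! \<sigma> k) [0..<m]"

definition minor :: "boolfun \<Rightarrow> boolfun \<Rightarrow> bool" where
  "minor f g \<longleftrightarrow>
     (\<exists>\<sigma>. \<sigma> ` {..<arity g} \<subseteq> {..<arity f} \<and>
        (\<forall>a. length a = arity f \<longrightarrow> app f a = app g (tuple_map a (arity g) \<sigma>)))"

definition equivalent :: "boolfun \<Rightarrow> boolfun \<Rightarrow> bool" where
  "equivalent f g \<longleftrightarrow> minor f g \<and> minor g f"

text \<open>
  For \<open>I = {i, j}\<close> with \<open>i < j\<close>, the list below is
  \<open>(a\<^sub>0, \<dots>, a\<^bsub>j-1\<^esub>, a\<^sub>i, a\<^sub>j, \<dots>, a\<^bsub>n-2\<^esub>)\<close>.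
\<close>

definition ident_minor :: "boolfun \<Rightarrow> nat set \<Rightarrow> boolfun" where
  "ident_minor f I =
     (let i = Min I; j = Max I
      in mk_fun (arity f - 1) (\<lambda>a. app f (take j a @ [a ! i] @ drop j a)))"

definition pairs :: "nat \<Rightarrow> nat set set" where
  "pairs n = {I. I \<subseteq> {..<n} \<and> card I = 2}"

definition deck :: "boolfun \<Rightarrow> boolfun set multiset" where
  "deck f = image_mset (\<lambda>I. {g. equivalent g (ident_minor f I)}) (mset_set (pairs (arity f)))"

text \<open>
  Decks are considered only for functions of arity at least 2; without this restriction, all
  unary functions would have the same (empty) deck.
\<close>

definition hypomorphic :: "boolfun \<Rightarrow> boolfun \<Rightarrow> bool" where
  "hypomorphic f g \<longleftrightarrow> arity f = arity g \<and> arity f \<ge> 2 \<and> deck f = deck g"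

definition strongly_hypomorphic :: "boolfun \<Rightarrow> boolfun \<Rightarrow> bool" where
  "strongly_hypomorphic f g \<longleftrightarrow>
     arity f = arity g \<and> arity f \<ge> 2 \<and>
     (\<forall>I\<in>pairs (arity f). equivalent (ident_minor f I) (ident_minor g I))"

definition reconstructible_fun :: "boolfun \<Rightarrow> bool" where
  "reconstructible_fun f \<longleftrightarrow> (\<forall>g. hypomorphic f g \<longrightarrow> equivalent f g)"

definition reconstructible :: "boolfun set \<Rightarrow> bool" where
  "reconstructible C \<longleftrightarrow> (\<forall>f\<in>C. reconstructible_fun f)"

definition weakly_reconstructible :: "boolfun set \<Rightarrow> bool" where
  "weakly_reconstructible C \<longleftrightarrow> (\<forall>f\<in>C. \<forall>g\<in>C. hypomorphic f g \<longrightarrow> equivalent f g)"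


subsection \<open>Explicit descriptions of the three polynomial clones\<close>

lemma polynomial_operations_eqI:
  assumes "clone D" and "h \<in> D" and "\<And>n c. n \<ge> 1 \<Longrightarrow> const_fun n c \<in> D"
    and "\<And>C f. \<lbrakk>clone C; h \<in> C; \<forall>n\<ge>1. \<forall>c. const_fun n c \<in> C; f \<in> D\<rbrakk> \<Longrightarrow> f \<in> C"
  shows "polynomial_operations {h} = D"
proof (rule antisym)
  show "polynomial_operations {h} \<subseteq> D"
    unfolding polynomial_operations_def using assms(1-3) by (intro Inter_lower) simp
  show "D \<subseteq> polynomial_operations {h}"
    unfolding polynomial_operations_def
  proof (intro subsetI InterI)
    fix f C
    assume "f \<in> D" and "C \<in> {C. clone C \<and> {h} \<subseteq> C \<and> (\<forall>n\<ge>1. \<forall>c. const_fun n c \<in> C)}"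
    then show "f \<in> C" using assms(4) [of C f] by simp
  qed
qed

lemma clone_proj: "\<lbrakk>clone C; i < n\<rbrakk> \<Longrightarrow> mk_fun n (\<lambda>a. a ! i) \<in> C"
proof -
  assume "clone C" "i < n"
  have "\<forall>n\<ge>1. \<forall>i<n. proj n i \<in> C"
    using \<open>clone C\<close> unfolding clone_def by (rule conjunct1)
  then have "proj n i \<in> C" using \<open>i < n\<close> by simp
  then show ?thesis by (simp only: proj_def)
qed

lemma clone_comp2:
  assumes C: "clone C" and h: "mk_fun 2 (\<lambda>a. H (a ! 0) (a ! 1)) \<in> C"
    and F: "mk_fun n F \<in> C" and G: "mk_fun n G \<in> C" and n: "n \<ge> 1"
  shows "mk_fun n (\<lambda>a. H (F a) (G a)) \<in> C"
proof -
  let ?h = "mk_fun 2 (\<lambda>a. H (a ! 0) (a ! 1))"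
  have "comp_fun n ?h [mk_fun n F, mk_fun n G] \<in> C"
    using C h F G n unfolding clone_def by simp
  also have "comp_fun n ?h [mk_fun n F, mk_fun n G] = mk_fun n (\<lambda>a. H (F a) (G a))"
    using n by (intro boolfun_eqI) (auto simp: comp_fun_def)
  finally show ?thesis .
qed

lemma mk_fun_eqI:
  assumes "arity f = n" and "\<And>a. length a = n \<Longrightarrow> app f a = F a"
  shows "f = mk_fun n F"
proof -
  have n: "n \<ge> 1" using assms(1) arity_ge_1 by blast
  show ?thesis
    using assms
    by (intro boolfun_eqI) (simp_all add: arity_mk_fun [OF n] app_mk_fun [OF n])
qed

lemma Lambda_clone_explicit:
  "Lambda_clone =
     {f. (\<exists>c. \<forall>a. length a = arity f \<longrightarrow> app f a = c) \<or>
         (\<exists>S. S \<noteq> {} \<and> S \<subseteq> {..<arity f} \<and>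
            (\<forall>a. length a = arity f \<longrightarrow> app f a = (\<forall>i\<in>S. a ! i)))}"
  (is "_ = ?D")
  unfolding Lambda_clone_def
proof (rule polynomial_operations_eqI)
  have D: "f \<in> ?D \<longleftrightarrow> (\<exists>S c. S \<subseteq> {..<arity f} \<and>
      (\<forall>a. length a = arity f \<longrightarrow> app f a = (c \<and> (\<forall>i\<in>S. a ! i))))" for f
  proof
    assume "f \<in> ?D"
    then show "\<exists>S c. S \<subseteq> {..<arity f} \<and>
      (\<forall>a. length a = arity f \<longrightarrow> app f a = (c \<and> (\<forall>i\<in>S. a ! i)))"
    proof (elim CollectE disjE exE conjE)
      fix c assume "\<forall>a. length a = arity f \<longrightarrow> app f a = c"
      then show ?thesis by (intro exI [of _ "{}"] exI [of _ c]) auto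
    next
      fix S assume "S \<subseteq> {..<arity f}" "\<forall>a. length a = arity f \<longrightarrow> app f a = (\<forall>i\<in>S. a ! i)"
      then show ?thesis by (intro exI [of _ S] exI [of _ True]) auto
    qed
  next
    assume "\<exists>S c. S \<subseteq> {..<arity f} \<and>
      (\<forall>a. length a = arity f \<longrightarrow> app f a = (c \<and> (\<forall>i\<in>S. a ! i)))"
    then obtain S c where S: "S \<subseteq> {..<arity f}"
      "\<forall>a. length a = arity f \<longrightarrow> app f a = (c \<and> (\<forall>i\<in>S. a ! i))" by blast
    show "f \<in> ?D"
    proof (cases "c \<and> S \<noteq> {}")
      case False
      then show ?thesis using S by auto
    next
      case True
      then show ?thesis using S by (intro CollectI disjI2 exI [of _ S]) simp
    qed
  qed
  show "clone ?D"
    unfolding clone_def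
  proof (intro conjI ballI allI impI)
    fix n i :: nat assume "1 \<le> n" "i < n"
    then show "proj n i \<in> ?D"
      unfolding D by (intro exI [of _ "{i}"] exI [of _ True]) (auto simp: proj_def)
  next
    fix f n gs
    assume f: "f \<in> ?D" and n: "1 \<le> n" and gs: "length gs = arity f"
      and g: "\<forall>g\<in>set gs. g \<in> ?D \<and> arity g = n"
    obtain S c where S: "S \<subseteq> {..<arity f}"
      "\<And>a. length a = arity f \<Longrightarrow> app f a = (c \<and> (\<forall>i\<in>S. a ! i))"
      using f unfolding D by blast
    have "\<forall>g\<in>set gs. \<exists>T d. T \<subseteq> {..<n} \<and> (\<forall>a. length a = n \<longrightarrow> app g a = (d \<and> (\<forall>i\<in>T. a ! i)))"
      using g unfolding D by (intro ballI) (drule (1) bspec, elim conjE, simp)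
    then obtain T d where T: "\<And>g. g \<in> set gs \<Longrightarrow> T g \<subseteq> {..<n}"
      "\<And>g a. g \<in> set gs \<Longrightarrow> length a = n \<Longrightarrow> app g a = (d g \<and> (\<forall>i\<in>T g. a ! i))"
      by metis
    have gsS: "gs ! i \<in> set gs" "i < length gs" if "i \<in> S" for i
      using that S(1) gs by auto
    show "comp_fun n f gs \<in> ?D"
      unfolding D
    proof (intro exI conjI allI impI)
      show "(\<Union>i\<in>S. T (gs ! i)) \<subseteq> {..<arity (comp_fun n f gs)}"
        using T(1) gsS n by (force simp: comp_fun_def)
      fix a :: "bool list" assume "length a = arity (comp_fun n f gs)"
      then have a: "length a = n" using n by (simp add: comp_fun_def)
      show "app (comp_fun n f gs) a =
        ((c \<and> (\<forall>i\<in>S. d (gs ! i))) \<and> (\<forall>i\<in>(\<Union>i\<in>S. T (gs ! i)). a ! i))"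
        using a n gs gsS T(2) by (auto simp: comp_fun_def S(2))
    qed
  qed
  show "meet_op \<in> ?D"
    unfolding D by (intro exI [of _ "{0, 1}"] exI [of _ True]) (auto simp: meet_op_def)
  show "const_fun n c \<in> ?D" if "n \<ge> 1" for n c
    using that by (auto simp: const_fun_def)
  fix C f
  assume C: "clone C" "meet_op \<in> C" and con: "\<forall>n\<ge>1. \<forall>c. const_fun n c \<in> C" and f: "f \<in> ?D"
  define n where "n = arity f"
  have n: "n \<ge> 1" using arity_ge_1 n_def by simp
  obtain S c where S: "S \<subseteq> {..<n}"
    "\<And>a. length a = n \<Longrightarrow> app f a = (c \<and> (\<forall>i\<in>S. a ! i))"
    using f unfolding D n_def by blast
  have "finite S" using S(1) finite_subset by blast
  then have "mk_fun n (\<lambda>a. c \<and> (\<forall>i\<in>S. a ! i)) \<in> C"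
    using S(1)
  proof (induction S)
    case empty
    then show ?case using con n by (simp add: const_fun_def)
  next
    case (insert j S)
    have "mk_fun n (\<lambda>a. a ! j \<and> (c \<and> (\<forall>i\<in>S. a ! i))) \<in> C"
    proof (rule clone_comp2 [of C "(\<and>)"])
      show "mk_fun 2 (\<lambda>a. a ! 0 \<and> a ! 1) \<in> C"
        using C(2) by (simp add: meet_op_def)
      show "mk_fun n (\<lambda>a. a ! j) \<in> C"
        using C(1) insert.prems by (intro clone_proj) auto
    qed (use C insert n in simp_all)
    moreover have "(\<lambda>a. a ! j \<and> (c \<and> (\<forall>i\<in>S. a ! i))) = (\<lambda>a. c \<and> (\<forall>i\<in>insert j S. a ! i))"
      by auto
    ultimately show ?case by simp
  qed
  moreover have "f = mk_fun n (\<lambda>a. c \<and> (\<forall>i\<in>S. a ! i))"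
    using S(2) n_def by (intro mk_fun_eqI) auto
  ultimately show "f \<in> C" by simp
qed

lemma V_clone_explicit:
  "V_clone =
     {f. (\<exists>c. \<forall>a. length a = arity f \<longrightarrow> app f a = c) \<or>
         (\<exists>S. S \<noteq> {} \<and> S \<subseteq> {..<arity f} \<and>
            (\<forall>a. length a = arity f \<longrightarrow> app f a = (\<exists>i\<in>S. a ! i)))}"
  (is "_ = ?D")
  unfolding V_clone_def
proof (rule polynomial_operations_eqI)
  have D: "f \<in> ?D \<longleftrightarrow> (\<exists>S c. S \<subseteq> {..<arity f} \<and>
      (\<forall>a. length a = arity f \<longrightarrow> app f a = (c \<or> (\<exists>i\<in>S. a ! i))))" for f
  proof
    assume "f \<in> ?D"
    then show "\<exists>S c. S \<subseteq> {..<arity f} \<and>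
      (\<forall>a. length a = arity f \<longrightarrow> app f a = (c \<or> (\<exists>i\<in>S. a ! i)))"
    proof (elim CollectE disjE exE conjE)
      fix c assume "\<forall>a. length a = arity f \<longrightarrow> app f a = c"
      then show ?thesis by (intro exI [of _ "{}"] exI [of _ c]) auto
    next
      fix S assume "S \<subseteq> {..<arity f}" "\<forall>a. length a = arity f \<longrightarrow> app f a = (\<exists>i\<in>S. a ! i)"
      then show ?thesis by (intro exI [of _ S] exI [of _ False]) auto
    qed
  next
    assume "\<exists>S c. S \<subseteq> {..<arity f} \<and>
      (\<forall>a. length a = arity f \<longrightarrow> app f a = (c \<or> (\<exists>i\<in>S. a ! i)))"
    then obtain S c where S: "S \<subseteq> {..<arity f}"
      "\<forall>a. length a = arity f \<longrightarrow> app f a = (c \<or> (\<exists>i\<in>S. a ! i))" by blast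
    show "f \<in> ?D"
    proof (cases "\<not> c \<and> S \<noteq> {}")
      case False
      then show ?thesis using S by auto
    next
      case True
      then show ?thesis using S by (intro CollectI disjI2 exI [of _ S]) simp
    qed
  qed
  show "clone ?D"
    unfolding clone_def
  proof (intro conjI ballI allI impI)
    fix n i :: nat assume "1 \<le> n" "i < n"
    then show "proj n i \<in> ?D"
      unfolding D by (intro exI [of _ "{i}"] exI [of _ False]) (auto simp: proj_def)
  next
    fix f n gs
    assume f: "f \<in> ?D" and n: "1 \<le> n" and gs: "length gs = arity f"
      and g: "\<forall>g\<in>set gs. g \<in> ?D \<and> arity g = n"
    obtain S c where S: "S \<subseteq> {..<arity f}"
      "\<And>a. length a = arity f \<Longrightarrow> app f a = (c \<or> (\<exists>i\<in>S. a ! i))"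
      using f unfolding D by blast
    have "\<forall>g\<in>set gs. \<exists>T d. T \<subseteq> {..<n} \<and> (\<forall>a. length a = n \<longrightarrow> app g a = (d \<or> (\<exists>i\<in>T. a ! i)))"
      using g unfolding D by (intro ballI) (drule (1) bspec, elim conjE, simp)
    then obtain T d where T: "\<And>g. g \<in> set gs \<Longrightarrow> T g \<subseteq> {..<n}"
      "\<And>g a. g \<in> set gs \<Longrightarrow> length a = n \<Longrightarrow> app g a = (d g \<or> (\<exists>i\<in>T g. a ! i))"
      by metis
    have gsS: "gs ! i \<in> set gs" "i < length gs" if "i \<in> S" for i
      using that S(1) gs by auto
    show "comp_fun n f gs \<in> ?D"
      unfolding D
    proof (intro exI conjI allI impI)
      show "(\<Union>i\<in>S. T (gs ! i)) \<subseteq> {..<arity (comp_fun n f gs)}"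
        using T(1) gsS n by (force simp: comp_fun_def)
      fix a :: "bool list" assume "length a = arity (comp_fun n f gs)"
      then have a: "length a = n" using n by (simp add: comp_fun_def)
      show "app (comp_fun n f gs) a =
        ((c \<or> (\<exists>i\<in>S. d (gs ! i))) \<or> (\<exists>i\<in>(\<Union>i\<in>S. T (gs ! i)). a ! i))"
        using a n gs gsS T(2) by (auto simp: comp_fun_def S(2))
    qed
  qed
  show "join_op \<in> ?D"
    unfolding D by (intro exI [of _ "{0, 1}"] exI [of _ False]) (auto simp: join_op_def)
  show "const_fun n c \<in> ?D" if "n \<ge> 1" for n c
    using that by (auto simp: const_fun_def)
  fix C f
  assume C: "clone C" "join_op \<in> C" and con: "\<forall>n\<ge>1. \<forall>c. const_fun n c \<in> C" and f: "f \<in> ?D"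
  define n where "n = arity f"
  have n: "n \<ge> 1" using arity_ge_1 n_def by simp
  obtain S c where S: "S \<subseteq> {..<n}"
    "\<And>a. length a = n \<Longrightarrow> app f a = (c \<or> (\<exists>i\<in>S. a ! i))"
    using f unfolding D n_def by blast
  have "finite S" using S(1) finite_subset by blast
  then have "mk_fun n (\<lambda>a. c \<or> (\<exists>i\<in>S. a ! i)) \<in> C"
    using S(1)
  proof (induction S)
    case empty
    then show ?case using con n by (simp add: const_fun_def)
  next
    case (insert j S)
    have "mk_fun n (\<lambda>a. a ! j \<or> (c \<or> (\<exists>i\<in>S. a ! i))) \<in> C"
    proof (rule clone_comp2 [of C "(\<or>)"])
      show "mk_fun 2 (\<lambda>a. a ! 0 \<or> a ! 1) \<in> C"
        using C(2) by (simp add: join_op_def)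
      show "mk_fun n (\<lambda>a. a ! j) \<in> C"
        using C(1) insert.prems by (intro clone_proj) auto
    qed (use C insert n in simp_all)
    moreover have "(\<lambda>a. a ! j \<or> (c \<or> (\<exists>i\<in>S. a ! i))) = (\<lambda>a. c \<or> (\<exists>i\<in>insert j S. a ! i))"
      by auto
    ultimately show ?case by simp
  qed
  moreover have "f = mk_fun n (\<lambda>a. c \<or> (\<exists>i\<in>S. a ! i))"
    using S(2) n_def by (intro mk_fun_eqI) auto
  ultimately show "f \<in> C" by simp
qed

lemma odd_card_sym_diff:
  assumes "finite S" "finite T"
  shows "odd (card {i \<in> (S - T) \<union> (T - S). P i}) \<longleftrightarrow>
    (odd (card {i \<in> S. P i}) \<noteq> odd (card {i \<in> T. P i}))"
proof -
  let ?A = "{i \<in> S - T. P i}" and ?B = "{i \<in> T - S. P i}" and ?I = "{i \<in> S \<inter> T. P i}"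
  have "{i \<in> (S - T) \<union> (T - S). P i} = ?A \<union> ?B" "{i \<in> S. P i} = ?A \<union> ?I"
    "{i \<in> T. P i} = ?B \<union> ?I" by auto
  moreover have "card (?A \<union> ?B) = card ?A + card ?B" "card (?A \<union> ?I) = card ?A + card ?I"
    "card (?B \<union> ?I) = card ?B + card ?I"
    using assms by (intro card_Un_disjoint; auto)+
  ultimately show ?thesis by (simp only: even_add) blast
qed

lemma odd_card_insert:
  assumes "finite S" "j \<notin> S"
  shows "odd (card {i \<in> insert j S. P i}) \<longleftrightarrow> (P j \<noteq> odd (card {i \<in> S. P i}))"
proof -
  have "{i \<in> insert j S. P i} = (if P j then insert j {i \<in> S. P i} else {i \<in> S. P i})"
    by auto
  then show ?thesis using assms by simp
qed

lemma L_clone_explicit: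
  "L_clone =
     {f. \<exists>S c. S \<subseteq> {..<arity f} \<and>
           (\<forall>a. length a = arity f \<longrightarrow> app f a = (c \<noteq> odd (card {i \<in> S. a ! i})))}"
  (is "_ = ?D")
  unfolding L_clone_def
proof (rule polynomial_operations_eqI)
  show "clone ?D"
    unfolding clone_def
  proof (intro conjI ballI allI impI)
    fix n i :: nat assume "1 \<le> n" "i < n"
    then show "proj n i \<in> ?D"
      by (intro CollectI exI [of _ "{i}"] exI [of _ False])
        (auto simp: proj_def odd_card_insert simp del: insert_iff)
  next
    fix f n gs
    assume f: "f \<in> ?D" and n: "1 \<le> n" and gs: "length gs = arity f"
      and g: "\<forall>g\<in>set gs. g \<in> ?D \<and> arity g = n"
    obtain S c where S: "S \<subseteq> {..<arity f}"
      "\<And>a. length a = arity f \<Longrightarrow> app f a = (c \<noteq> odd (card {i \<in> S. a ! i}))"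
      using f by blast
    have "finite S" using S(1) finite_subset by blast
    then have "\<exists>T d. T \<subseteq> {..<n} \<and> (\<forall>a. length a = n \<longrightarrow>
        (c \<noteq> odd (card {i \<in> S. app (gs ! i) a})) = (d \<noteq> odd (card {i \<in> T. a ! i})))"
      using S(1)
    proof (induction S)
      case empty
      show ?case by (intro exI [of _ "{}"] exI [of _ c]) auto
    next
      case (insert j S)
      then obtain T d where T: "T \<subseteq> {..<n}" "\<And>a. length a = n \<Longrightarrow>
        (c \<noteq> odd (card {i \<in> S. app (gs ! i) a})) = (d \<noteq> odd (card {i \<in> T. a ! i}))"
        by auto
      have "gs ! j \<in> set gs" using insert.prems gs by simp
      with g have "gs ! j \<in> ?D \<and> arity (gs ! j) = n" by (rule bspec)
      then obtain U e where U: "U \<subseteq> {..<n}" "\<And>a. length a = n \<Longrightarrow>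
        app (gs ! j) a = (e \<noteq> odd (card {i \<in> U. a ! i}))"
        by auto
      have fin: "finite T" "finite U" using T(1) U(1) finite_subset by blast+
      show ?case
      proof (intro exI conjI allI impI)
        show "(T - U) \<union> (U - T) \<subseteq> {..<n}" using T(1) U(1) by auto
        fix a :: "bool list" assume a: "length a = n"
        show "(c \<noteq> odd (card {i \<in> insert j S. app (gs ! i) a})) =
          ((d \<noteq> e) \<noteq> odd (card {i \<in> (T - U) \<union> (U - T). a ! i}))"
          unfolding odd_card_sym_diff [OF fin] odd_card_insert [OF insert.hyps]
          using T(2) [OF a] U(2) [OF a] by blast
      qed
    qed
    moreover have "app (comp_fun n f gs) a = (c \<noteq> odd (card {i \<in> S. app (gs ! i) a}))"
      if "length a = n" for a
    proof -
      have "{i \<in> S. map (\<lambda>g. app g a) gs ! i} = {i \<in> S. app (gs ! i) a}"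
        using S(1) gs by auto
      then show ?thesis using that n gs by (simp add: comp_fun_def S(2))
    qed
    ultimately show "comp_fun n f gs \<in> ?D"
      using n by (simp add: comp_fun_def)
  qed
  show "add_op \<in> ?D"
  proof (intro CollectI exI conjI allI impI)
    show "{0, 1} \<subseteq> {..<arity add_op}" by (simp add: add_op_def)
    fix a :: "bool list" assume "length a = arity add_op"
    then show "app add_op a = (False \<noteq> odd (card {i \<in> {0, 1}. a ! i}))"
      using odd_card_insert [of "{1}" 0 "(!) a"] odd_card_insert [of "{}" 1 "(!) a"]
      by (simp add: add_op_def)
  qed
  show "const_fun n c \<in> ?D" if "n \<ge> 1" for n c
    using that by (intro CollectI exI [of _ "{}"] exI [of _ c]) (auto simp: const_fun_def)
  fix C f
  assume C: "clone C" "add_op \<in> C" and con: "\<forall>n\<ge>1. \<forall>c. const_fun n c \<in> C" and f: "f \<in> ?D"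
  define n where "n = arity f"
  have n: "n \<ge> 1" using arity_ge_1 n_def by simp
  obtain S c where S: "S \<subseteq> {..<n}"
    "\<And>a. length a = n \<Longrightarrow> app f a = (c \<noteq> odd (card {i \<in> S. a ! i}))"
    using f unfolding n_def by blast
  have "finite S" using S(1) finite_subset by blast
  then have "mk_fun n (\<lambda>a. c \<noteq> odd (card {i \<in> S. a ! i})) \<in> C"
    using S(1)
  proof (induction S)
    case empty
    then show ?case using con n by (simp add: const_fun_def)
  next
    case (insert j S)
    have "mk_fun n (\<lambda>a. a ! j \<noteq> (c \<noteq> odd (card {i \<in> S. a ! i}))) \<in> C"
    proof (rule clone_comp2 [of C "(\<noteq>)"])
      show "mk_fun 2 (\<lambda>a. a ! 0 \<noteq> a ! 1) \<in> C"
        using C(2) by (simp add: add_op_def)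
      show "mk_fun n (\<lambda>a. a ! j) \<in> C"
        using C(1) insert.prems by (intro clone_proj) auto
    qed (use C insert n in simp_all)
    moreover have "(\<lambda>a. a ! j \<noteq> (c \<noteq> odd (card {i \<in> S. a ! i}))) =
        (\<lambda>a. c \<noteq> odd (card {i \<in> insert j S. a ! i}))"
      unfolding odd_card_insert [OF insert.hyps] by blast
    ultimately show ?case by simp
  qed
  moreover have "f = mk_fun n (\<lambda>a. c \<noteq> odd (card {i \<in> S. a ! i}))"
    using S(2) n_def by (intro mk_fun_eqI) auto
  ultimately show "f \<in> C" by simp
qed

end

theory Submission
  imports Defs
begin

text \<open>
  Affine functions and conjunctions are recognised from their cards: \<open>f \<in> L\<close> (respectively
  \<open>f \<in> \<Lambda>\<close>) means that \<open>f\<close> preserves \<open>x + y + z\<close> (respectively \<open>\<and>\<close>), and from arity 4 on this can be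
  tested on tuples with two equal entries. A member is then determined, up to equivalence, by
  its constant and its number \<open>s\<close> of essential arguments, whereas identifying two arguments leaves
  \<open>s\<close>, or \<open>s - 2\<close> (respectively \<open>s - 1\<close>) if both are essential.

  A clone outside the three contains the majority function, \<open>x \<and> (y \<or> z)\<close> or \<open>x \<or> (y \<and> z)\<close>, hence
  every self-dual monotone function, or every monotone function other than \<open>0\<close> below a
  projection, or dually. Both classes contain pairs built as follows. Arrange \<open>2 m\<close> arguments,
  \<open>m\<close> odd, into \<open>m\<close> pairs, and let \<open>H b\<close> consist of all transversals of the pairs whose number of
  second elements has parity \<open>b\<close>, together with \<open>m\<close> further sets \<open>edge s\<close> of size \<open>m\<close>, where
  \<open>edge s\<close> contains the first element of the pair \<open>s\<close> and otherwise only whole pairs. Exchanging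
  the elements of the pair \<open>s\<close> turns one parity into the other and moves no set except \<open>edge s\<close>, and
  \<open>edge s\<close> disappears when two arguments separated by it are identified; identifying the elements of
  one pair destroys all transversals. So the functions that are true above level \<open>m\<close> and outside
  \<open>H b\<close> on level \<open>m\<close> have the same identification minors for both \<open>b\<close>.
\<close>


subsection \<open>Evaluation and minors\<close>

text \<open>Assignments on all of \<open>nat\<close> replace tuples, and only positions below the
  arity are read. Taking a minor then is composition with a map of positions, free of length
  conditions.\<close>

definition fval :: "boolfun \<Rightarrow> (nat \<Rightarrow> bool) \<Rightarrow> bool" where
  "fval f x = app f (map x [0..<arity f])"

lemma fval_mk_fun [simp]: "n \<ge> 1 \<Longrightarrow> fval (mk_fun n F) x \<longleftrightarrow> F (map x [0..<n])"
  by (simp add: fval_def)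

lemma app_eq_fval: "length a = arity f \<Longrightarrow> app f a = fval f (\<lambda>i. a ! i)"
  unfolding fval_def by (metis map_nth)

lemma fval_cong: "(\<And>i. i < arity f \<Longrightarrow> x i = y i) \<Longrightarrow> fval f x = fval f y"
  unfolding fval_def by (auto intro!: arg_cong [of _ _ "app f"])

lemma fval_eqI: "arity f = arity g \<Longrightarrow> (\<And>x. fval f x = fval g x) \<Longrightarrow> f = g"
  by (intro boolfun_eqI) (simp_all add: app_eq_fval)

lemma eq_mk_fun_fval: "f = mk_fun (arity f) (\<lambda>a. fval f (\<lambda>i. a ! i))"
  by (intro mk_fun_eqI) (simp_all add: app_eq_fval)

lemma minor_iff:
  "minor f g \<longleftrightarrow>
    (\<exists>\<sigma>. \<sigma> ` {..<arity g} \<subseteq> {..<arity f} \<and> (\<forall>x. fval f x = fval g (\<lambda>k. x (\<sigma> k))))"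
  unfolding minor_def
proof -
  have "(\<forall>a. length a = arity f \<longrightarrow> app f a = app g (tuple_map a (arity g) \<sigma>)) \<longleftrightarrow>
    (\<forall>x. fval f x = fval g (\<lambda>k. x (\<sigma> k)))"
    if \<sigma>: "\<sigma> ` {..<arity g} \<subseteq> {..<arity f}" for \<sigma>
  proof -
    have tm: "app g (tuple_map (map x [0..<arity f]) (arity g) \<sigma>) = fval g (\<lambda>k. x (\<sigma> k))" for x
    proof -
      have "tuple_map (map x [0..<arity f]) (arity g) \<sigma> = map (\<lambda>k. x (\<sigma> k)) [0..<arity g]"
        using \<sigma> by (auto simp: tuple_map_def image_subset_iff)
      then show ?thesis by (simp add: fval_def)
    qed
    show ?thesis
    proof (rule iffI; intro allI impI)
      fix x assume "\<forall>a. length a = arity f \<longrightarrow> app f a = app g (tuple_map a (arity g) \<sigma>)"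
      then have "app f (map x [0..<arity f]) = app g (tuple_map (map x [0..<arity f]) (arity g) \<sigma>)"
        by simp
      then show "fval f x = fval g (\<lambda>k. x (\<sigma> k))" using tm by (simp add: fval_def)
    next
      fix a :: "bool list" assume *: "\<forall>x. fval f x = fval g (\<lambda>k. x (\<sigma> k))" and a: "length a = arity f"
      have "a = map ((!) a) [0..<arity f]" using a by (metis map_nth)
      then show "app f a = app g (tuple_map a (arity g) \<sigma>)"
        using * tm [of "(!) a"] a by (simp add: app_eq_fval)
    qed
  qed
  then show "(\<exists>\<sigma>. \<sigma> ` {..<arity g} \<subseteq> {..<arity f} \<and>
      (\<forall>a. length a = arity f \<longrightarrow> app f a = app g (tuple_map a (arity g) \<sigma>))) \<longleftrightarrow>
    (\<exists>\<sigma>. \<sigma> ` {..<arity g} \<subseteq> {..<arity f} \<and> (\<forall>x. fval f x = fval g (\<lambda>k. x (\<sigma> k))))"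
    by blast
qed

lemma minorI:
  assumes "\<And>k. k < arity g \<Longrightarrow> \<sigma> k < arity f" "\<And>x. fval f x = fval g (\<lambda>k. x (\<sigma> k))"
  shows "minor f g"
  unfolding minor_iff using assms by (intro exI [of _ \<sigma>]) auto

lemma minorE:
  assumes "minor f g"
  obtains \<sigma> where "\<And>k. k < arity g \<Longrightarrow> \<sigma> k < arity f" "\<And>x. fval f x = fval g (\<lambda>k. x (\<sigma> k))"
  using assms unfolding minor_iff by (auto simp: image_subset_iff)

lemma equivalent_refl: "equivalent f f"
  unfolding equivalent_def by (auto intro: minorI [of _ id])

lemma equivalent_sym: "equivalent f g \<Longrightarrow> equivalent g f"
  by (simp add: equivalent_def)

section \<open>Identification minors and comparison of cards\<close>

definition merge :: "nat \<Rightarrow> nat \<Rightarrow> nat \<Rightarrow> nat" where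
  "merge i j k = (if k < j then k else if k = j then i else k - 1)"

lemma arity_ident_minor: "arity f \<ge> 2 \<Longrightarrow> arity (ident_minor f I) = arity f - 1"
  by (simp add: ident_minor_def Let_def)

lemma fval_ident_minor:
  assumes "i < j" "j < arity f"
  shows "fval (ident_minor f {i, j}) x = fval f (\<lambda>k. x (merge i j k))"
proof -
  have "take j (map x [0..<arity f - 1]) @ [map x [0..<arity f - 1] ! i] @
      drop j (map x [0..<arity f - 1]) = map (\<lambda>k. x (merge i j k)) [0..<arity f]" (is "?l = ?r")
  proof (rule nth_equalityI)
    show "length ?l = length ?r" using assms by auto
    fix k assume "k < length ?l"
    then have "k < arity f" using assms by auto
    then show "?l ! k = ?r ! k"
      using assms by (auto simp: nth_append merge_def nth_Cons')
  qed
  moreover have "Min {i, j} = i" "Max {i, j} = j" using assms by auto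
  ultimately show ?thesis
    using assms by (simp add: ident_minor_def Let_def fval_def del: append_Cons append_Nil)
qed

lemma pairsE:
  assumes "I \<in> pairs n"
  obtains i j where "i < j" "j < n" "I = {i, j}"
proof -
  from assms obtain a b where "I = {a, b}" "a \<noteq> b" "a < n" "b < n"
    by (auto simp: pairs_def card_2_iff)
  then show ?thesis using that [of a b] that [of b a] by (cases "a < b") auto
qed

lemma pairsI: "i < n \<Longrightarrow> j < n \<Longrightarrow> i \<noteq> j \<Longrightarrow> {i, j} \<in> pairs n"
  by (auto simp: pairs_def)

lemma merge_less: "i < j \<Longrightarrow> j < n \<Longrightarrow> k < n \<Longrightarrow> merge i j k < n - 1"
  by (auto simp: merge_def)

text \<open>A section of \<open>merge i j\<close>: it lists the positions other than
  \<open>j\<close> in increasing order, so that position \<open>j\<close> of the original tuple is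
  represented by \<open>i\<close>.\<close>

definition skip :: "nat \<Rightarrow> nat \<Rightarrow> nat" where
  "skip j k = (if k < j then k else Suc k)"

lemma skip_merge: "i < j \<Longrightarrow> skip j (merge i j k) = (if k = j then i else k)"
  by (auto simp: skip_def merge_def)

text \<open>The rearrangement \<open>p\<close> descends to the cards because it fixes both
  identified positions; the map of positions is \<open>p\<close> transported along
  \<open>skip\<close> and \<open>merge\<close>.\<close>

lemma minor_ident_minorI:
  assumes f: "arity f = n" and g: "arity g = n" and ij: "i < j" "j < n"
    and p: "p i = i" "p j = j" "\<And>k. k < n \<Longrightarrow> p k < n"
    and fg: "\<And>x. x i = x j \<Longrightarrow> fval f x = fval g (\<lambda>k. x (p k))"
  shows "minor (ident_minor f {i, j}) (ident_minor g {i, j})"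
proof (rule minorI [where \<sigma> = "\<lambda>k. merge i j (p (skip j k))"])
  fix k assume "k < arity (ident_minor g {i, j})"
  then have "k < n - 1" using g ij by (simp add: arity_ident_minor)
  then have "skip j k < n" using ij by (auto simp: skip_def)
  then show "merge i j (p (skip j k)) < arity (ident_minor f {i, j})"
    using f ij p merge_less by (simp add: arity_ident_minor)
next
  fix x
  \<comment> \<open>Passing through \<open>skip\<close> affects only \<open>k = j\<close>, which
    becomes \<open>i\<close>; both positions are fixed by \<open>p\<close>, and
    \<open>merge i j\<close> sends both to \<open>i\<close>.\<close>
  have m: "merge i j (p (skip j (merge i j k))) = merge i j (p k)" for k
    using ij p by (simp add: skip_merge) (simp add: merge_def)
  have "fval (ident_minor f {i, j}) x = fval g (\<lambda>k. x (merge i j (p k)))"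
    using fval_ident_minor [OF ij(1), of f x] fg [of "\<lambda>k. x (merge i j k)"] f ij
    by (simp add: merge_def)
  also have "\<dots> = fval (ident_minor g {i, j}) (\<lambda>k. x (merge i j (p (skip j k))))"
    using fval_ident_minor [OF ij(1), of g] g ij by (simp add: m)
  finally show "fval (ident_minor f {i, j}) x =
    fval (ident_minor g {i, j}) (\<lambda>k. x (merge i j (p (skip j k))))" .
qed

text \<open>A tuple with equal entries at \<open>i\<close> and \<open>j\<close> is recovered after
  deleting entry \<open>j\<close>, so values of \<open>f\<close> on such tuples are values of the
  card.\<close>

lemma fval_via_ident_minor:
  assumes "i < j" "j < arity f" "x i = x j"
  shows "fval f x = fval (ident_minor f {i, j}) (\<lambda>k. x (skip j k))"
  unfolding fval_ident_minor [OF assms(1,2)] using assms by (auto simp: skip_merge intro!: fval_cong)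

text \<open>One inclusion of decks, without multiplicities. The positive half of the theorem uses it
  in both directions and never counts how often a card occurs.\<close>

definition same_cards :: "boolfun \<Rightarrow> boolfun \<Rightarrow> bool" where
  "same_cards f g \<longleftrightarrow> arity f = arity g \<and> (\<forall>I\<in>pairs (arity f). \<exists>J\<in>pairs (arity f).
     equivalent (ident_minor f I) (ident_minor g J))"

lemma finite_pairs [simp]: "finite (pairs n)"
  unfolding pairs_def by (rule finite_subset [of _ "Pow {..<n}"]) auto

lemma hypomorphic_same_cards:
  assumes "hypomorphic f g"
  shows "same_cards f g"
  unfolding same_cards_def
proof (intro conjI ballI)
  show ar: "arity f = arity g" using assms by (simp add: hypomorphic_def)
  fix I assume "I \<in> pairs (arity f)"
  then have "{h. equivalent h (ident_minor f I)} \<in># deck g"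
    using assms unfolding hypomorphic_def by (metis (no_types, lifting) deck_def finite_pairs
        finite_set_mset_mset_set image_eqI set_image_mset)
  then obtain J where "J \<in> pairs (arity f)"
    "{h. equivalent h (ident_minor f I)} = {h. equivalent h (ident_minor g J)}"
    unfolding deck_def using ar by auto
  then show "\<exists>J\<in>pairs (arity f). equivalent (ident_minor f I) (ident_minor g J)"
    using equivalent_refl by blast
qed

lemma hypomorphic_sym: "hypomorphic f g \<Longrightarrow> hypomorphic g f"
  by (auto simp: hypomorphic_def)

text \<open>Decks consist of classes, so transitivity of equivalence is what turns equivalent cards
  into equal deck elements.\<close>

lemma strongly_hypomorphic_imp_hypomorphic:
  assumes "strongly_hypomorphic f g"
  shows "hypomorphic f g"
proof -
  have "equivalent a c" if "equivalent a b" "equivalent b c" for a b c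
  proof -
    have "minor a c" if ab: "minor a b" and bc: "minor b c" for a b c
    proof -
      obtain s where s: "\<And>k. k < arity b \<Longrightarrow> s k < arity a" "\<And>x. fval a x = fval b (\<lambda>k. x (s k))"
        using ab by (rule minorE) blast
      obtain t where t: "\<And>k. k < arity c \<Longrightarrow> t k < arity b" "\<And>x. fval b x = fval c (\<lambda>k. x (t k))"
        using bc by (rule minorE) blast
      show ?thesis using s t by (intro minorI [where \<sigma> = "\<lambda>k. s (t k)"]) auto
    qed
    with that show ?thesis by (auto simp: equivalent_def)
  qed
  then have "{h. equivalent h (ident_minor f I)} = {h. equivalent h (ident_minor g I)}"
    if "I \<in> pairs (arity f)" for I
    using assms that equivalent_sym unfolding strongly_hypomorphic_def by blast
  then have "deck f = image_mset (\<lambda>I. {h. equivalent h (ident_minor g I)}) (mset_set (pairs (arity f)))"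
    unfolding deck_def by (intro image_mset_cong) simp
  then have "deck f = deck g" using assms by (simp add: deck_def strongly_hypomorphic_def)
  then show ?thesis using assms by (simp add: hypomorphic_def strongly_hypomorphic_def)
qed


subsection \<open>Duality\<close>

text \<open>Dualising exchanges meet with join and commutes with identification. This reduces
  \<open>V_clone\<close> to \<open>Lambda_clone\<close> and the join case to the meet case.\<close>

definition dual :: "boolfun \<Rightarrow> boolfun" where
  "dual f = mk_fun (arity f) (\<lambda>a. \<not> app f (map Not a))"

lemma arity_dual [simp]: "arity (dual f) = arity f"
  using arity_ge_1 by (simp add: dual_def)

lemma fval_dual [simp]: "fval (dual f) x \<longleftrightarrow> \<not> fval f (\<lambda>i. \<not> x i)"
  using arity_ge_1 by (simp add: dual_def fval_def o_def)

lemma dual_dual [simp]: "dual (dual f) = f"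
  by (intro fval_eqI) simp_all

lemma minor_dual: "minor f g \<Longrightarrow> minor (dual f) (dual g)"
  by (erule minorE) (rule minorI, auto)

lemma equivalent_dual [simp]: "equivalent (dual f) (dual g) \<longleftrightarrow> equivalent f g"
  using minor_dual dual_dual unfolding equivalent_def by metis

lemma ident_minor_dual:
  assumes "I \<in> pairs (arity f)"
  shows "ident_minor (dual f) I = dual (ident_minor f I)"
proof -
  obtain i j where ij: "i < j" "j < arity f" "I = {i, j}" using assms by (rule pairsE)
  then show ?thesis by (intro fval_eqI) (simp_all add: arity_ident_minor fval_ident_minor)
qed

lemma same_cards_dual: "same_cards f g \<Longrightarrow> same_cards (dual f) (dual g)"
  unfolding same_cards_def by (metis arity_dual equivalent_dual ident_minor_dual)

lemma strongly_hypomorphic_dual: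
  "strongly_hypomorphic f g \<Longrightarrow> strongly_hypomorphic (dual f) (dual g)"
  unfolding strongly_hypomorphic_def by (simp add: ident_minor_dual)


subsection \<open>Substitution in clones\<close>

lemma clone_subst:
  assumes "clone C" "f \<in> C" "n \<ge> 1" "\<And>k. k < arity f \<Longrightarrow> mk_fun n (G k) \<in> C"
  shows "mk_fun n (\<lambda>a. fval f (\<lambda>k. G k a)) \<in> C"
proof -
  let ?gs = "map (\<lambda>k. mk_fun n (G k)) [0..<arity f]"
  have "\<forall>gs. length gs = arity f \<longrightarrow> (\<forall>g\<in>set gs. g \<in> C \<and> arity g = n) \<longrightarrow> comp_fun n f gs \<in> C"
    using assms(1-3) unfolding clone_def by blast
  then have "comp_fun n f ?gs \<in> C" using assms by auto
  also have "comp_fun n f ?gs = mk_fun n (\<lambda>a. fval f (\<lambda>k. G k a))"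
    using assms(3) by (intro boolfun_eqI) (auto simp: comp_fun_def fval_def o_def)
  finally show ?thesis .
qed

lemma clone_minor:
  assumes "clone C" "g \<in> C" "minor f g"
  shows "f \<in> C"
proof -
  obtain s where s: "\<And>k. k < arity g \<Longrightarrow> s k < arity f" "\<And>x. fval f x = fval g (\<lambda>k. x (s k))"
    using assms(3) by (rule minorE) blast
  have "mk_fun (arity f) (\<lambda>a. fval g (\<lambda>k. a ! s k)) \<in> C"
    using assms s by (intro clone_subst) (auto intro: clone_proj simp: arity_ge_1 simp del: One_nat_def)
  also have "mk_fun (arity f) (\<lambda>a. fval g (\<lambda>k. a ! s k)) = f"
    using eq_mk_fun_fval [of f] by (simp add: s(2))
  finally show ?thesis .
qed

lemma minor_ident_minor: "I \<in> pairs (arity f) \<Longrightarrow> minor (ident_minor f I) f"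
proof (erule pairsE)
  fix i j assume ij: "i < j" "j < arity f" "I = {i, j}"
  then show "minor (ident_minor f I) f"
    using merge_less [OF ij(1,2)]
    by (intro minorI [where \<sigma> = "merge i j"]) (auto simp: arity_ident_minor fval_ident_minor)
qed

lemma clone_dual:
  assumes "clone C"
  shows "clone (dual ` C)"
  unfolding clone_def
proof (intro conjI ballI allI impI)
  fix n i :: nat assume n: "1 \<le> n" "i < n"
  have "proj n i = dual (proj n i)"
    using n by (intro fval_eqI) (simp_all add: proj_def)
  moreover have "proj n i \<in> C" using n assms by (simp add: clone_def)
  ultimately show "proj n i \<in> dual ` C" by blast
next
  fix f n gs
  assume f: "f \<in> dual ` C" and n: "1 \<le> n" and gs: "length gs = arity f"
    and g: "\<forall>g\<in>set gs. g \<in> dual ` C \<and> arity g = n"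
  have df: "dual f \<in> C" using f by auto
  have dg: "dual (gs ! k) \<in> C" "arity (gs ! k) = n" if "k < arity f" for k
    using g that gs by (metis dual_dual imageE nth_mem)+
  have "mk_fun n (app (dual (gs ! k))) = dual (gs ! k)" if "k < arity f" for k
    using dg that by (intro mk_fun_eqI [symmetric]) auto
  then have "mk_fun n (\<lambda>a. fval (dual f) (\<lambda>k. app (dual (gs ! k)) a)) \<in> C"
    using df dg assms n by (intro clone_subst) auto
  moreover have "comp_fun n f gs = dual (mk_fun n (\<lambda>a. fval (dual f) (\<lambda>k. app (dual (gs ! k)) a)))"
  proof (rule boolfun_eqI)
    fix a :: "bool list" assume "length a = arity (comp_fun n f gs)"
    then have a: "length a = n" using n by (simp add: comp_fun_def)
    have "map (\<lambda>g. app g a) gs = map (\<lambda>k. app (gs ! k) a) [0..<arity f]"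
      using gs by (intro nth_equalityI) auto
    moreover have "app (dual (gs ! k)) (map Not a) \<longleftrightarrow> \<not> app (gs ! k) a" if "k < arity f" for k
      using dg that a n by (simp add: dual_def o_def)
    ultimately show "app (comp_fun n f gs) a =
      app (dual (mk_fun n (\<lambda>a. fval (dual f) (\<lambda>k. app (dual (gs ! k)) a)))) a"
      using n a by (auto simp: comp_fun_def dual_def [of "mk_fun _ _"] fval_def [of f]
          intro!: arg_cong [of _ _ "app f"])
  qed (use n in \<open>simp add: comp_fun_def\<close>)
  ultimately show "comp_fun n f gs \<in> dual ` C" by blast
qed

subsection \<open>Conjunctions and affine functions\<close>

text \<open>The set may be empty, so the constant true function counts as a conjunction and only the
  constant false function is treated apart.\<close>

definition is_conj :: "boolfun \<Rightarrow> nat set \<Rightarrow> bool" where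
  "is_conj f S \<longleftrightarrow> S \<subseteq> {..<arity f} \<and> (\<forall>x. fval f x = (\<forall>i\<in>S. x i))"

definition is_affine :: "boolfun \<Rightarrow> nat set \<Rightarrow> bool \<Rightarrow> bool" where
  "is_affine f S c \<longleftrightarrow> S \<subseteq> {..<arity f} \<and> (\<forall>x. fval f x = (c \<noteq> odd (card {i \<in> S. x i})))"

lemma all_lists_iff:
  assumes "S \<subseteq> {..<arity f}" "\<And>x y. (\<And>i. i \<in> S \<Longrightarrow> x i = y i) \<Longrightarrow> P x = P y"
  shows "(\<forall>a. length a = arity f \<longrightarrow> app f a = P ((!) a)) \<longleftrightarrow> (\<forall>x. fval f x = P x)"
proof (rule iffI; intro allI impI)
  fix x assume *: "\<forall>a. length a = arity f \<longrightarrow> app f a = P ((!) a)"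
  have "fval f x = P ((!) (map x [0..<arity f]))"
    using * [rule_format, of "map x [0..<arity f]"] by (simp add: fval_def)
  also have "\<dots> = P x" using assms(1) by (intro assms(2)) auto
  finally show "fval f x = P x" .
next
  fix a :: "bool list" assume "\<forall>x. fval f x = P x" "length a = arity f"
  then show "app f a = P ((!) a)" by (simp add: app_eq_fval)
qed

lemma Lambda_iff: "f \<in> Lambda_clone \<longleftrightarrow> (\<exists>c. \<forall>x. fval f x = c) \<or> (\<exists>S. S \<noteq> {} \<and> is_conj f S)"
proof -
  have 1: "(\<forall>a. length a = arity f \<longrightarrow> app f a = c) \<longleftrightarrow> (\<forall>x. fval f x = c)" for c
    by (rule all_lists_iff [where P = "\<lambda>_. c" and S = "{}"]) auto
  have 2: "(\<forall>a. length a = arity f \<longrightarrow> app f a = (\<forall>i\<in>S. a ! i)) \<longleftrightarrow> (\<forall>x. fval f x = (\<forall>i\<in>S. x i))"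
    if "S \<subseteq> {..<arity f}" for S
    by (rule all_lists_iff [where P = "\<lambda>x. \<forall>i\<in>S. x i" and S = S]) (use that in auto)
  show ?thesis
    unfolding Lambda_clone_explicit is_conj_def mem_Collect_eq
    by (simp add: 1 2 cong: conj_cong)
qed

lemma L_iff: "f \<in> L_clone \<longleftrightarrow> (\<exists>S c. is_affine f S c)"
proof -
  have 1: "(\<forall>a. length a = arity f \<longrightarrow> app f a = (c \<noteq> odd (card {i \<in> S. a ! i}))) \<longleftrightarrow>
    (\<forall>x. fval f x = (c \<noteq> odd (card {i \<in> S. x i})))"
    if "S \<subseteq> {..<arity f}" for S c
    by (rule all_lists_iff [where P = "\<lambda>x. c \<noteq> odd (card {i \<in> S. x i})" and S = S])
      (use that in \<open>auto cong: conj_cong\<close>)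
  have "(S \<subseteq> {..<arity f} \<and> (\<forall>a. length a = arity f \<longrightarrow> app f a = (c \<noteq> odd (card {i \<in> S. a ! i})))) \<longleftrightarrow>
    is_affine f S c" for S c
    using 1 [of S c] unfolding is_affine_def by (rule conj_cong [OF refl])
  then show ?thesis
    unfolding L_clone_explicit mem_Collect_eq by presburger
qed

lemma Lambda_cases:
  assumes "f \<in> Lambda_clone"
  obtains "\<And>x. \<not> fval f x" | S where "is_conj f S"
proof -
  from assms consider c where "\<And>x. fval f x = c" | S where "is_conj f S"
    unfolding Lambda_iff by auto
  then show ?thesis
  proof cases
    case (1 c)
    then show ?thesis using that(1) that(2) [of "{}"] by (cases c) (auto simp: is_conj_def)
  qed (use that in auto)
qed

lemma in_LambdaI:
  assumes "is_conj f S"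
  shows "f \<in> Lambda_clone"
  using assms unfolding Lambda_iff by (cases "S = {}") (auto simp: is_conj_def)

lemma V_clone_eq: "V_clone = dual ` Lambda_clone"
proof -
  have "f \<in> V_clone \<longleftrightarrow> (\<exists>c. \<forall>x. fval f x = c) \<or>
      (\<exists>S. S \<noteq> {} \<and> S \<subseteq> {..<arity f} \<and> (\<forall>x. fval f x = (\<exists>i\<in>S. x i)))" for f
  proof -
    have 1: "(\<forall>a. length a = arity f \<longrightarrow> app f a = c) \<longleftrightarrow> (\<forall>x. fval f x = c)" for c
      by (rule all_lists_iff [where P = "\<lambda>_. c" and S = "{}"]) auto
    have 2: "(\<forall>a. length a = arity f \<longrightarrow> app f a = (\<exists>i\<in>S. a ! i)) \<longleftrightarrow> (\<forall>x. fval f x = (\<exists>i\<in>S. x i))"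
      if "S \<subseteq> {..<arity f}" for S
      by (rule all_lists_iff [where P = "\<lambda>x. \<exists>i\<in>S. x i" and S = S]) (use that in auto)
    show ?thesis
      unfolding V_clone_explicit mem_Collect_eq
    by (simp add: 1 2 cong: conj_cong)
  qed
  also have "\<dots> f \<longleftrightarrow> dual f \<in> Lambda_clone" for f
  proof -
    have "(\<exists>c. \<forall>x. fval (dual f) x = c) \<longleftrightarrow> (\<exists>c. \<forall>x. fval f x = c)"
    proof (rule iffI; elim exE)
      fix c assume *: "\<forall>x. fval (dual f) x = c"
      have "fval f x = (\<not> c)" for x using * [rule_format, of "\<lambda>i. \<not> x i"] by auto
      then show "\<exists>c. \<forall>x. fval f x = c" by blast
    next
      fix c assume "\<forall>x. fval f x = c"
      then have "fval (dual f) x = (\<not> c)" for x by simp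
      then show "\<exists>c. \<forall>x. fval (dual f) x = c" by blast
    qed
    moreover have "(\<forall>x. fval (dual f) x = (\<forall>i\<in>S. x i)) \<longleftrightarrow> (\<forall>x. fval f x = (\<exists>i\<in>S. x i))" for S
    proof (rule iffI; rule allI)
      fix x
      assume "\<forall>x. fval (dual f) x = (\<forall>i\<in>S. x i)"
      from this [rule_format, of "\<lambda>i. \<not> x i"] show "fval f x = (\<exists>i\<in>S. x i)" by (simp add: Bex_def Ball_def) blast
    qed simp
    ultimately show ?thesis by (simp add: Lambda_iff is_conj_def)
  qed
  finally have "f \<in> V_clone \<longleftrightarrow> dual f \<in> Lambda_clone" for f .
  moreover have "f \<in> dual ` Lambda_clone" if "dual f \<in> Lambda_clone" for f
    using imageI [OF that, of dual] by simp
  ultimately show ?thesis by (intro subset_antisym subsetI) auto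
qed

lemma Lambda_meet:
  assumes "f \<in> Lambda_clone"
  shows "fval f (\<lambda>i. x i \<and> y i) \<longleftrightarrow> fval f x \<and> fval f y"
  using assms by (rule Lambda_cases) (auto simp: is_conj_def)

text \<open>An assignment is the meet of the assignments with a single zero, one for each of its
  zeros. Hence a meet-preserving function that holds at the all-true assignment is the conjunction
  of those arguments whose single zero makes it false.\<close>

lemma meet_imp_Lambda:
  assumes meet: "\<And>x y. fval f (\<lambda>i. x i \<and> y i) \<longleftrightarrow> fval f x \<and> fval f y"
  shows "f \<in> Lambda_clone"
proof (cases "fval f (\<lambda>_. True)")
  case False
  then have "\<not> fval f x" for x using meet [of x "\<lambda>_. True"] by simp
  then show ?thesis by (auto simp: Lambda_iff)
next
  case True
  let ?S = "{i. i < arity f \<and> \<not> fval f (\<lambda>k. k \<noteq> i)}"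
  have "fval f (\<lambda>k. k \<notin> X) \<longleftrightarrow> X \<inter> ?S = {}" if "finite X" "X \<subseteq> {..<arity f}" for X
    using that
  proof (induction X)
    case empty
    then show ?case using True by simp
  next
    case (insert a X)
    have "fval f (\<lambda>k. k \<notin> insert a X) \<longleftrightarrow> fval f (\<lambda>k. k \<noteq> a) \<and> fval f (\<lambda>k. k \<notin> X)"
      using meet [of "\<lambda>k. k \<noteq> a" "\<lambda>k. k \<notin> X"] by simp
    then show ?case using insert by auto
  qed
  from this [of "{i. i < arity f \<and> \<not> x i}" for x]
  have "fval f (\<lambda>k. k \<notin> {i. i < arity f \<and> \<not> x i}) \<longleftrightarrow> (\<forall>i\<in>?S. x i)" for x by auto
  moreover have "fval f (\<lambda>k. k \<notin> {i. i < arity f \<and> \<not> x i}) = fval f x" for x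
    by (rule fval_cong) simp
  ultimately have "is_conj f ?S" by (auto simp: is_conj_def)
  then show ?thesis by (rule in_LambdaI)
qed

section \<open>Essential arguments under identification and minors\<close>

lemma merge_image_subset: "i < j \<Longrightarrow> j < n \<Longrightarrow> S \<subseteq> {..<n} \<Longrightarrow> merge i j ` S \<subseteq> {..<n - 1}"
  using merge_less by auto

lemma inj_on_merge: "i < j \<Longrightarrow> \<not> {i, j} \<subseteq> S \<Longrightarrow> inj_on (merge i j) S"
  by (auto simp: inj_on_def merge_def split: if_splits)

lemma is_conj_ident_minor:
  assumes "is_conj f S" "i < j" "j < arity f"
  shows "is_conj (ident_minor f {i, j}) (merge i j ` S)"
  using assms merge_image_subset [of i j "arity f" S]
  by (auto simp: is_conj_def fval_ident_minor arity_ident_minor)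

lemma card_merge_image:
  assumes "i < j" "finite S"
  shows "card (merge i j ` S) = (if {i, j} \<subseteq> S then card S - 1 else card S)"
proof (cases "{i, j} \<subseteq> S")
  case True
  then have "merge i j ` S = merge i j ` (S - {j})"
    using assms(1) by (auto simp: merge_def)
  also have "card \<dots> = card (S - {j})"
    using assms by (intro card_image inj_on_merge) auto
  also have "\<dots> = card S - 1" using True assms(2) by (intro card_Diff_singleton) simp
  finally show ?thesis using True by (simp only: if_True)
next
  case False
  show ?thesis
    unfolding if_not_P [OF False] using inj_on_merge [OF assms(1) False] by (rule card_image)
qed

text \<open>Two identified arguments in \<open>S\<close> cancel modulo 2, so both disappear; in all
  other cases \<open>merge i j\<close> is injective on \<open>S\<close>.\<close>

lemma is_affine_ident_minor:
  assumes S: "is_affine f S c" and ij: "i < j" "j < arity f"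
  obtains S' where "is_affine (ident_minor f {i, j}) S' c"
    "card S' = (if {i, j} \<subseteq> S then card S - 2 else card S)"
proof -
  let ?T = "if {i, j} \<subseteq> S then S - {i, j} else S"
  have fin: "finite S" using S finite_subset by (auto simp: is_affine_def)
  have inj: "inj_on (merge i j) ?T" using ij by (intro inj_on_merge) auto
  have par: "odd (card {k \<in> S. x (merge i j k)}) = odd (card {k \<in> merge i j ` ?T. x k})" for x
  proof -
    have "{k \<in> merge i j ` ?T. x k} = merge i j ` {k \<in> ?T. x (merge i j k)}" by auto
    moreover have "inj_on (merge i j) {k \<in> ?T. x (merge i j k)}"
      using inj by (rule inj_on_subset) blast
    ultimately have c: "card {k \<in> merge i j ` ?T. x k} = card {k \<in> ?T. x (merge i j k)}"
      by (simp only: card_image)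
    show ?thesis
    proof (cases "{i, j} \<subseteq> S")
      case True
      then have S_eq: "insert i (insert j (S - {i, j})) = S" by auto
      have "odd (card {k \<in> insert i (insert j (S - {i, j})). P k}) \<longleftrightarrow>
          (P i \<noteq> (P j \<noteq> odd (card {k \<in> S - {i, j}. P k})))" for P
        using fin ij by (subst odd_card_insert, simp, simp, subst odd_card_insert) simp_all
      from this [of "\<lambda>k. x (merge i j k)"]
      have "odd (card {k \<in> S. x (merge i j k)}) \<longleftrightarrow> odd (card {k \<in> S - {i, j}. x (merge i j k)})"
        unfolding S_eq using ij by (simp only: merge_def [of i j i] merge_def [of i j j] if_True refl less_irrefl if_False) blast
      then show ?thesis using True c by simp
    next
      case False
      show ?thesis using c unfolding if_not_P [OF False] by simp
    qed
  qed
  have "is_affine (ident_minor f {i, j}) (merge i j ` ?T) c"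
    unfolding is_affine_def
  proof (intro conjI allI)
    have "?T \<subseteq> {..<arity f}" using S by (auto simp: is_affine_def)
    then show "merge i j ` ?T \<subseteq> {..<arity (ident_minor f {i, j})}"
      using ij merge_image_subset [of i j "arity f" ?T] by (subst arity_ident_minor) simp_all
    show "fval (ident_minor f {i, j}) x = (c \<noteq> odd (card {k \<in> merge i j ` ?T. x k}))" for x
      using S par [of x]
      by (simp only: fval_ident_minor [OF ij] is_affine_def)
  qed
  moreover have "card (merge i j ` ?T) = (if {i, j} \<subseteq> S then card S - 2 else card S)"
    using inj fin ij by (auto simp: card_image card_Diff_subset)
  ultimately show ?thesis by (rule that)
qed

text \<open>Testing the indicators of \<open>S\<close> and of the image of \<open>T\<close> under
  the map of positions shows that these two sets coincide.\<close>

lemma minor_conj: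
  assumes "is_conj f S" "is_conj g T" "minor f g"
  shows "card S \<le> card T"
proof -
  obtain s where s: "\<And>k. k < arity g \<Longrightarrow> s k < arity f" "\<And>x. fval f x = fval g (\<lambda>k. x (s k))"
    using assms(3) by (rule minorE) blast
  have "(\<forall>i\<in>S. x i) \<longleftrightarrow> (\<forall>i\<in>s ` T. x i)" for x
    using assms(1,2) s(2) [of x] by (simp add: is_conj_def)
  from this [of "\<lambda>i. i \<in> S"] this [of "\<lambda>i. i \<in> s ` T"] have "S = s ` T" by auto
  moreover have "finite T" using assms(2) finite_subset by (auto simp: is_conj_def)
  ultimately show ?thesis using card_image_le by blast
qed

text \<open>The all-false assignment yields the constants. An element of \<open>S\<close> outside
  the image of \<open>T\<close> would be noticed by \<open>f\<close>, but not by \<open>g\<close>,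
  on its own indicator.\<close>

lemma minor_affine:
  assumes "is_affine f S c" "is_affine g T d" "minor f g"
  shows "c = d" "card S \<le> card T"
proof -
  obtain s where s: "\<And>k. k < arity g \<Longrightarrow> s k < arity f" "\<And>x. fval f x = fval g (\<lambda>k. x (s k))"
    using assms(3) by (rule minorE) blast
  have eq: "(c \<noteq> odd (card {i\<in>S. x i})) \<longleftrightarrow> (d \<noteq> odd (card {i\<in>T. x (s i)}))" for x
    using assms(1,2) s(2) [of x] by (simp add: is_affine_def)
  from eq [of "\<lambda>_. False"] show "c = d" by simp
  have "i \<in> s ` T" if "i \<in> S" for i
  proof (rule ccontr)
    assume "i \<notin> s ` T"
    then have T: "{k \<in> T. s k = i} = {}" by auto
    have S: "{k \<in> S. k = i} = {i}" using that by auto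
    show False using eq [of "\<lambda>k. k = i"] \<open>c = d\<close> unfolding S T by simp
  qed
  moreover have "finite T" using assms(2) finite_subset by (auto simp: is_affine_def)
  ultimately show "card S \<le> card T"
    by (meson card_image_le card_mono finite_imageI order_trans subsetI)
qed

lemma conj_minorI:
  assumes "is_conj f S" "is_conj g T" "arity f = arity g" "card S = card T"
  shows "minor f g"
proof -
  have "finite S" "finite T" using assms finite_subset by (auto simp: is_conj_def)
  then obtain b where b: "bij_betw b T S" using assms(4) finite_same_card_bij by metis
  show ?thesis
  \<comment> \<open>Positions outside \<open>T\<close> are inessential, and 0 is a legal target
    because arities are positive.\<close>
  proof (rule minorI [where \<sigma> = "\<lambda>k. if k \<in> T then b k else 0"])
    show "(if k \<in> T then b k else 0) < arity f" for k
      using b assms(1) arity_ge_1 [of f] by (auto simp: is_conj_def bij_betw_def)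
    show "fval f x = fval g (\<lambda>k. x (if k \<in> T then b k else 0))" for x
      using b assms(1,2) by (auto simp: is_conj_def bij_betw_def)
  qed
qed

lemma affine_minorI:
  assumes "is_affine f S c" "is_affine g T c" "arity f = arity g" "card S = card T"
  shows "minor f g"
proof -
  have "finite S" "finite T" using assms finite_subset by (auto simp: is_affine_def)
  then obtain b where b: "bij_betw b T S" using assms(4) finite_same_card_bij by metis
  show ?thesis
  proof (rule minorI [where \<sigma> = "\<lambda>k. if k \<in> T then b k else 0"])
    show "(if k \<in> T then b k else 0) < arity f" for k
      using b assms(1) arity_ge_1 [of f] by (auto simp: is_affine_def bij_betw_def)
    fix x
    have "bij_betw b {k \<in> T. x (b k)} {i \<in> S. x i}"
      using b by (auto simp: bij_betw_def inj_on_def)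
    then have "card {i \<in> S. x i} = card {k \<in> T. x (b k)}"
      by (metis bij_betw_same_card)
    moreover have "{k \<in> T. x (if k \<in> T then b k else 0)} = {k \<in> T. x (b k)}" by auto
    ultimately show "fval f x = fval g (\<lambda>k. x (if k \<in> T then b k else 0))"
      using assms(1,2) by (simp add: is_affine_def)
  qed
qed

text \<open>The drop \<open>\<delta>\<close> is 1 for conjunctions and 2 for affine functions.
  Suppose \<open>S\<close> is the smaller set. If some argument is outside \<open>T\<close>, a pair
  not inside \<open>T\<close> shows the value \<open>card T\<close>, too large for \<open>S\<close>.
  If \<open>T\<close> is everything, all its values are \<open>n - \<delta>\<close>; a pair not
  inside \<open>S\<close> then forces \<open>card S = n - \<delta>\<close>, which is at least 2, and
  a pair inside \<open>S\<close> shows a smaller value.\<close>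

lemma card_determined_by_cards:
  fixes \<delta> :: nat
  assumes n: "n \<ge> 4" and \<delta>: "0 < \<delta>" "\<delta> \<le> 2" and S: "S \<subseteq> {..<n}" and T: "T \<subseteq> {..<n}"
    and ST: "\<And>I. I \<in> pairs n \<Longrightarrow> \<exists>J\<in>pairs n. (if I \<subseteq> S then card S - \<delta> else card S) =
      (if J \<subseteq> T then card T - \<delta> else card T)"
    and TS: "\<And>J. J \<in> pairs n \<Longrightarrow> \<exists>I\<in>pairs n. (if I \<subseteq> S then card S - \<delta> else card S) =
      (if J \<subseteq> T then card T - \<delta> else card T)"
  shows "card T \<le> card S"
proof (rule ccontr)
  assume "\<not> card T \<le> card S"
  then have less: "card S < card T" by simp
  have ex: "\<exists>I\<in>pairs n. \<not> I \<subseteq> U" if "U \<subseteq> {..<n}" "U \<noteq> {..<n}" for U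
  proof -
    obtain j where "j < n" "j \<notin> U" using \<open>U \<subseteq> {..<n}\<close> \<open>U \<noteq> {..<n}\<close> by auto
    moreover have "(if j = 0 then 1 else 0) < n" "(if j = 0 then 1 else 0) \<noteq> j" using n by auto
    ultimately show ?thesis using pairsI by blast
  qed
  show False
  proof (cases "T = {..<n}")
    case False
    then obtain J where "J \<in> pairs n" "\<not> J \<subseteq> T" using ex T by blast
    with TS [of J] obtain I where "(if I \<subseteq> S then card S - \<delta> else card S) = card T" by auto
    then show False using less by (auto split: if_splits)
  next
    case True
    then have all: "J \<subseteq> T" if "J \<in> pairs n" for J using that by (auto simp: pairs_def)
    have "S \<noteq> {..<n}" using less True by auto
    then obtain I where "I \<in> pairs n" "\<not> I \<subseteq> S" using ex S by blast
    with ST [of I] all have cS: "card S = n - \<delta>" using True by auto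
    then have "card S \<ge> 2" using n \<delta> by simp
    then obtain I where I: "I \<subseteq> S" "card I = 2" by (meson obtain_subset_with_card_n)
    then have "I \<in> pairs n" using S by (auto simp: pairs_def)
    with ST [of I] all I True have "card S - \<delta> = n - \<delta>" by auto
    then show False using cS \<delta> \<open>card S \<ge> 2\<close> by simp
  qed
qed

section \<open>Membership in the clones recognised from the cards\<close>

lemma pigeonhole_bool:
  fixes x :: "nat \<Rightarrow> bool"
  assumes "a < n" "b < n" "c < n" "a \<noteq> b" "a \<noteq> c" "b \<noteq> c"
  obtains i j where "i < j" "j < n" "x i = x j" "{i, j} \<subseteq> {a, b, c}"
proof -
  have "\<exists>i j. i \<noteq> j \<and> x i = x j \<and> {i, j} \<subseteq> {a, b, c}"
    using assms by (cases "x a = x b"; cases "x a = x c"; cases "x b = x c") blast+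
  then obtain i j where ij: "i \<noteq> j" "x i = x j" "{i, j} \<subseteq> {a, b, c}" by blast
  then show ?thesis
    using that [of i j] that [of j i] assms by (cases "i < j") (auto simp: insert_commute)
qed

lemma ident_minors_Lambda_meet:
  assumes "\<And>I. I \<in> pairs (arity g) \<Longrightarrow> ident_minor g I \<in> Lambda_clone"
    and "i < arity g" "j < arity g" "i \<noteq> j" "x i = x j" "y i = y j"
  shows "fval g (\<lambda>k. x k \<and> y k) \<longleftrightarrow> fval g x \<and> fval g y"
proof -
  have *: "fval g (\<lambda>k. x k \<and> y k) \<longleftrightarrow> fval g x \<and> fval g y"
    if ij: "i < j" "j < arity g" "x i = x j" "y i = y j" for i j
  proof -
    have "ident_minor g {i, j} \<in> Lambda_clone" using ij by (intro assms(1) pairsI) auto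
    from Lambda_meet [OF this, of "\<lambda>k. x (skip j k)" "\<lambda>k. y (skip j k)"] show ?thesis
      using ij by (simp add: fval_via_ident_minor [of i j g])
  qed
  show ?thesis using * [of i j] * [of j i] assms by (cases "i < j") auto
qed

text \<open>Meets are preserved for two assignments that are both constant on a common pair of
  positions. Monotonicity follows first: among three positions other than the raised one, two carry
  equal values. Where no common pair exists, monotonicity allows raising entries until one
  does.\<close>

lemma ident_minors_in_Lambda:
  assumes n: "arity g \<ge> 4"
    and cards: "\<And>I. I \<in> pairs (arity g) \<Longrightarrow> ident_minor g I \<in> Lambda_clone"
  shows "g \<in> Lambda_clone"
proof (rule meet_imp_Lambda)
  fix x y :: "nat \<Rightarrow> bool"
  have meet: "fval g (\<lambda>k. x k \<and> y k) \<longleftrightarrow> fval g x \<and> fval g y"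
    if "i < arity g" "j < arity g" "i \<noteq> j" "x i = x j" "y i = y j" for i j x y
    using cards that by (rule ident_minors_Lambda_meet)
  have mono1: "fval g u \<longrightarrow> fval g (u(k := True))" for u k
  proof -
    obtain a b c where "a < arity g" "b < arity g" "c < arity g" "a \<noteq> b" "a \<noteq> c" "b \<noteq> c"
      "a \<noteq> k" "b \<noteq> k" "c \<noteq> k"
    proof -
      have "card ({..<4} - {k}) \<ge> 3" by (cases "k < 4") auto
      then obtain A where "A \<subseteq> {..<4} - {k}" "card A = 3" by (meson obtain_subset_with_card_n)
      then obtain p q r where "{p, q, r} \<subseteq> {..<4} - {k}" "p \<noteq> q" "p \<noteq> r" "q \<noteq> r"
        by (auto simp: card_3_iff)
      then show ?thesis using n by (intro that [of p q r]) auto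
    qed
    then obtain i j where ij: "i < j" "j < arity g" "u i = u j" "{i, j} \<subseteq> {a, b, c}"
      using pigeonhole_bool [of a "arity g" b c u] by metis
    then have "i \<noteq> k" "j \<noteq> k" using \<open>a \<noteq> k\<close> \<open>b \<noteq> k\<close> \<open>c \<noteq> k\<close> by auto
    moreover have "(\<lambda>l. u l \<and> (u(k := True)) l) = u" by auto
    ultimately show ?thesis using meet [of i j u "u(k := True)"] ij by auto
  qed
  have mono: "fval g v" if "fval g u" "\<And>i. u i \<Longrightarrow> v i" for u v
  proof -
    have "fval g (\<lambda>k. u k \<or> k \<in> X)" if "finite X" for X
      using that
    proof (induction X)
      case empty
      then show ?case using \<open>fval g u\<close> by simp
    next
      case (insert a X)
      have "(\<lambda>k. u k \<or> k \<in> insert a X) = (\<lambda>k. u k \<or> k \<in> X)(a := True)"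
        by (auto simp: fun_eq_iff)
      then show ?case using insert mono1 by simp
    qed
    from this [of "{i. i < arity g \<and> v i}"]
    have "fval g (\<lambda>k. u k \<or> k \<in> {i. i < arity g \<and> v i})" by simp
    moreover have "fval g (\<lambda>k. u k \<or> k \<in> {i. i < arity g \<and> v i}) = fval g v"
      using that(2) by (intro fval_cong) auto
    ultimately show ?thesis by simp
  qed
  show "fval g (\<lambda>i. x i \<and> y i) \<longleftrightarrow> fval g x \<and> fval g y"
  proof (cases "\<exists>i j. i < arity g \<and> j < arity g \<and> i \<noteq> j \<and> x i = x j \<and> y i = y j")
    case True
    then obtain i j where "i < arity g" "j < arity g" "i \<noteq> j" "x i = x j" "y i = y j" by blast
    then show ?thesis by (rule meet)
  next
    case False
    \<comment> \<open>The arity is 4, and each combination of values of \<open>x\<close> and \<open>y\<close> occurs exactly once.\<close>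
    then have inj: "inj_on (\<lambda>i. (x i, y i)) {..<arity g}" by (auto simp: inj_on_def)
    then have "card ((\<lambda>i. (x i, y i)) ` {..<arity g}) = arity g" by (simp add: card_image)
    moreover have "card ((\<lambda>i. (x i, y i)) ` {..<arity g}) \<le> card (UNIV :: (bool \<times> bool) set)"
      by (intro card_mono) auto
    moreover have UN: "card (UNIV :: (bool \<times> bool) set) = 4"
      by (simp add: card_UNIV_bool UNIV_Times_UNIV [symmetric] card_cartesian_product del: UNIV_Times_UNIV)
    ultimately have "(\<lambda>i. (x i, y i)) ` {..<arity g} = UNIV"
      using n by (intro card_subset_eq) auto
    then have ex: "\<exists>i<arity g. x i = p \<and> y i = q" for p q
    proof -
      have "(p, q) \<in> (\<lambda>i. (x i, y i)) ` {..<arity g}"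
        using \<open>(\<lambda>i. (x i, y i)) ` {..<arity g} = UNIV\<close> by simp
      then show ?thesis by auto
    qed
    obtain a where a: "a < arity g" "x a" "y a" using ex [of True True] by auto
    obtain b where b: "b < arity g" "x b" "\<not> y b" using ex [of True False] by auto
    obtain c where c: "c < arity g" "\<not> x c" "y c" using ex [of False True] by auto
    obtain d where d: "d < arity g" "\<not> x d" "\<not> y d" using ex [of False False] by auto
    have uniq: "i = j" if "i < arity g" "j < arity g" "x i = x j" "y i = y j" for i j
      using False that by blast
    have ne: "a \<noteq> d" "b \<noteq> c" "b \<noteq> d" "c \<noteq> d" using a b c d by auto
    have "fval g (\<lambda>i. x i \<and> y i)" if xy: "fval g x" "fval g y"
    proof -
      \<comment> \<open>As sets of positions, \<open>x\<close> is \<open>{a, b}\<close> and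
        \<open>y\<close> is \<open>{a, c}\<close>. Raised at \<open>d\<close>, each has equal
        entries at \<open>a\<close> and \<open>d\<close>, so \<open>g\<close> holds at
        \<open>{a, d}\<close>. Both this set and \<open>{a, b, c}\<close> have equal entries at
        \<open>b\<close> and \<open>c\<close>, so \<open>g\<close> holds at their meet
        \<open>{a}\<close>.\<close>
      have "fval g (x(d := True))" "fval g (y(d := True))" using mono1 xy by auto
      then have ad: "fval g (\<lambda>k. (x(d := True)) k \<and> (y(d := True)) k)"
        using meet [of a d "x(d := True)" "y(d := True)"] a d ne by simp
      have "fval g (x(c := True))" using mono1 xy by auto
      with ad have "fval g (\<lambda>k. ((x(d := True)) k \<and> (y(d := True)) k) \<and> (x(c := True)) k)"
        using meet [of b c "\<lambda>k. (x(d := True)) k \<and> (y(d := True)) k" "x(c := True)"] b c d ne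
        by simp
      moreover have "(\<lambda>k. ((x(d := True)) k \<and> (y(d := True)) k) \<and> (x(c := True)) k) = (\<lambda>i. x i \<and> y i)"
        using c d by (auto simp: fun_eq_iff)
      ultimately show ?thesis by simp
    qed
    then show ?thesis using mono by blast
  qed
qed

lemma affine_sum3:
  assumes "f \<in> L_clone"
  shows "fval f (\<lambda>i. (x i \<noteq> y i) \<noteq> z i) \<longleftrightarrow> ((fval f x \<noteq> fval f y) \<noteq> fval f z)"
proof -
  obtain S c where S: "is_affine f S c" using assms by (auto simp: L_iff)
  then have fin: "finite S" using finite_subset by (auto simp: is_affine_def)
  have par: "odd (card {i \<in> S. x i \<noteq> y i}) \<longleftrightarrow> odd (card {i \<in> S. x i}) \<noteq> odd (card {i \<in> S. y i})" for x y
  proof -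
    have "{i \<in> S. x i \<noteq> y i} = {i \<in> ({i \<in> S. x i} - {i \<in> S. y i}) \<union> ({i \<in> S. y i} - {i \<in> S. x i}). True}"
      by auto
    then show ?thesis
      using odd_card_sym_diff [of "{i \<in> S. x i}" "{i \<in> S. y i}" "\<lambda>_. True"] fin by simp
  qed
  have f: "fval f x = (c \<noteq> odd (card {i \<in> S. x i}))" for x
    using S by (simp only: is_affine_def)
  show ?thesis
    using par [of "\<lambda>i. x i \<noteq> y i" z] par [of x y] unfolding f by blast
qed

text \<open>The affine function \<open>l\<close> agrees with \<open>g\<close> at the zero tuple and
  the unit tuples. The difference \<open>h\<close> is additive on two assignments that are both
  constant on a common pair of positions, and every assignment can be decomposed into units by such
  sums.\<close>

lemma ident_minors_in_L:
  assumes n: "arity g \<ge> 4"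
    and cards: "\<And>I. I \<in> pairs (arity g) \<Longrightarrow> ident_minor g I \<in> L_clone"
  shows "g \<in> L_clone"
proof -
  define S where "S = {i. i < arity g \<and> fval g (\<lambda>k. k = i) \<noteq> fval g (\<lambda>_. False)}"
  define c where "c = fval g (\<lambda>_. False)"
  define l where "l x = (c \<noteq> odd (card {i \<in> S. x i}))" for x
  define h where "h x = (fval g x \<noteq> l x)" for x
  have fS: "finite S" by (simp add: S_def)
  have g3: "fval g (\<lambda>i. (x i \<noteq> y i) \<noteq> z i) \<longleftrightarrow> ((fval g x \<noteq> fval g y) \<noteq> fval g z)"
    if "i < arity g" "j < arity g" "i \<noteq> j" "x i = x j" "y i = y j" "z i = z j" for x y z i j
  proof -
    have *: "fval g (\<lambda>i. (x i \<noteq> y i) \<noteq> z i) \<longleftrightarrow> ((fval g x \<noteq> fval g y) \<noteq> fval g z)"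
      if ij: "i < j" "j < arity g" "x i = x j" "y i = y j" "z i = z j" for i j
    proof -
      have "ident_minor g {i, j} \<in> L_clone" using ij by (intro cards pairsI) auto
      from affine_sum3 [OF this, of "\<lambda>k. x (skip j k)" "\<lambda>k. y (skip j k)" "\<lambda>k. z (skip j k)"]
      show ?thesis using ij by (simp add: fval_via_ident_minor [of i j g])
    qed
    show ?thesis using * [of i j] * [of j i] that by (cases "i < j") auto
  qed
  define f where "f = mk_fun (arity g) (\<lambda>a. l ((!) a))"
  have f: "fval f x = l x" for x
  proof -
    have "{i \<in> S. map x [0..<arity g] ! i} = {i \<in> S. x i}" by (auto simp: S_def)
    then show ?thesis using arity_ge_1 [of g] by (simp add: f_def l_def)
  qed
  have "arity f = arity g" using arity_ge_1 [of g] by (simp add: f_def)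
  then have "is_affine f S c"
    unfolding is_affine_def f l_def by (auto simp: S_def)
  then have "f \<in> L_clone" by (auto simp: L_iff)
  have l3: "l (\<lambda>i. (x i \<noteq> y i) \<noteq> z i) \<longleftrightarrow> ((l x \<noteq> l y) \<noteq> l z)" for x y z
    using affine_sum3 [OF \<open>f \<in> L_clone\<close>] unfolding f .
  have h3: "h (\<lambda>i. (x i \<noteq> y i) \<noteq> z i) \<longleftrightarrow> ((h x \<noteq> h y) \<noteq> h z)"
    if "i < arity g" "j < arity g" "i \<noteq> j" "x i = x j" "y i = y j" "z i = z j" for x y z i j
    unfolding h_def l3 g3 [OF that] by blast
  have h0: "\<not> h (\<lambda>_. False)" by (simp add: h_def l_def c_def)
  have h1: "\<not> h (\<lambda>k. k = i)" if "i < arity g" for i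
  proof -
    have "{k \<in> S. k = i} = (if i \<in> S then {i} else {})" by auto
    then show ?thesis using that by (auto simp: h_def l_def c_def S_def)
  qed
  have h2: "h (\<lambda>i. x i \<noteq> y i) \<longleftrightarrow> h x \<noteq> h y"
    if "i < arity g" "j < arity g" "i \<noteq> j" "x i = x j" "y i = y j" for x y i j
    using h3 [of i j x y "\<lambda>_. False"] that h0 by simp
  \<comment> \<open>Arity at least 4 leaves two further positions, at which both unit tuples
    vanish.\<close>
  have h11: "\<not> h (\<lambda>k. k = i \<or> k = j)" if ij: "i < arity g" "j < arity g" "i \<noteq> j" for i j
  proof -
    have "card ({..<arity g} - {i, j}) \<ge> 2" using n ij by (simp add: card_Diff_subset)
    then obtain A where "A \<subseteq> {..<arity g} - {i, j}" "card A = 2"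
      by (meson obtain_subset_with_card_n)
    then obtain k l where "k \<noteq> l" "k < arity g" "l < arity g" "k \<notin> {i, j}" "l \<notin> {i, j}"
      by (auto simp: card_2_iff)
    moreover have "(\<lambda>k. (k = i) \<noteq> (k = j)) = (\<lambda>k. k = i \<or> k = j)" using ij by (auto simp: fun_eq_iff)
    ultimately show ?thesis using h2 [of k l "\<lambda>k. k = i" "\<lambda>k. k = j"] h1 ij by auto
  qed
  have hX: "\<not> h (\<lambda>k. k \<in> X)"
    if "finite X" "X \<subseteq> {..<arity g} - {i, j}" "i < arity g" "j < arity g" "i \<noteq> j" for X i j
    using that
  proof (induction X)
    case empty
    then show ?case using h0 by simp
  next
    case (insert a X)
    have "(\<lambda>k. k \<in> insert a X) = (\<lambda>k. (k = a) \<noteq> (k \<in> X))"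
      using insert.hyps by (auto simp: fun_eq_iff)
    then show ?case
      using insert h1 [of a] h2 [of i j "\<lambda>k. k = a" "\<lambda>k. k \<in> X"] by auto
  qed
  have "\<not> h x" for x
  proof -
    have "0 < arity g" "1 < arity g" "2 < arity g" "(0::nat) \<noteq> 1" "(0::nat) \<noteq> 2" "(1::nat) \<noteq> 2"
      using n by auto
    then obtain i j where ij: "i < j" "j < arity g" "x i = x j"
      using pigeonhole_bool [of 0 "arity g" 1 2 x] by metis
    define X where "X = {k. k < arity g \<and> x k} - {i, j}"
    have hx: "\<not> h (\<lambda>k. k \<in> X)"
      using hX [of X i j] ij by (auto simp: X_def)
    have hc: "h u = h v" if "\<And>k. k < arity g \<Longrightarrow> u k = v k" for u v
    proof -
      have "{i \<in> S. u i} = {i \<in> S. v i}" using that by (auto simp: S_def)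
      then show ?thesis using fval_cong [of g u v] that by (simp add: h_def l_def)
    qed
    show ?thesis
    proof (cases "x i")
      case True
      have "h x = h (\<lambda>k. (k = i \<or> k = j) \<noteq> (k \<in> X))"
        using True ij by (intro hc) (auto simp: X_def)
      also have "\<dots> = (h (\<lambda>k. k = i \<or> k = j) \<noteq> h (\<lambda>k. k \<in> X))"
        using ij by (intro h2 [of i j]) (auto simp: X_def)
      finally show ?thesis using hx h11 [of i j] ij by simp
    next
      case False
      have "h x = h (\<lambda>k. k \<in> X)"
        using False ij by (intro hc) (auto simp: X_def)
      then show ?thesis using hx by simp
    qed
  qed
  then have "fval g x = (c \<noteq> odd (card {i \<in> S. x i}))" for x
    unfolding h_def l_def by blast
  moreover have "S \<subseteq> {..<arity g}" by (auto simp: S_def)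
  ultimately have "is_affine g S c"
    unfolding is_affine_def by (intro conjI allI)
  then show ?thesis by (auto simp: L_iff)
qed

subsection \<open>Reconstruction in the polynomial clones\<close>

lemma clone_Inter:
  assumes "\<And>C. C \<in> A \<Longrightarrow> clone C"
  shows "clone (\<Inter>A)"
  unfolding clone_def
proof (intro conjI ballI allI impI InterI)
  fix n i :: nat and C assume "1 \<le> n" "i < n" "C \<in> A"
  then show "proj n i \<in> C" using assms [of C] unfolding clone_def by blast
next
  fix f n gs C
  assume *: "f \<in> \<Inter>A" "1 \<le> n" "length gs = arity f" "\<forall>g\<in>set gs. g \<in> \<Inter>A \<and> arity g = n" "C \<in> A"
  then have "f \<in> C" "\<forall>g\<in>set gs. g \<in> C \<and> arity g = n" by auto
  moreover have "\<forall>f\<in>C. \<forall>n\<ge>1. \<forall>gs. length gs = arity f \<longrightarrow>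
      (\<forall>g\<in>set gs. g \<in> C \<and> arity g = n) \<longrightarrow> comp_fun n f gs \<in> C"
    using assms [OF \<open>C \<in> A\<close>] unfolding clone_def by (rule conjunct2)
  ultimately show "comp_fun n f gs \<in> C" using *(2,3) by simp
qed

lemma clone_polynomial_operations: "clone (polynomial_operations F)"
  unfolding polynomial_operations_def by (rule clone_Inter) simp

lemma clone_Lambda: "clone Lambda_clone" and clone_L: "clone L_clone"
  by (simp_all add: Lambda_clone_def L_clone_def clone_polynomial_operations)

lemma same_cards_in_clone:
  assumes "clone C" "same_cards f g" "\<And>I. I \<in> pairs (arity f) \<Longrightarrow> ident_minor g I \<in> C"
    and "I \<in> pairs (arity f)"
  shows "ident_minor f I \<in> C"
  using assms clone_minor unfolding same_cards_def equivalent_def by metis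

lemma ident_minor_in_clone:
  "clone C \<Longrightarrow> f \<in> C \<Longrightarrow> I \<in> pairs (arity f) \<Longrightarrow> ident_minor f I \<in> C"
  using clone_minor minor_ident_minor by blast

lemma same_cards_arity: "same_cards f g \<Longrightarrow> arity f = arity g"
  by (simp add: same_cards_def)

text \<open>The cards put \<open>g\<close> into \<open>Lambda_clone\<close> as well. The constant
  false function is recognised by its cards; two conjunctions are compared by their numbers of
  arguments, bounded in both directions.\<close>

lemma Lambda_reconstruct:
  assumes f: "f \<in> Lambda_clone" and n: "arity f \<ge> 4" and fg: "same_cards f g" and gf: "same_cards g f"
  shows "equivalent f g"
proof -
  have ar: "arity f = arity g" using fg by (rule same_cards_arity)
  have "g \<in> Lambda_clone"
  proof (rule ident_minors_in_Lambda)
    show "arity g \<ge> 4" using n ar by simp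
    show "ident_minor g I \<in> Lambda_clone" if "I \<in> pairs (arity g)" for I
      using clone_Lambda gf _ that
      by (rule same_cards_in_clone) (use f ar clone_Lambda in \<open>auto intro: ident_minor_in_clone\<close>)
  qed
  \<comment> \<open>Two of the first three entries of any tuple are equal, so every value of
    \<open>q\<close> is a value of one of its cards.\<close>
  have const: "\<not> fval q x"
    if qp: "same_cards q p" and p: "\<And>x. \<not> fval p x" and n: "arity p \<ge> 4" for p q x
  proof -
    have ar: "arity q = arity p" using qp by (rule same_cards_arity)
    have "0 < arity q" "1 < arity q" "2 < arity q" "(0::nat) \<noteq> 1" "(0::nat) \<noteq> 2" "(1::nat) \<noteq> 2"
      using n ar by auto
    then obtain i j where ij: "i < j" "j < arity q" "x i = x j"
      using pigeonhole_bool [of 0 "arity q" 1 2 x] by metis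
    then have "{i, j} \<in> pairs (arity q)" by (intro pairsI) auto
    then obtain J where J: "J \<in> pairs (arity q)" "minor (ident_minor q {i, j}) (ident_minor p J)"
      using qp unfolding same_cards_def equivalent_def by blast
    obtain k l where kl: "k < l" "l < arity q" "J = {k, l}" using J(1) by (rule pairsE)
    have "\<not> fval (ident_minor p J) y" for y
      using kl ar p fval_ident_minor [of k l p y] by simp
    then have "\<not> fval (ident_minor q {i, j}) y" for y
      using J(2) by (auto elim: minorE)
    then show ?thesis using fval_via_ident_minor [of i j q x] ij by simp
  qed
  show ?thesis
    using f
  proof (cases rule: Lambda_cases)
    case 1
    then have "\<not> fval g x" for x using const [OF gf] n by blast
    then show ?thesis
      using 1 ar unfolding equivalent_def by (intro conjI minorI [where \<sigma> = id]) auto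
  next
    case (2 S)
    show ?thesis
      using \<open>g \<in> Lambda_clone\<close>
    proof (cases rule: Lambda_cases)
      case 1
      then have "\<not> fval f (\<lambda>_. True)" using const [OF fg] n ar by simp
      then show ?thesis using 2 by (simp add: is_conj_def)
    next
      case T: (2 T)
      have le: "card V \<le> card U"
        if pq: "same_cards p q" and qp: "same_cards q p" and U: "is_conj p U" and V: "is_conj q V"
          and n: "arity p \<ge> 4" for p q U V
      proof -
        have ar: "arity p = arity q" using pq by (rule same_cards_arity)
        have fin: "finite U" "finite V"
          using U V finite_subset by (auto simp: is_conj_def)
        have card_minor: "\<exists>T. is_conj (ident_minor f I) T \<and> card T = (if I \<subseteq> S then card S - 1 else card S)"
          if S: "is_conj f S" and I: "I \<in> pairs (arity f)" for f S I
        proof -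
          obtain i j where ij: "i < j" "j < arity f" "I = {i, j}" using I by (rule pairsE)
          have "finite S" using S finite_subset by (auto simp: is_conj_def)
          with is_conj_ident_minor [OF S ij(1,2)] card_merge_image [OF ij(1)] ij(3)
          show ?thesis by blast
        qed
        have cards: "(if I \<subseteq> S then card S - 1 else card S) = (if J \<subseteq> T then card T - 1 else card T)"
          if "equivalent (ident_minor f I) (ident_minor g J)" "is_conj f S" "is_conj g T"
            "I \<in> pairs (arity f)" "J \<in> pairs (arity g)" for f g S T I J
          using card_minor [of f S I] card_minor [of g T J] that minor_conj
          unfolding equivalent_def by (metis order_antisym)
        show ?thesis
        proof (rule card_determined_by_cards [of "arity p" 1])
          fix I assume I: "I \<in> pairs (arity p)"
          obtain J where J: "J \<in> pairs (arity p)" "equivalent (ident_minor p I) (ident_minor q J)"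
            using pq I unfolding same_cards_def by blast
          from cards [OF J(2) U V I] J(1) ar
          show "\<exists>J\<in>pairs (arity p). (if I \<subseteq> U then card U - 1 else card U) =
              (if J \<subseteq> V then card V - 1 else card V)"
            by metis
          obtain J where J: "J \<in> pairs (arity p)" "equivalent (ident_minor q I) (ident_minor p J)"
            using qp I ar unfolding same_cards_def by metis
          have "I \<in> pairs (arity q)" using I ar by simp
          from cards [OF equivalent_sym [OF J(2)] U V J(1) this] J(1)
          show "\<exists>J\<in>pairs (arity p). (if J \<subseteq> U then card U - 1 else card U) =
              (if I \<subseteq> V then card V - 1 else card V)"
            by (rule bexI)
        qed (use n U V ar in \<open>auto simp: is_conj_def\<close>)
      qed
      have "card S = card T"
        using le [OF fg gf 2 T n] le [OF gf fg T 2] n ar by simp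
      then show ?thesis using conj_minorI 2 T ar unfolding equivalent_def by metis
    qed
  qed
qed

text \<open>As for conjunctions, except that two arguments cancel where one was lost; the constant
  term is inherited by minors and can be read off any card.\<close>

lemma L_reconstruct:
  assumes f: "f \<in> L_clone" and n: "arity f \<ge> 4" and fg: "same_cards f g" and gf: "same_cards g f"
  shows "equivalent f g"
proof -
  have ar: "arity f = arity g" using fg by (rule same_cards_arity)
  have "g \<in> L_clone"
  proof (rule ident_minors_in_L)
    show "arity g \<ge> 4" using n ar by simp
    show "ident_minor g I \<in> L_clone" if "I \<in> pairs (arity g)" for I
      using clone_L gf _ that
      by (rule same_cards_in_clone) (use f ar clone_L in \<open>auto intro: ident_minor_in_clone\<close>)
  qed
  then obtain S c T d where S: "is_affine f S c" and T: "is_affine g T d"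
    using f unfolding L_iff by blast
  have card_minor: "\<exists>T. is_affine (ident_minor f I) T c \<and> card T = (if I \<subseteq> S then card S - 2 else card S)"
    if S: "is_affine f S c" and I: "I \<in> pairs (arity f)" for f S c I
  proof -
    obtain i j where ij: "i < j" "j < arity f" "I = {i, j}" using I by (rule pairsE)
    then show ?thesis using is_affine_ident_minor [OF S ij(1,2)] by metis
  qed
  have cards: "(if I \<subseteq> S then card S - 2 else card S) = (if J \<subseteq> T then card T - 2 else card T) \<and> c = d"
    if eq: "equivalent (ident_minor f I) (ident_minor g J)" and S: "is_affine f S c" and T: "is_affine g T d"
      and I: "I \<in> pairs (arity f)" and J: "J \<in> pairs (arity g)" for f g S T I J c d
  proof -
    obtain S' where S': "is_affine (ident_minor f I) S' c"
      "card S' = (if I \<subseteq> S then card S - 2 else card S)" using card_minor [OF S I] by blast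
    obtain T' where T': "is_affine (ident_minor g J) T' d"
      "card T' = (if J \<subseteq> T then card T - 2 else card T)" using card_minor [OF T J] by blast
    have "card S' = card T'" "c = d"
      using minor_affine [OF S'(1) T'(1)] minor_affine [OF T'(1) S'(1)] eq
      unfolding equivalent_def by (simp_all add: order_antisym)
    then show ?thesis using S' T' by simp
  qed
  have le: "card V \<le> card U \<and> c = d"
    if pq: "same_cards p q" and qp: "same_cards q p" and U: "is_affine p U c" and V: "is_affine q V d"
      and n: "arity p \<ge> 4" for p q U V c d
  proof -
    have ar: "arity p = arity q" using pq by (rule same_cards_arity)
    have to: "\<exists>J\<in>pairs (arity p). (if I \<subseteq> U then card U - 2 else card U) =
          (if J \<subseteq> V then card V - 2 else card V) \<and> c = d" if I: "I \<in> pairs (arity p)" for I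
    proof -
      obtain J where J: "J \<in> pairs (arity p)" "equivalent (ident_minor p I) (ident_minor q J)"
        using pq I unfolding same_cards_def by blast
      from cards [OF J(2) U V I] J(1) ar show ?thesis by metis
    qed
    have "{0, 1} \<in> pairs (arity p)" using n by (intro pairsI) auto
    then have "c = d" using to by blast
    moreover have "card V \<le> card U"
    proof (rule card_determined_by_cards [of "arity p" 2])
      fix I assume I: "I \<in> pairs (arity p)"
      show "\<exists>J\<in>pairs (arity p). (if I \<subseteq> U then card U - 2 else card U) =
          (if J \<subseteq> V then card V - 2 else card V)"
        using to [OF I] by blast
      obtain J where J: "J \<in> pairs (arity p)" "equivalent (ident_minor q I) (ident_minor p J)"
        using qp I ar unfolding same_cards_def by metis
      have "I \<in> pairs (arity q)" using I ar by simp
      from conjunct1 [OF cards [OF equivalent_sym [OF J(2)] U V J(1) this]] J(1)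
      show "\<exists>J\<in>pairs (arity p). (if J \<subseteq> U then card U - 2 else card U) =
          (if I \<subseteq> V then card V - 2 else card V)"
        by (rule bexI)
    qed (use n U V ar in \<open>auto simp: is_affine_def\<close>)
    ultimately show ?thesis by simp
  qed
  have "card S = card T" "c = d"
    using le [OF fg gf S T n] le [OF gf fg T S] n ar by simp_all
  then show ?thesis
    using affine_minorI [of f S c g T] affine_minorI [of g T c f S] S T ar
    by (simp add: equivalent_def)
qed

lemma reconstructible_of_arity_ge_4:
  assumes "C \<subseteq> Lambda_clone \<or> C \<subseteq> V_clone \<or> C \<subseteq> L_clone"
  shows "reconstructible (of_arity_ge C 4)"
  unfolding reconstructible_def reconstructible_fun_def
proof (intro ballI allI impI)
  fix f g assume f: "f \<in> of_arity_ge C 4" and fg: "hypomorphic f g"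
  have cards: "same_cards f g" "same_cards g f"
    using fg hypomorphic_sym hypomorphic_same_cards by auto
  have n: "arity f \<ge> 4" using f by (simp add: of_arity_ge_def)
  have "f \<in> C" using f by (simp add: of_arity_ge_def)
  with assms consider "f \<in> Lambda_clone" | "dual f \<in> Lambda_clone" | "f \<in> L_clone"
    unfolding V_clone_eq by fastforce
  then show "equivalent f g"
  proof cases
    case 1
    then show ?thesis using n cards by (rule Lambda_reconstruct)
  next
    case 2
    then have "equivalent (dual f) (dual g)"
      using n cards by (intro Lambda_reconstruct same_cards_dual) simp_all
    then show ?thesis by simp
  next
    case 3
    then show ?thesis using n cards by (rule L_reconstruct)
  qed
qed

subsection \<open>Minimal nontrivial clones\<close>

text \<open>Binary operations are padded to three arguments, so that all compositions of small
  operations happen within a single arity.\<close>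

definition ternary :: "boolfun set \<Rightarrow> (bool \<Rightarrow> bool \<Rightarrow> bool \<Rightarrow> bool) \<Rightarrow> bool" where
  "ternary C F \<longleftrightarrow> mk_fun 3 (\<lambda>a. F (a ! 0) (a ! 1) (a ! 2)) \<in> C"

lemma ternary_subst:
  assumes "clone C" "ternary C F" "n \<ge> 1"
    and G: "mk_fun n G1 \<in> C" "mk_fun n G2 \<in> C" "mk_fun n G3 \<in> C"
  shows "mk_fun n (\<lambda>a. F (G1 a) (G2 a) (G3 a)) \<in> C"
proof -
  let ?G = "\<lambda>k. if k = 0 then G1 else if k = 1 then G2 else G3"
  have "mk_fun n (\<lambda>a. fval (mk_fun 3 (\<lambda>a. F (a ! 0) (a ! 1) (a ! 2))) (\<lambda>k. ?G k a)) \<in> C"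
    using assms(2) G by (intro clone_subst [OF assms(1) _ assms(3)]) (simp_all add: ternary_def)
  then show ?thesis by simp
qed

lemma ternary_comp:
  assumes "clone C" "ternary C F" "ternary C G1" "ternary C G2" "ternary C G3"
  shows "ternary C (\<lambda>x y z. F (G1 x y z) (G2 x y z) (G3 x y z))"
  using ternary_subst [OF assms(1,2), of 3] assms(3-5) by (simp add: ternary_def)

lemma ternary_proj:
  assumes "clone C"
  shows "ternary C (\<lambda>x y z. x)" "ternary C (\<lambda>x y z. y)" "ternary C (\<lambda>x y z. z)"
  unfolding ternary_def using assms by (intro clone_proj; simp)+

lemma ternary_fval:
  assumes "clone C" "f \<in> C" "\<And>k. k < arity f \<Longrightarrow> ternary C (G k)"
  shows "ternary C (\<lambda>x y z. fval f (\<lambda>k. G k x y z))"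
  unfolding ternary_def using assms by (intro clone_subst) (simp_all add: ternary_def)

definition maj :: "bool \<Rightarrow> bool \<Rightarrow> bool \<Rightarrow> bool" where
  "maj x y z \<longleftrightarrow> (x \<and> y) \<or> (x \<and> z) \<or> (y \<and> z)"

text \<open>By hypothesis an odd number of the four values is true, that is, the polynomial of
  \<open>B\<close> over the two-element field contains the product of both arguments. Up to
  negations such a \<open>B\<close> is a meet or a join, and the compositions in \<open>Bs\<close>
  undo the negations.\<close>

lemma nonaffine_binary:
  assumes C: "clone C" and B: "ternary C (\<lambda>x y z. B x y)"
    and nonaffine: "(B False False \<noteq> B False True) \<noteq> (B True False \<noteq> B True True)"
  shows "ternary C (\<lambda>x y z. x \<and> y) \<or> ternary C (\<lambda>x y z. x \<or> y)"
proof -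
  note p = ternary_proj [OF C]
  have comp: "ternary C (\<lambda>x y z. B (P x y) (Q x y))"
    if "ternary C (\<lambda>x y z. P x y)" "ternary C (\<lambda>x y z. Q x y)" for P Q
    using ternary_comp [OF C B that that(1)] .
  define Bs where "Bs = {B, \<lambda>x y. B x (B x y), \<lambda>x y. B (B x y) y, \<lambda>x y. B (B x y) (B x y)}"
  have "ternary C (\<lambda>x y z. H x y)" if "H \<in> Bs" for H
    using that comp p B unfolding Bs_def by auto
  moreover have "(\<lambda>x y. x \<and> y) \<in> Bs \<or> (\<lambda>x y. x \<or> y) \<in> Bs"
    using nonaffine unfolding Bs_def
    by (cases "B False False"; cases "B False True"; cases "B True False"; cases "B True True";
        simp add: fun_eq_iff all_bool_eq)
  ultimately show ?thesis by blast
qed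

lemma nonaffine_ternary:
  assumes C: "clone C" and F: "ternary C F"
    and nonaffine: "\<And>c p q r. F \<noteq> (\<lambda>x y z. ((x \<and> p) \<noteq> (y \<and> q)) \<noteq> ((z \<and> r) \<noteq> c))"
  shows "ternary C (\<lambda>x y z. x \<and> y) \<or> ternary C (\<lambda>x y z. x \<or> y) \<or> ternary C maj"
proof -
  note p = ternary_proj [OF C]
  note comp = ternary_comp [OF C F]
  \<comment> \<open>If all binary minors of \<open>F\<close> are affine, then \<open>F\<close> is, up to negating the value and at most one
    argument, the majority function; \<open>G\<close> removes the negation of the value.\<close>
  define G where "G x y z = F (F x y z) (F x y z) (F x y z)" for x y z
  have G: "ternary C G" using comp [OF F F F] by (simp add: G_def [abs_def])
  note compG = ternary_comp [OF C G]
  \<comment> \<open>The last three members serve the case that \<open>F x x x\<close> is constant.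
    Majority plus an odd number of linear terms has affine identifications, but substituting that
    constant for an argument leaves a product of the other two.\<close>
  define Bs where "Bs = {\<lambda>x y. F x x y, \<lambda>x y. F x y x, \<lambda>x y. F y x x,
    \<lambda>x y. F (F x x x) x y, \<lambda>x y. F x (F x x x) y, \<lambda>x y. F x y (F x x x)}"
  \<comment> \<open>If one argument of \<open>G\<close> is negated, substituting \<open>G\<close>
    itself for that argument cancels the negation.\<close>
  define Gs where "Gs = {G, \<lambda>x y z. G x y (G x y z), \<lambda>x y z. G x (G x y z) z, \<lambda>x y z. G (G x y z) y z}"
  have Bs: "ternary C (\<lambda>x y z. B x y)" if "B \<in> Bs" for B
    using that comp p unfolding Bs_def by auto
  have Gs: "ternary C H" if "H \<in> Gs" for H
    using that compG p G unfolding Gs_def by auto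
  show ?thesis
  proof (cases "\<exists>B\<in>Bs. (B False False \<noteq> B False True) \<noteq> (B True False \<noteq> B True True)")
    case True
    then obtain B where "B \<in> Bs" "(B False False \<noteq> B False True) \<noteq> (B True False \<noteq> B True True)"
      by (rule bexE)
    from nonaffine_binary [OF C Bs [OF this(1)] this(2)] show ?thesis by (rule disj_forward) simp_all
  next
    case False
    let ?c = "F False False False"
    have "\<not> (\<forall>x y z. F x y z = (((x \<and> (F True False False \<noteq> ?c)) \<noteq> (y \<and> (F False True False \<noteq> ?c))) \<noteq>
        ((z \<and> (F False False True \<noteq> ?c)) \<noteq> ?c)))"
      using nonaffine [of "F True False False \<noteq> ?c" "F False True False \<noteq> ?c" "F False False True \<noteq> ?c" ?c]
      unfolding fun_eq_iff .
    moreover have "\<not> ((B False False \<noteq> B False True) \<noteq> (B True False \<noteq> B True True))" if "B \<in> Bs" for B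
      using False that by (rule_tac notI) (erule notE, rule bexI)
    note affine = this [unfolded Bs_def, OF insertI1] this [unfolded Bs_def, OF insertI2, OF insertI1]
      this [unfolded Bs_def, OF insertI2, OF insertI2, OF insertI1]
      this [unfolded Bs_def, OF insertI2, OF insertI2, OF insertI2, OF insertI1]
      this [unfolded Bs_def, OF insertI2, OF insertI2, OF insertI2, OF insertI2, OF insertI1]
      this [unfolded Bs_def, OF insertI2, OF insertI2, OF insertI2, OF insertI2, OF insertI2, OF insertI1]
    ultimately have "\<exists>p q r d. (\<forall>x y z. F x y z = (maj (x \<noteq> p) (y \<noteq> q) (z \<noteq> r) \<noteq> d)) \<and>
        (\<not> p \<and> \<not> q \<or> \<not> p \<and> \<not> r \<or> \<not> q \<and> \<not> r)"
      unfolding maj_def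
      by (cases "F False False False"; cases "F True True True"; cases "F False False True";
          cases "F False True False"; cases "F True False False"; cases "F True True False";
          cases "F True False True"; cases "F False True True";
          simp add: all_bool_eq ex_bool_eq)
    then obtain p q r d where F_eq: "\<And>x y z. F x y z = (maj (x \<noteq> p) (y \<noteq> q) (z \<noteq> r) \<noteq> d)"
      and one: "\<not> p \<and> \<not> q \<or> \<not> p \<and> \<not> r \<or> \<not> q \<and> \<not> r" by blast
    have "F a a a \<longleftrightarrow> a \<noteq> d" for a
      unfolding F_eq maj_def using one by (cases p; cases q; cases r; cases a; simp)
    then have G_eq: "G x y z = maj (x \<noteq> p) (y \<noteq> q) (z \<noteq> r)" for x y z
      using F_eq [of x y z] unfolding G_def by blast
    have "maj \<in> Gs"
      using one unfolding Gs_def G_eq [abs_def] maj_def [abs_def]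
      by (cases p; cases q; cases r; simp add: fun_eq_iff all_bool_eq)
    then show ?thesis using Gs by blast
  qed
qed

lemma polynomial_operations_superset: "F \<subseteq> polynomial_operations F"
  and const_fun_polynomial: "n \<ge> 1 \<Longrightarrow> const_fun n c \<in> polynomial_operations F"
  by (auto simp: polynomial_operations_def)

lemma affine_ternary_in_L:
  "mk_fun 3 (\<lambda>a. ((a ! 0 \<and> p) \<noteq> (a ! 1 \<and> q)) \<noteq> ((a ! 2 \<and> r) \<noteq> c)) \<in> L_clone"
proof -
  have add: "mk_fun 2 (\<lambda>a. a ! 0 \<noteq> a ! 1) \<in> L_clone"
    using polynomial_operations_superset [of "{add_op}"] by (simp add: add_op_def L_clone_def)
  have const: "mk_fun 3 (\<lambda>a. d) \<in> L_clone" for d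
    using const_fun_polynomial [of 3] by (simp add: const_fun_def L_clone_def)
  have "mk_fun 3 (\<lambda>a. a ! k \<and> d) \<in> L_clone" if "k < 3" for k d
    using clone_proj [OF clone_L that] const [of False] by (cases d) auto
  then show ?thesis
    by (intro clone_comp2 [OF clone_L add] const) auto
qed

text \<open>A member outside \<open>L_clone\<close> of least arity has all its cards in
  \<open>L_clone\<close>, so its arity is at most 3. Padded to a ternary operation it remains
  nonaffine, because it is a minor of the padded one.\<close>

lemma not_in_L_cases:
  assumes C: "clone C" and "\<not> C \<subseteq> L_clone"
  shows "ternary C (\<lambda>x y z. x \<and> y) \<or> ternary C (\<lambda>x y z. x \<or> y) \<or> ternary C maj"
proof -
  have "\<exists>f. f \<in> C \<and> f \<notin> L_clone" using assms(2) by auto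
  then obtain f where f: "f \<in> C" "f \<notin> L_clone"
    and least: "\<And>g. g \<in> C \<Longrightarrow> g \<notin> L_clone \<Longrightarrow> arity f \<le> arity g"
    using ex_has_least_nat [of "\<lambda>f. f \<in> C \<and> f \<notin> L_clone" _ arity] by blast
  have n: "arity f \<le> 3"
  proof (rule ccontr)
    assume "\<not> arity f \<le> 3"
    then have n: "arity f \<ge> 4" by simp
    have "ident_minor f I \<in> L_clone" if "I \<in> pairs (arity f)" for I
    proof (rule ccontr)
      assume "ident_minor f I \<notin> L_clone"
      with least [OF ident_minor_in_clone [OF C f(1) that]] n show False
        by (simp add: arity_ident_minor)
    qed
    with n ident_minors_in_L f(2) show False by blast
  qed
  define F where "F x y z = fval f (\<lambda>k. if k = 0 then x else if k = 1 then y else z)" for x y z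
  have F: "ternary C F"
  proof -
    have "ternary C (\<lambda>x y z. fval f (\<lambda>k. (if k = 0 then (\<lambda>x y z. x) else
        if k = 1 then (\<lambda>x y z. y) else (\<lambda>x y z. z)) x y z))"
      using ternary_proj [OF C] by (intro ternary_fval C f) simp
    moreover have "(\<lambda>k. (if k = 0 then (\<lambda>x y z. x) else if k = 1 then (\<lambda>x y z. y) else (\<lambda>x y z. z)) x y z)
      = (\<lambda>k::nat. if k = 0 then x else if k = 1 then y else z)" for x y z :: bool
      by auto
    ultimately show ?thesis by (simp add: F_def [abs_def])
  qed
  show ?thesis
  proof (rule nonaffine_ternary [OF C F])
    fix c p q r
    show "F \<noteq> (\<lambda>x y z. ((x \<and> p) \<noteq> (y \<and> q)) \<noteq> ((z \<and> r) \<noteq> c))"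
    proof
      assume eq: "F = (\<lambda>x y z. ((x \<and> p) \<noteq> (y \<and> q)) \<noteq> ((z \<and> r) \<noteq> c))"
      let ?g = "mk_fun 3 (\<lambda>a. F (a ! 0) (a ! 1) (a ! 2))"
      have g: "?g \<in> L_clone"
        unfolding eq by (rule affine_ternary_in_L)
      have "minor f ?g"
      proof (rule minorI [where \<sigma> = "\<lambda>k. if k < arity f then k else 0"])
        show "(if k < arity f then k else 0) < arity f" for k
          using arity_ge_1 [of f] by simp
        fix x :: "nat \<Rightarrow> bool"
        have "x i = (if i = 0 then x (if 0 < arity f then 0 else 0) else if i = 1
            then x (if 1 < arity f then 1 else 0) else x (if 2 < arity f then 2 else 0))"
          if "i < arity f" for i
        proof -
          have "i = 0 \<or> i = 1 \<or> i = 2" using that n by arith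
          then show ?thesis using that by auto
        qed
        note x = this
        have "fval ?g y = F (y 0) (y 1) (y 2)" for y by (simp add: numeral_2_eq_2)
        then show "fval f x = fval ?g (\<lambda>k. x (if k < arity f then k else 0))"
          unfolding F_def by (simp only:) (intro fval_cong x)
      qed
      with g have "f \<in> L_clone" by (rule clone_minor [OF clone_L])
      with f(2) show False by simp
    qed
  qed
qed

lemma not_in_Lambda_meet:
  assumes C: "clone C" and meet: "ternary C (\<lambda>x y z. x \<and> y)" and "\<not> C \<subseteq> Lambda_clone"
  shows "ternary C (\<lambda>x y z. x \<and> (y \<or> z))"
proof -
  \<comment> \<open>\<open>D\<close> behaves like a clone that contains the constant 1, represented by \<open>x\<close>.\<close>
  define D where "D g \<longleftrightarrow> ternary C (\<lambda>x y z. x \<and> g y z)" for g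
  note p = ternary_proj [OF C]
  have andT: "ternary C (\<lambda>x y z. F x y z \<and> G x y z)" if "ternary C F" "ternary C G" for F G
    using ternary_comp [OF C meet that(1) that(2) that(2)] .
  have Dp: "D (\<lambda>y z. y)" "D (\<lambda>y z. z)" "D (\<lambda>y z. True)"
    using andT [OF p(1) p(2)] andT [OF p(1) p(3)] p(1) by (simp_all add: D_def)
  have Dand: "D (\<lambda>y z. g y z \<and> h y z)" if "D g" "D h" for g h
  proof -
    have "(\<lambda>x y z. (x \<and> g y z) \<and> (x \<and> h y z)) = (\<lambda>x y z. x \<and> (g y z \<and> h y z))" by (auto simp: fun_eq_iff)
    with andT [OF that [unfolded D_def]] show ?thesis unfolding D_def by simp
  qed
  have Dcomp: "D (\<lambda>y z. g (h y z) (k y z))" if "D g" "D h" "D k" for g h k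
  proof -
    have "ternary C (\<lambda>x y z. x \<and> g (x \<and> h y z) (x \<and> k y z))"
      using ternary_comp [OF C that(1) [unfolded D_def] p(1) that(2,3) [unfolded D_def]] .
    moreover have "(\<lambda>x y z. x \<and> g (x \<and> h y z) (x \<and> k y z)) = (\<lambda>x y z. x \<and> g (h y z) (k y z))"
    proof (intro ext)
      show "(x \<and> g (x \<and> h y z) (x \<and> k y z)) = (x \<and> g (h y z) (k y z))" for x y z by (cases x) simp_all
    qed
    ultimately show ?thesis by (simp add: D_def)
  qed
  have Dfval: "D (\<lambda>y z. fval f (\<lambda>k. G k y z))" if "f \<in> C" "\<And>k. D (G k)" for f G
  proof -
    have "ternary C (\<lambda>x y z. fval f (\<lambda>k. x \<and> G k y z))"
      using ternary_fval [OF C that(1), of "\<lambda>k x y z. x \<and> G k y z"] that(2) by (simp add: D_def)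
    from andT [OF p(1) this] have "ternary C (\<lambda>x y z. x \<and> fval f (\<lambda>k. x \<and> G k y z))" .
    moreover have "(\<lambda>x y z. x \<and> fval f (\<lambda>k. x \<and> G k y z)) = (\<lambda>x y z. x \<and> fval f (\<lambda>k. G k y z))"
    proof (intro ext)
      show "(x \<and> fval f (\<lambda>k. x \<and> G k y z)) = (x \<and> fval f (\<lambda>k. G k y z))" for x y z by (cases x) simp_all
    qed
    ultimately show ?thesis by (simp add: D_def)
  qed
  obtain f where f: "f \<in> C" "f \<notin> Lambda_clone" using assms(3) by auto
  then obtain u v where uv: "fval f (\<lambda>i. u i \<and> v i) \<noteq> (fval f u \<and> fval f v)"
    using meet_imp_Lambda by blast
  \<comment> \<open>\<open>G k\<close> encodes the values of \<open>u\<close> and \<open>v\<close>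
    at \<open>k\<close>: with (1, 0), (0, 1) and (0, 0) for \<open>(y, z)\<close> it produces
    \<open>u\<close>, \<open>v\<close> and their meet. So \<open>g\<close> is a binary operation in
    \<open>D\<close> that fails to preserve a meet.\<close>
  define G where "G k = (if u k then if v k then (\<lambda>y z. True) else (\<lambda>y z. y)
      else if v k then (\<lambda>y z. z) else (\<lambda>y z. y \<and> z))" for k
  define g where "g y z = fval f (\<lambda>k. G k y z)" for y z
  have "D (G k)" for k using Dp Dand by (simp add: G_def)
  then have g: "D g" using Dfval [OF f(1)] by (simp add: g_def [abs_def])
  have "(\<lambda>k. G k True False) = u" "(\<lambda>k. G k False True) = v" "(\<lambda>k. G k False False) = (\<lambda>i. u i \<and> v i)"
    by (auto simp: G_def fun_eq_iff)
  then have gne: "g False False \<noteq> (g True False \<and> g False True)"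
    using uv by (simp add: g_def)
  define h1 where "h1 y z = g y (y \<and> z)" for y z
  define h2 where "h2 y z = g (y \<and> z) z" for y z
  have h: "D h1" "D h2"
    using Dcomp [OF g] Dp Dand unfolding h1_def [abs_def] h2_def [abs_def] by simp_all
  define k where "k y z = (g y y \<and> g z z)" for y z
  have k: "D k" using Dcomp [OF g] Dp Dand unfolding k_def [abs_def] by simp
  \<comment> \<open>The members cover, in this order: join itself; exclusive or and equivalence;
    joint denial and the negations, where \<open>k\<close> is joint denial; and the two
    implications.\<close>
  define Hs where "Hs = {g, \<lambda>y z. g (g y z) (y \<and> z), \<lambda>y z. g (k y z) (k y z),
    \<lambda>y z. h1 (h1 y z) z, \<lambda>y z. h2 y (h2 y z)}"
  have "D H" if "H \<in> Hs" for H
    using that Dcomp [OF g] Dcomp [OF h(1)] Dcomp [OF h(2)] Dp Dand g h k unfolding Hs_def by auto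
  moreover have "(\<lambda>y z. y \<or> z) \<in> Hs"
    using gne unfolding Hs_def
    by (cases "g False False"; cases "g False True"; cases "g True False"; cases "g True True";
        simp add: fun_eq_iff all_bool_eq h1_def h2_def k_def)
  ultimately have "D (\<lambda>y z. y \<or> z)" by blast
  then show ?thesis by (simp add: D_def)
qed

section \<open>Functions generated by the minimal operations\<close>

text \<open>A disjunctive normal form below the argument at position \<open>z\<close>. With that
  argument put first, the ternary operation joins functions below it; with its last two entries
  equal, it is the meet. The hypothesis \<open>top\<close> makes the family of terms
  nonempty.\<close>

lemma monotone_below_proj_in_clone:
  assumes C: "clone C" and u: "ternary C (\<lambda>x y z. x \<and> (y \<or> z))" and z: "z < arity f"
    and mono: "\<And>x y. fval f x \<Longrightarrow> (\<And>i. x i \<Longrightarrow> y i) \<Longrightarrow> fval f y"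
    and below: "\<And>x. fval f x \<Longrightarrow> x z" and top: "fval f (\<lambda>_. True)"
  shows "f \<in> C"
proof -
  define n where "n = arity f"
  have n: "n \<ge> 1" using arity_ge_1 n_def by simp
  note u' = ternary_subst [OF C u n]
  have pz: "mk_fun n (\<lambda>a. a ! z) \<in> C" using C z by (auto intro: clone_proj simp: n_def)
  have conj: "mk_fun n (\<lambda>a. a ! z \<and> (\<forall>i\<in>X. a ! i)) \<in> C" if "finite X" "X \<subseteq> {..<n}" for X
    using that
  proof (induction X)
    case empty
    then show ?case using pz by simp
  next
    case (insert j X)
    have "mk_fun n (\<lambda>a. a ! j) \<in> C" using C insert.prems by (auto intro: clone_proj)
    then have "mk_fun n (\<lambda>a. (a ! z \<and> (\<forall>i\<in>X. a ! i)) \<and> (a ! j \<or> a ! j)) \<in> C"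
      using insert by (intro u') auto
    moreover have "(\<lambda>a. (a ! z \<and> (\<forall>i\<in>X. a ! i)) \<and> (a ! j \<or> a ! j)) =
        (\<lambda>a. a ! z \<and> (\<forall>i\<in>insert j X. a ! i))" by (auto simp: fun_eq_iff)
    ultimately show ?case by simp
  qed
  have dnf: "mk_fun n (\<lambda>a. a ! z \<and> (\<exists>X\<in>A. \<forall>i\<in>X. a ! i)) \<in> C"
    if "finite A" "A \<noteq> {}" "A \<subseteq> Pow {..<n}" for A
    using that
  proof (induction A rule: finite_ne_induct)
    case (singleton X)
    then show ?case using conj [of X] finite_subset by auto
  next
    case (insert X A)
    have "mk_fun n (\<lambda>a. a ! z \<and> ((a ! z \<and> (\<forall>i\<in>X. a ! i)) \<or> (a ! z \<and> (\<exists>X\<in>A. \<forall>i\<in>X. a ! i)))) \<in> C"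
      using insert finite_subset [of X "{..<n}"] by (intro u' pz conj) auto
    moreover have "(\<lambda>a. a ! z \<and> ((a ! z \<and> (\<forall>i\<in>X. a ! i)) \<or> (a ! z \<and> (\<exists>X\<in>A. \<forall>i\<in>X. a ! i)))) =
        (\<lambda>a. a ! z \<and> (\<exists>X\<in>insert X A. \<forall>i\<in>X. a ! i))" by (auto simp: fun_eq_iff)
    ultimately show ?case by simp
  qed
  define A where "A = {X. X \<subseteq> {..<n} \<and> fval f (\<lambda>i. i \<in> X)}"
  have "fval f (\<lambda>i. i \<in> {..<n}) = fval f (\<lambda>_. True)" by (intro fval_cong) (simp add: n_def)
  then have "{..<n} \<in> A" using top by (simp add: A_def)
  then have "mk_fun n (\<lambda>a. a ! z \<and> (\<exists>X\<in>A. \<forall>i\<in>X. a ! i)) \<in> C"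
    by (intro dnf) (auto simp: A_def)
  also have "mk_fun n (\<lambda>a. a ! z \<and> (\<exists>X\<in>A. \<forall>i\<in>X. a ! i)) = f"
  proof (rule mk_fun_eqI [symmetric])
    fix a :: "bool list" assume "length a = n"
    then have a: "app f a = fval f (\<lambda>i. a ! i)" by (simp add: app_eq_fval n_def)
    show "app f a = (a ! z \<and> (\<exists>X\<in>A. \<forall>i\<in>X. a ! i))"
    proof
      assume fa: "app f a"
      have "fval f (\<lambda>i. i \<in> {i. i < n \<and> a ! i}) = fval f (\<lambda>i. a ! i)"
        by (intro fval_cong) (simp add: n_def)
      then have "{i. i < n \<and> a ! i} \<in> A" using fa a by (auto simp: A_def)
      moreover have "a ! z" using below [of "\<lambda>i. a ! i"] fa a by simp
      ultimately show "a ! z \<and> (\<exists>X\<in>A. \<forall>i\<in>X. a ! i)"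
        by (intro conjI bexI [of _ "{i. i < n \<and> a ! i}"]) simp_all
    next
      assume "a ! z \<and> (\<exists>X\<in>A. \<forall>i\<in>X. a ! i)"
      then obtain X where "X \<in> A" "\<And>i. i \<in> X \<Longrightarrow> a ! i" by blast
      then show "app f a" using mono [of "\<lambda>i. i \<in> X" "\<lambda>i. a ! i"] a by (auto simp: A_def)
    qed
  qed (simp add: n_def)
  finally show ?thesis .
qed

text \<open>
  By self-duality and monotonicity, any two values of \<open>f\<close> are taken by a common projection; the
  majority function then yields interpolation on all tuples, as in the Baker--Pixley theorem.
\<close>

lemma selfdual_monotone_in_clone:
  assumes C: "clone C" and maj: "ternary C maj"
    and mono: "\<And>x y. fval f x \<Longrightarrow> (\<And>i. i < arity f \<Longrightarrow> x i \<Longrightarrow> y i) \<Longrightarrow> fval f y"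
    and selfdual: "\<And>x. fval f (\<lambda>i. \<not> x i) \<longleftrightarrow> \<not> fval f x"
  shows "f \<in> C"
proof -
  define n where "n = arity f"
  have n: "n \<ge> 1" using arity_ge_1 n_def by simp
  have two: "\<exists>i<n. x i = fval f x \<and> y i = fval f y" for x y
  proof (rule ccontr)
    assume "\<not> (\<exists>i<n. x i = fval f x \<and> y i = fval f y)"
    then have no: "x i \<noteq> fval f x \<or> y i \<noteq> fval f y" if "i < arity f" for i
      using that n_def by blast
    \<comment> \<open>When no position fits, the tuples are ordered: for two values true,
      \<open>x\<close> lies below the negation of \<open>y\<close>; for two values false, the
      negation of \<open>x\<close> lies below \<open>y\<close>; for different values, the tuple with
      value true lies below the other.\<close>
    consider "fval f x" "fval f y" | "fval f x" "\<not> fval f y" | "\<not> fval f x" "fval f y"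
      | "\<not> fval f x" "\<not> fval f y" by blast
    then show False
    proof cases
      case 1
      have "fval f (\<lambda>i. \<not> y i)" by (rule mono [OF 1(1)]) (use no 1 in blast)
      then show False using selfdual 1 by blast
    next
      case 2
      have "fval f y" by (rule mono [OF 2(1)]) (use no 2 in blast)
      then show False using 2 by blast
    next
      case 3
      have "fval f x" by (rule mono [OF 3(2)]) (use no 3 in blast)
      then show False using 3 by blast
    next
      case 4
      then have "fval f (\<lambda>i. \<not> x i)" using selfdual by blast
      then have "fval f y" by (rule mono) (use no 4 in blast)
      then show False using 4 by blast
    qed
  qed
  have interpolate: "\<exists>G. mk_fun n G \<in> C \<and> (\<forall>a\<in>T. G a = fval f ((!) a))" if "finite T" for T
    using that
  proof (induction T rule: finite_psubset_induct)
    case (psubset T)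
    show ?case
    proof (cases "\<exists>a b c. {a, b, c} \<subseteq> T \<and> a \<noteq> b \<and> a \<noteq> c \<and> b \<noteq> c")
      case True
      then obtain a b c where abc: "a \<in> T" "b \<in> T" "c \<in> T" "a \<noteq> b" "a \<noteq> c" "b \<noteq> c" by auto
      \<comment> \<open>Each of the three interpolants can fail at one tuple only, and these tuples
        are distinct, so the majority is right everywhere.\<close>
      have "\<exists>G. mk_fun n G \<in> C \<and> (\<forall>x\<in>T - {d}. G x = fval f ((!) x))" if "d \<in> T" for d
        using that by (intro psubset.IH) auto
      then have "\<forall>d\<in>T. \<exists>G. mk_fun n G \<in> C \<and> (\<forall>x\<in>T - {d}. G x = fval f ((!) x))" by (rule ballI)
      from bchoice [OF this] obtain G
        where G': "\<forall>d\<in>T. mk_fun n (G d) \<in> C \<and> (\<forall>x\<in>T - {d}. G d x = fval f ((!) x))" ..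
      have G: "mk_fun n (G d) \<in> C" "x \<in> T \<Longrightarrow> x \<noteq> d \<Longrightarrow> G d x = fval f ((!) x)" if "d \<in> T" for d x
        using G' that by simp_all
      have "mk_fun n (\<lambda>x. maj (G a x) (G b x) (G c x)) \<in> C"
        using ternary_subst [OF C maj n G(1) [OF abc(1)] G(1) [OF abc(2)] G(1) [OF abc(3)]] .
      moreover have "\<forall>x\<in>T. maj (G a x) (G b x) (G c x) = fval f ((!) x)"
      proof
        fix x assume "x \<in> T"
        show "maj (G a x) (G b x) (G c x) = fval f ((!) x)"
        using G(2) [OF abc(1) \<open>x \<in> T\<close>] G(2) [OF abc(2) \<open>x \<in> T\<close>] G(2) [OF abc(3) \<open>x \<in> T\<close>] abc(4-6)
        unfolding maj_def by (cases "x = a"; cases "x = b"; cases "x = c") auto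
      qed
      ultimately show ?thesis by (intro exI conjI)
    next
      case False
      have "\<exists>a b. T \<subseteq> {a, b}"
      proof (cases "T = {}")
        case nonempty: False
        then obtain a where "a \<in> T" by blast
        show ?thesis
        proof (cases "T = {a}")
          case False
          then obtain b where "b \<in> T" "b \<noteq> a" using \<open>a \<in> T\<close> by blast
          then have "T \<subseteq> {a, b}"
            using \<open>a \<in> T\<close> \<open>\<not> (\<exists>a b c. {a, b, c} \<subseteq> T \<and> a \<noteq> b \<and> a \<noteq> c \<and> b \<noteq> c)\<close> by auto
          then show ?thesis by blast
        qed blast
      qed blast
      then obtain a b where T: "T \<subseteq> {a, b}" by blast
      obtain i where "i < n" "a ! i = fval f ((!) a)" "b ! i = fval f ((!) b)"
        using two by blast
      then show ?thesis using T clone_proj [OF C, of i n] by (intro exI [of _ "\<lambda>a. a ! i"]) auto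
    qed
  qed
  have "finite {a :: bool list. length a = n}"
    using finite_lists_length_eq [of "UNIV :: bool set" n] by simp
  from interpolate [OF this] obtain G where G: "mk_fun n G \<in> C"
    "\<And>a. length a = n \<Longrightarrow> G a = fval f ((!) a)" by auto
  have "f = mk_fun n G" using G(2) by (intro mk_fun_eqI) (simp_all add: n_def app_eq_fval)
  then show ?thesis using G(1) by simp
qed

subsection \<open>A pair of hypergraphs\<close>

text \<open>Regularity gives every \<open>edge s\<close> the size \<open>2 * h + 1\<close>, and
  \<open>odd_h\<close> governs the parity of its intersections with transversals. For arguments from
  two different pairs, \<open>separating\<close> supplies an edge based at neither pair that
  contains one pair and avoids the other.\<close>

locale tournament =
  fixes m h :: nat and dom :: "nat \<Rightarrow> nat \<Rightarrow> bool"
  assumes m_eq: "m = 2 * h + 1" and odd_h: "odd h"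
    and irrefl: "\<not> dom s s"
    and total: "s < m \<Longrightarrow> t < m \<Longrightarrow> s \<noteq> t \<Longrightarrow> dom s t \<longleftrightarrow> \<not> dom t s"
    and outdegree: "s < m \<Longrightarrow> card {t. t < m \<and> dom s t} = h"
    and separating: "p < m \<Longrightarrow> q < m \<Longrightarrow> p \<noteq> q \<Longrightarrow> \<exists>s<m. s \<noteq> p \<and> s \<noteq> q \<and> dom s p \<noteq> dom s q"
begin

text \<open>The pairs are \<open>{2 p, 2 p + 1}\<close> for \<open>p < m\<close>.\<close>

definition edge :: "nat \<Rightarrow> nat set" where
  "edge s = insert (2 * s) {i. i < 2 * m \<and> dom s (i div 2)}"

definition transversal :: "nat set \<Rightarrow> bool" where
  "transversal Y \<longleftrightarrow> Y \<subseteq> {..<2 * m} \<and> (\<forall>p<m. 2 * p \<in> Y \<longleftrightarrow> 2 * p + 1 \<notin> Y)"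

definition odd_transversal :: "nat set \<Rightarrow> bool" where
  "odd_transversal Y \<longleftrightarrow> odd (card {p. p < m \<and> 2 * p + 1 \<in> Y})"

definition H :: "bool \<Rightarrow> nat set set" where
  "H b = {Y. transversal Y \<and> odd_transversal Y = b} \<union> edge ` {..<m}"

definition swap :: "nat \<Rightarrow> nat \<Rightarrow> nat" where
  "swap s i = (if i = 2 * s then 2 * s + 1 else if i = 2 * s + 1 then 2 * s else i)"

definition swapped :: "nat \<Rightarrow> nat set \<Rightarrow> nat set" where
  "swapped s Y = {i. swap s i \<in> Y}"

text \<open>Transversals described by the pairs from which the second element is taken; the empty
  set and singletons give the even and odd transversals used below.\<close>

definition selection :: "nat set \<Rightarrow> nat set" where
  "selection P = {i. i < 2 * m \<and> (odd i \<longleftrightarrow> i div 2 \<in> P)}"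

lemma h_pos: "h \<ge> 1"
  using odd_h by (cases h) auto

lemma edge_subset: "s < m \<Longrightarrow> edge s \<subseteq> {..<2 * m}"
  by (auto simp: edge_def)

lemma H_subset: "Y \<in> H b \<Longrightarrow> Y \<subseteq> {..<2 * m}"
  using edge_subset by (auto simp: H_def transversal_def)

lemma even_in_edge: "p < m \<Longrightarrow> 2 * p \<in> edge s \<longleftrightarrow> p = s \<or> dom s p"
  by (auto simp: edge_def)

lemma odd_in_edge: "p < m \<Longrightarrow> Suc (2 * p) \<in> edge s \<longleftrightarrow> dom s p"
  by (auto simp: edge_def) (metis Suc_double_not_eq_double)

lemma in_edge: "i < 2 * m \<Longrightarrow> i div 2 \<noteq> s \<Longrightarrow> i \<in> edge s \<longleftrightarrow> dom s (i div 2)"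
  by (auto simp: edge_def)

section \<open>Sizes and parities of intersections, counted pair by pair\<close>

lemma card_eq_sum:
  assumes "Y \<subseteq> {..<2 * m}"
  shows "card Y = (\<Sum>p<m. of_bool (2 * p \<in> Y) + of_bool (Suc (2 * p) \<in> Y))"
proof -
  have "card (Y \<inter> {..<2 * k}) = (\<Sum>p<k. of_bool (2 * p \<in> Y) + of_bool (Suc (2 * p) \<in> Y))" for k
  proof (induction k)
    case (Suc k)
    have "Y \<inter> {..<2 * Suc k} = (Y \<inter> {..<2 * k}) \<union> (Y \<inter> {2 * k, Suc (2 * k)})" by auto
    also have "card \<dots> = card (Y \<inter> {..<2 * k}) + card (Y \<inter> {2 * k, Suc (2 * k)})"
      by (intro card_Un_disjoint) auto
    also have "card (Y \<inter> {2 * k, Suc (2 * k)}) = of_bool (2 * k \<in> Y) + of_bool (Suc (2 * k) \<in> Y)"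
      by (cases "2 * k \<in> Y"; cases "Suc (2 * k) \<in> Y") (simp_all add: Int_insert_right)
    finally show ?case using Suc.IH by simp
  qed simp
  from this [of m] assms show ?thesis by (simp add: Int_absorb2)
qed

lemma sum_dom: "s < m \<Longrightarrow> (\<Sum>p<m. of_bool (dom s p)) = h"
  using outdegree [of s] by (simp add: of_bool_def sum.If_cases Int_def)

lemma sum_single: "s < m \<Longrightarrow> (\<Sum>p<m. of_bool (p = s \<and> P)) = (of_bool P :: nat)"
  by (cases P) (simp_all add: of_bool_def)

lemma card_edge:
  assumes s: "s < m"
  shows "card (edge s) = m"
proof -
  have "card (edge s) = (\<Sum>p<m. of_bool (2 * p \<in> edge s) + of_bool (Suc (2 * p) \<in> edge s))"
    using s by (intro card_eq_sum edge_subset)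
  also have "\<dots> = (\<Sum>p<m. of_bool (p = s \<and> True) + (of_bool (dom s p) + of_bool (dom s p)))"
    using irrefl by (intro sum.cong refl) (auto simp: even_in_edge odd_in_edge)
  also have "\<dots> = 1 + (h + h)"
    unfolding sum.distrib sum_dom [OF s] sum_single [OF s] by simp
  finally show ?thesis by (simp add: m_eq)
qed

lemma card_transversal:
  assumes "transversal Y"
  shows "card Y = m"
proof -
  have "card Y = (\<Sum>p<m. of_bool (2 * p \<in> Y) + of_bool (Suc (2 * p) \<in> Y))"
    using assms by (intro card_eq_sum) (simp add: transversal_def)
  also have "\<dots> = (\<Sum>p<m. 1)"
    using assms by (intro sum.cong) (auto simp: transversal_def)
  finally show ?thesis by simp
qed

lemma card_H: "Y \<in> H b \<Longrightarrow> card Y = m"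
  using card_edge card_transversal by (auto simp: H_def)

lemma odd_m: "odd m"
  by (simp add: m_eq)

text \<open>For distinct \<open>s\<close> and \<open>t\<close>, pairs dominated by both contribute
  2. The pair \<open>s\<close> contributes 1 if \<open>t\<close> dominates \<open>s\<close>, the
  pair \<open>t\<close> contributes 1 if \<open>s\<close> dominates \<open>t\<close>, and exactly
  one of these occurs.\<close>

lemma odd_edge_Int_edge:
  assumes s: "s < m" and t: "t < m"
  shows "odd (card (edge s \<inter> edge t))"
proof (cases "s = t")
  case True
  then show ?thesis using card_edge s odd_m by simp
next
  case False
  have "card (edge s \<inter> edge t) =
      (\<Sum>p<m. of_bool (2 * p \<in> edge s \<inter> edge t) + of_bool (Suc (2 * p) \<in> edge s \<inter> edge t))"
    using edge_subset [OF s] by (intro card_eq_sum) auto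
  also have "\<dots> = (\<Sum>p<m. of_bool (p = s \<and> dom t s) + of_bool (p = t \<and> dom s t) +
      2 * of_bool (dom s p \<and> dom t p))"
    using irrefl False by (intro sum.cong refl) (auto simp: even_in_edge odd_in_edge)
  also have "\<dots> = of_bool (dom t s) + of_bool (dom s t) + 2 * (\<Sum>p<m. of_bool (dom s p \<and> dom t p))"
    unfolding sum.distrib sum_single [OF s] sum_single [OF t] sum_distrib_left ..
  also have "of_bool (dom t s) + of_bool (dom s t) = (1 :: nat)"
    using total [OF s t False] by auto
  finally show ?thesis by simp
qed

text \<open>Each of the \<open>h\<close> pairs dominated by \<open>s\<close> meets \<open>T\<close>
  once, and \<open>h\<close> is odd; the pair \<open>s\<close> contributes one more exactly if its
  first element lies in \<open>T\<close>.\<close>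

lemma even_transversal_Int_edge:
  assumes T: "transversal T" and s: "s < m"
  shows "even (card (T \<inter> edge s)) \<longleftrightarrow> 2 * s \<in> T"
proof -
  have "card (T \<inter> edge s) =
      (\<Sum>p<m. of_bool (2 * p \<in> T \<inter> edge s) + of_bool (Suc (2 * p) \<in> T \<inter> edge s))"
    using edge_subset [OF s] by (intro card_eq_sum) auto
  also have "\<dots> = (\<Sum>p<m. of_bool (p = s \<and> 2 * s \<in> T) + of_bool (dom s p))"
    using irrefl T by (intro sum.cong refl) (auto simp: even_in_edge odd_in_edge transversal_def)
  also have "\<dots> = of_bool (2 * s \<in> T) + h"
    unfolding sum.distrib sum_single [OF s] sum_dom [OF s] ..
  finally show ?thesis using odd_h by simp
qed

text \<open>The two transversals disagree on an even number of pairs, so they agree on an odd number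
  of the \<open>m\<close> pairs.\<close>

lemma odd_transversal_Int_transversal:
  assumes T: "transversal T" and U: "transversal U" and par: "odd_transversal T = odd_transversal U"
  shows "odd (card (T \<inter> U))"
proof -
  let ?A = "{p. p < m \<and> 2 * p + 1 \<in> T}" and ?B = "{p. p < m \<and> 2 * p + 1 \<in> U}"
  have "even (card {p \<in> (?A - ?B) \<union> (?B - ?A). True})"
    using odd_card_sym_diff [of ?A ?B "\<lambda>_. True"] par by (simp add: odd_transversal_def)
  also have "{p \<in> (?A - ?B) \<union> (?B - ?A). True} = {p \<in> {..<m}. (2 * p + 1 \<in> T) \<noteq> (2 * p + 1 \<in> U)}"
    by auto
  also have "card \<dots> = (\<Sum>p<m. of_bool ((2 * p + 1 \<in> T) \<noteq> (2 * p + 1 \<in> U)))"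
    by (simp add: of_bool_def sum.If_cases Int_def)
  finally have ev: "even (\<Sum>p<m. of_bool ((2 * p + 1 \<in> T) \<noteq> (2 * p + 1 \<in> U)) :: nat)" .
  have "card (T \<inter> U) + (\<Sum>p<m. of_bool ((2 * p + 1 \<in> T) \<noteq> (2 * p + 1 \<in> U))) =
      (\<Sum>p<m. of_bool (2 * p \<in> T \<inter> U) + of_bool (Suc (2 * p) \<in> T \<inter> U)
        + of_bool ((2 * p + 1 \<in> T) \<noteq> (2 * p + 1 \<in> U)))"
    using T by (subst card_eq_sum) (auto simp: transversal_def sum.distrib)
  also have "\<dots> = (\<Sum>p<m. 1)"
    using T U by (intro sum.cong refl) (auto simp: transversal_def)
  finally have "card (T \<inter> U) + (\<Sum>p<m. of_bool ((2 * p + 1 \<in> T) \<noteq> (2 * p + 1 \<in> U))) = m"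
    by simp
  then have "odd (card (T \<inter> U) + (\<Sum>p<m. of_bool ((2 * p + 1 \<in> T) \<noteq> (2 * p + 1 \<in> U))))"
    using odd_m by simp
  with ev show ?thesis unfolding even_add by blast
qed

lemma even_in_selection [simp]: "2 * p \<in> selection P \<longleftrightarrow> p < m \<and> p \<notin> P"
  and odd_in_selection [simp]: "Suc (2 * p) \<in> selection P \<longleftrightarrow> p < m \<and> p \<in> P"
  by (auto simp: selection_def)

lemma transversal_selection: "transversal (selection P)"
  unfolding transversal_def by (auto simp: selection_def)

lemma odd_transversal_selection: "P \<subseteq> {..<m} \<Longrightarrow> odd_transversal (selection P) \<longleftrightarrow> odd (card P)"
proof -
  assume "P \<subseteq> {..<m}"
  then have "{p. p < m \<and> 2 * p + 1 \<in> selection P} = P" by auto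
  then show ?thesis by (simp add: odd_transversal_def)
qed

lemma even_Int_cases:
  assumes "A \<in> H b" "B \<in> H b" "even (card (A \<inter> B))"
  obtains s where "s < m" "A = edge s \<or> B = edge s"
proof -
  consider "transversal A" "odd_transversal A = b" "transversal B" "odd_transversal B = b"
    | s where "s < m" "A = edge s \<or> B = edge s"
    using assms(1,2) by (auto simp: H_def)
  then show ?thesis
  proof cases
    case 1
    then show ?thesis using odd_transversal_Int_transversal [of A B] assms(3) by simp
  qed (rule that)
qed

text \<open>
  The sets \<open>edge s\<close> and the transversals form the two sides of a bipartite graph in which
  adjacency is even intersection. A dominating transversal contains all first elements,
  so it exists for the even parity only; this distinguishes \<open>H False\<close> from \<open>H True\<close>.
\<close>

definition dominating :: "nat set set \<Rightarrow> nat set \<Rightarrow> bool" where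
  "dominating F T \<longleftrightarrow> T \<in> F \<and> (\<forall>A\<in>F. \<forall>B\<in>F. even (card (A \<inter> B)) \<longrightarrow>
     even (card (T \<inter> A)) \<or> even (card (T \<inter> B)))"

text \<open>An even intersection within \<open>H False\<close> involves an edge, and the transversal
  of all first elements meets every edge evenly.\<close>

lemma dominating_H_False: "dominating (H False) (selection {})"
  unfolding dominating_def
proof (intro conjI ballI impI)
  show "selection {} \<in> H False"
    using transversal_selection odd_transversal_selection [of "{}"] by (auto simp: H_def)
  fix A B assume "A \<in> H False" "B \<in> H False" "even (card (A \<inter> B))"
  then obtain s where "s < m" "A = edge s \<or> B = edge s" by (rule even_Int_cases)
  then show "even (card (selection {} \<inter> A)) \<or> even (card (selection {} \<inter> B))"
    using even_transversal_Int_edge [OF transversal_selection, of s "{}"] by auto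
qed

text \<open>An odd transversal contains the second element of some pair \<open>s\<close>; for
  another pair \<open>t\<close>, the sets \<open>selection {t}\<close> and \<open>edge s\<close> are
  adjacent, but neither is adjacent to it. For \<open>T = edge t\<close>, the same two sets with any
  \<open>s\<close> other than \<open>t\<close> refute domination.\<close>

lemma not_dominating_H_True: "\<not> dominating (H True) T"
proof
  assume T: "dominating (H True) T"
  have single: "selection {t} \<in> H True" if "t < m" for t
    using that transversal_selection odd_transversal_selection [of "{t}"] by (auto simp: H_def)
  have edge: "edge s \<in> H True" if "s < m" for s using that by (simp add: H_def)
  from T have "T \<in> H True" by (simp add: dominating_def)
  then consider "transversal T" "odd_transversal T" | t where "t < m" "T = edge t"
    by (auto simp: H_def)
  then show False
  proof cases
    case 1
    have "{p. p < m \<and> 2 * p + 1 \<in> T} \<noteq> {}" 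
      using 1(2) unfolding odd_transversal_def by (metis card.empty even_zero)
    then obtain s where s: "s < m" "2 * s + 1 \<in> T" by blast
    then have nT: "2 * s \<notin> T" using 1(1) by (auto simp: transversal_def)
    obtain t where t: "t < m" "t \<noteq> s" using s h_pos m_eq that [of 0] that [of 1] by (cases "s = 0") auto
    have "even (card (selection {t} \<inter> edge s))"
      using even_transversal_Int_edge [OF transversal_selection s(1), of "{t}"] s t by simp
    then have "even (card (T \<inter> selection {t})) \<or> even (card (T \<inter> edge s))"
      using T single [OF t(1)] edge [OF s(1)] unfolding dominating_def by blast
    moreover have "odd (card (T \<inter> selection {t}))"
      using 1 t odd_transversal_Int_transversal [OF 1(1) transversal_selection, of "{t}"]
        odd_transversal_selection [of "{t}"] by simp
    ultimately show False using even_transversal_Int_edge [OF 1(1) s(1)] nT by simp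
  next
    case 2
    obtain s where s: "s < m" "s \<noteq> t" using 2(1) h_pos m_eq that [of 0] that [of 1] by (cases "t = 0") auto
    have "even (card (selection {t} \<inter> edge s))"
      using even_transversal_Int_edge [OF transversal_selection s(1), of "{t}"] s by simp
    then have "even (card (T \<inter> selection {t})) \<or> even (card (T \<inter> edge s))"
      using T single [OF 2(1)] edge [OF s(1)] unfolding dominating_def by blast
    moreover have "odd (card (T \<inter> edge s))" using odd_edge_Int_edge 2 s by simp
    moreover have "odd (card (T \<inter> selection {t}))"
      using even_transversal_Int_edge [OF transversal_selection 2(1), of "{t}"] 2
      by (simp add: Int_commute)
    ultimately show False by simp
  qed
qed

section \<open>Exchanging the elements of a pair\<close>

lemma swap_swap [simp]: "swap s (swap s i) = i"
  by (auto simp: swap_def)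

lemma swap_less: "s < m \<Longrightarrow> swap s i < 2 * m \<longleftrightarrow> i < 2 * m"
  by (auto simp: swap_def)

lemma swapped_swapped [simp]: "swapped s (swapped s Y) = Y"
  by (simp add: swapped_def)

lemma swapped_eq_image: "swapped s Y = swap s ` Y"
  by (auto simp: swapped_def) (metis swap_swap image_eqI)

lemma card_swapped [simp]: "card (swapped s Y) = card Y"
  unfolding swapped_eq_image by (rule card_image) (metis injI inj_on_subset subset_UNIV swap_swap)

lemma swapped_subset: "s < m \<Longrightarrow> Y \<subseteq> {..<2 * m} \<Longrightarrow> swapped s Y \<subseteq> {..<2 * m}"
  using swap_less by (auto simp: swapped_def)

lemma swapped_edge:
  assumes "s < m" "t < m" "s \<noteq> t"
  shows "swapped s (edge t) = edge t"
proof -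
  have "swap s i div 2 = i div 2" for i by (auto simp: swap_def)
  moreover have "swap s i = 2 * t \<longleftrightarrow> i = 2 * t" for i
    using assms(3) by (auto simp: swap_def)
  ultimately show ?thesis
    using assms by (auto simp: swapped_def edge_def swap_less)
qed

lemma transversal_swapped:
  assumes s: "s < m" and Y: "transversal Y"
  shows "transversal (swapped s Y)" "odd_transversal (swapped s Y) \<longleftrightarrow> \<not> odd_transversal Y"
proof -
  have in1: "2 * p \<in> swapped s Y \<longleftrightarrow> (if p = s then 2 * p + 1 \<in> Y else 2 * p \<in> Y)" for p
    by (auto simp: swapped_def swap_def)
  have in2: "2 * p + 1 \<in> swapped s Y \<longleftrightarrow> (if p = s then 2 * p \<in> Y else 2 * p + 1 \<in> Y)" for p
    by (auto simp: swapped_def swap_def)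
  show "transversal (swapped s Y)"
    using Y swapped_subset [OF s, of Y] unfolding transversal_def in1 in2 by auto
  let ?A = "{p. p < m \<and> p \<noteq> s \<and> 2 * p + 1 \<in> Y}"
  have "{p. p < m \<and> 2 * p + 1 \<in> swapped s Y} = (if 2 * s \<in> Y then insert s ?A else ?A)"
    using s unfolding in2 by auto
  moreover have "{p. p < m \<and> 2 * p + 1 \<in> Y} = (if 2 * s \<in> Y then ?A else insert s ?A)"
    using s Y by (auto simp: transversal_def)
  ultimately show "odd_transversal (swapped s Y) \<longleftrightarrow> \<not> odd_transversal Y"
    by (simp add: odd_transversal_def)
qed

text \<open>The exchange toggles the parity of transversals and fixes every edge except
  \<open>edge s\<close>, so only that edge and its image are excluded.\<close>

lemma H_swapped:
  assumes s: "s < m" and Y: "Y \<noteq> edge s" "Y \<noteq> swapped s (edge s)"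
  shows "Y \<in> H False \<longleftrightarrow> swapped s Y \<in> H True"
proof -
  have *: "swapped s Y \<in> H (\<not> b)" if "Y \<in> H b" "Y \<noteq> edge s" for Y b
    using that transversal_swapped [OF s] swapped_edge [OF s] unfolding H_def by force
  have "swapped s Y \<noteq> edge s" using Y(2) swapped_swapped by metis
  then show ?thesis using * [of Y False] * [of "swapped s Y" True] Y(1) by auto
qed

section \<open>Monotone functions obtained from the hypergraphs\<close>

definition good :: "bool \<Rightarrow> nat set \<Rightarrow> bool" where
  "good b Y \<longleftrightarrow> m \<le> card Y \<and> Y \<notin> H b"

lemma good_swapped:
  "s < m \<Longrightarrow> Y \<noteq> edge s \<Longrightarrow> Y \<noteq> swapped s (edge s) \<Longrightarrow> good False Y \<longleftrightarrow> good True (swapped s Y)"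
  using H_swapped by (simp add: good_def)

lemma good_same_pair:
  assumes "p < m" "2 * p \<in> Y \<longleftrightarrow> 2 * p + 1 \<in> Y"
  shows "good False Y \<longleftrightarrow> good True Y"
  using assms by (auto simp: good_def H_def transversal_def)

lemma good_mono:
  assumes "good b Y" "Y \<subseteq> Z" "finite Z"
  shows "good b Z"
proof (cases "Y = Z")
  case False
  then have "card Y < card Z" using assms by (intro psubset_card_mono) auto
  then show ?thesis using assms card_H [of Z b] by (auto simp: good_def)
qed (use assms in simp)

text \<open>Two complementary sets in \<open>H b\<close> would have an empty, hence even,
  intersection, so one of them is an edge. The complement of \<open>edge s\<close> omits a whole
  pair and takes only the second element of the pair \<open>s\<close>, so it is neither a
  transversal nor an edge.\<close>

lemma good_complement:
  assumes Y: "Y \<subseteq> {..<2 * m}" and ng: "\<not> good b Y"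
  shows "good b ({..<2 * m} - Y)"
proof (cases "m \<le> card Y")
  case False
  have "card ({..<2 * m} - Y) = 2 * m - card Y"
    using Y finite_subset by (subst card_Diff_subset) auto
  then show ?thesis using False card_H [of "{..<2 * m} - Y" b] by (auto simp: good_def)
next
  case True
  let ?Z = "{..<2 * m} - Y"
  have YH: "Y \<in> H b" using True ng by (simp add: good_def)
  have "card ?Z = m"
    using Y finite_subset card_H [OF YH] by (subst card_Diff_subset) auto
  moreover have "?Z \<notin> H b"
  proof
    assume "?Z \<in> H b"
    moreover have "even (card (Y \<inter> ?Z))" by simp
    ultimately obtain s where s: "s < m" "Y = edge s \<or> ?Z = edge s"
      using YH even_Int_cases by blast
    define U where "U = (if Y = edge s then ?Z else Y)"
    have U: "U = {..<2 * m} - edge s" "U \<in> H b"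
      using s Y YH \<open>?Z \<in> H b\<close> by (auto simp: U_def)
    have "card {t. t < m \<and> dom s t} \<noteq> 0" using outdegree s h_pos by simp
    then obtain t where t: "t < m" "dom s t" by (metis (mono_tags, lifting) card.empty empty_Collect_eq)
    then have nt: "2 * t \<notin> U" "2 * t + 1 \<notin> U" using U by (auto simp: even_in_edge odd_in_edge)
    then have "\<not> transversal U" using t by (auto simp: transversal_def)
    then obtain u where u: "u < m" "U = edge u" using U(2) by (auto simp: H_def)
    have "2 * s \<notin> U" "2 * s + 1 \<in> U" using U s irrefl by (auto simp: even_in_edge odd_in_edge)
    then show False using u s by (auto simp: even_in_edge odd_in_edge)
  qed
  ultimately show ?thesis by (simp add: good_def)
qed

text \<open>
  The last argument \<open>2 m\<close> selects between \<open>good b\<close> and its dual, on which \<open>R\<close> acts: negation gives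
  a self-dual function, the constant \<open>False\<close> a function below a projection.
\<close>

definition val :: "(bool \<Rightarrow> bool) \<Rightarrow> bool \<Rightarrow> nat set \<Rightarrow> bool" where
  "val R b X = (if 2 * m \<in> X then good b (X - {2 * m}) else R (good b ({..<2 * m} - X)))"

definition design_fun :: "(bool \<Rightarrow> bool) \<Rightarrow> bool \<Rightarrow> boolfun" where
  "design_fun R b = mk_fun (2 * m + 1) (\<lambda>a. val R b {i. i < 2 * m + 1 \<and> a ! i})"

lemma arity_design_fun [simp]: "arity (design_fun R b) = 2 * m + 1"
  by (simp add: design_fun_def)

lemma fval_design_fun [simp]: "fval (design_fun R b) x = val R b {i. i < 2 * m + 1 \<and> x i}"
proof -
  have "{i. i < 2 * m + 1 \<and> map x [0..<2 * m + 1] ! i} = {i. i < 2 * m + 1 \<and> x i}"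
    by (auto simp del: upt_Suc)
  then show ?thesis by (simp add: design_fun_def del: upt_Suc)
qed

lemma good_full: "good b {..<2 * m}"
proof -
  have "card {..<2 * m} \<noteq> m" using m_eq by simp
  then have "{..<2 * m} \<notin> H b" using card_H by blast
  then show ?thesis by (simp add: good_def)
qed

text \<open>The hypothesis leaves negation and the constant false function for \<open>R\<close>,
  both antitone. Passing from the half without \<open>2 * m\<close> to the half with it relies on
  \<open>good_complement\<close>.\<close>

lemma val_mono:
  assumes R: "\<not> R True" and X: "val R b X" and XZ: "X \<subseteq> Z" and Z: "Z \<subseteq> {..<2 * m + 1}"
  shows "val R b Z"
proof -
  have fin: "finite Z" using Z finite_subset by blast
  show ?thesis
  proof (cases "2 * m \<in> X")
    case True
    then have "good b (X - {2 * m})" using X by (simp add: val_def)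
    then have "good b (Z - {2 * m})" by (rule good_mono) (use XZ fin in auto)
    then show ?thesis using True XZ by (auto simp: val_def)
  next
    case False
    then have RX: "R (good b ({..<2 * m} - X))" using X by (simp add: val_def)
    then have ng: "\<not> good b ({..<2 * m} - X)" and RF: "R False"
      using R by (cases "good b ({..<2 * m} - X)"; simp)+
    have "good b ({..<2 * m} - ({..<2 * m} - X))" using ng by (intro good_complement) auto
    moreover have "{..<2 * m} - ({..<2 * m} - X) = X"
      using False XZ Z by (force simp: less_Suc_eq)
    ultimately have gX: "good b X" by simp
    show ?thesis
    proof (cases "2 * m \<in> Z")
      case True
      have "good b (Z - {2 * m})" using gX by (rule good_mono) (use XZ False fin in auto)
      then show ?thesis using True by (simp add: val_def)
    next
      case ZF: False
      have "\<not> good b ({..<2 * m} - Z)"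
        using ng good_mono [of b "{..<2 * m} - Z" "{..<2 * m} - X"] XZ by auto
      then show ?thesis using ZF RF by (simp add: val_def)
    qed
  qed
qed

lemma val_selfdual:
  assumes "X \<subseteq> {..<2 * m + 1}"
  shows "val Not b ({..<2 * m + 1} - X) \<longleftrightarrow> \<not> val Not b X"
proof (cases "2 * m \<in> X")
  case True
  then have "{..<2 * m} - ({..<2 * m + 1} - X) = X - {2 * m}"
    using assms by (auto simp: less_Suc_eq)
  then show ?thesis using True by (simp add: val_def)
next
  case False
  then have "{..<2 * m + 1} - X - {2 * m} = {..<2 * m} - X" by auto
  then show ?thesis using False by (simp add: val_def)
qed

section \<open>Agreement of the identification minors\<close>

text \<open>If \<open>j\<close> is the selector \<open>2 * m\<close>, identification puts
  \<open>i\<close> into the set tested by \<open>good\<close> in both halves: into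
  \<open>X - {2 * m}\<close> if the selector is in \<open>X\<close>, into the complement otherwise.
  The selector thus counts as always present, and an edge avoiding the pair of \<open>i\<close> is
  sought.\<close>

lemma exists_separating_edge:
  assumes "i < j" "j \<le> 2 * m" "i div 2 \<noteq> j div 2"
  obtains s where "s < m" "s \<noteq> i div 2" "s \<noteq> j div 2"
    "dom s (i div 2) \<noteq> (if j = 2 * m then True else dom s (j div 2))"
proof (cases "j = 2 * m")
  case True
  have p: "i div 2 < m" using assms(1) True by auto
  then have "card {t. t < m \<and> dom (i div 2) t} \<noteq> 0" using outdegree h_pos by simp
  then obtain s where s: "s < m" "dom (i div 2) s"
    by (metis (mono_tags, lifting) card.empty empty_Collect_eq)
  then have "s \<noteq> i div 2" using irrefl by auto
  then have "\<not> dom s (i div 2)" using total [OF s(1) p] s(2) by simp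
  then show ?thesis using that [of s] s True \<open>s \<noteq> i div 2\<close> by simp
next
  case False
  then have "i div 2 < m" "j div 2 < m" using assms by auto
  then show ?thesis using separating [OF _ _ assms(3)] that False by auto
qed

text \<open>The tested set treats \<open>i\<close> and \<open>j\<close> alike, also after
  complementation, whereas \<open>edge s\<close> and its image separate them. So neither of these
  can occur as the tested set.\<close>

lemma val_swapped:
  assumes s: "s < m" "s \<noteq> i div 2" "s \<noteq> j div 2"
    and sep: "dom s (i div 2) \<noteq> (if j = 2 * m then True else dom s (j div 2))"
    and ij: "i < j" "j \<le> 2 * m" and X: "X \<subseteq> {..<2 * m + 1}" "i \<in> X \<longleftrightarrow> j \<in> X"
  shows "val R False X = val R True (swapped s X)"
proof -
  have i: "i < 2 * m" using ij by simp
  have swap_id: "swap s k = k" if "k div 2 \<noteq> s" for k using that by (auto simp: swap_def)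
  have i_edge: "i \<in> edge s \<longleftrightarrow> dom s (i div 2)" "i \<in> swapped s (edge s) \<longleftrightarrow> dom s (i div 2)"
    using in_edge [OF i, of s] s swap_id [of i] by (auto simp: swapped_def)
  have j_edge: "j \<in> edge s \<longleftrightarrow> dom s (j div 2)" "j \<in> swapped s (edge s) \<longleftrightarrow> dom s (j div 2)" if "j \<noteq> 2 * m"
    using in_edge [of j s] ij that s swap_id [of j] by (auto simp: swapped_def)
  have z: "2 * m \<in> swapped s X \<longleftrightarrow> 2 * m \<in> X"
    using s swap_id [of "2 * m"] by (simp add: swapped_def)
  have neq: "Y \<noteq> edge s \<and> Y \<noteq> swapped s (edge s)"
    if "i \<in> Y \<longleftrightarrow> (if j = 2 * m then True else j \<in> Y)" for Y
  proof (rule ccontr)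
    assume "\<not> (Y \<noteq> edge s \<and> Y \<noteq> swapped s (edge s))"
    then have "i \<in> Y \<longleftrightarrow> dom s (i div 2)" "j \<noteq> 2 * m \<Longrightarrow> j \<in> Y \<longleftrightarrow> dom s (j div 2)"
      using i_edge j_edge by auto
    then show False using that sep by (auto split: if_splits)
  qed
  show ?thesis
  proof (cases "2 * m \<in> X")
    case True
    have "swapped s X - {2 * m} = swapped s (X - {2 * m})"
    proof -
      have "swap s k = 2 * m \<longleftrightarrow> k = 2 * m" for k
        using s(1) swap_id [of "2 * m"] by (metis nonzero_mult_div_cancel_left less_irrefl swap_swap zero_neq_numeral)
      then show ?thesis by (auto simp: swapped_def)
    qed
    moreover have "good False (X - {2 * m}) = good True (swapped s (X - {2 * m}))"
      using neq [of "X - {2 * m}"] X True ij s(1) by (intro good_swapped) auto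
    ultimately show ?thesis using True z by (simp add: val_def)
  next
    case False
    have "{..<2 * m} - swapped s X = swapped s ({..<2 * m} - X)"
      using s(1) swap_less by (auto simp: swapped_def)
    moreover have "good False ({..<2 * m} - X) = good True (swapped s ({..<2 * m} - X))"
      using neq [of "{..<2 * m} - X"] X False ij s(1) by (intro good_swapped) auto
    ultimately show ?thesis using False z by (simp add: val_def)
  qed
qed

lemma val_same_pair:
  assumes p: "p < m" and X: "2 * p \<in> X \<longleftrightarrow> 2 * p + 1 \<in> X"
  shows "val R False X = val R True X"
proof -
  have "good False (X - {2 * m}) = good True (X - {2 * m})"
    using p X by (intro good_same_pair [OF p]) auto
  moreover have "good False ({..<2 * m} - X) = good True ({..<2 * m} - X)"
    using p X by (intro good_same_pair [OF p]) auto
  ultimately show ?thesis by (simp add: val_def)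
qed

lemma strongly_hypomorphic_design_fun:
  "strongly_hypomorphic (design_fun R False) (design_fun R True)"
  unfolding strongly_hypomorphic_def
proof (intro conjI ballI)
  let ?f = "design_fun R False" and ?g = "design_fun R True"
  show "arity ?f = arity ?g" by simp
  show "arity ?f \<ge> 2" unfolding arity_design_fun using m_eq h_pos by linarith
  fix I assume "I \<in> pairs (arity ?f)"
  then obtain i j where ij: "i < j" "j < 2 * m + 1" "I = {i, j}"
    unfolding arity_design_fun by (rule pairsE)
  \<comment> \<open>For two elements of one pair \<open>\<pi>\<close> is the identity, since no
    tested set is a transversal; otherwise it exchanges a suitable pair. Being an involution, it
    serves both directions.\<close>
  have "\<exists>\<pi>. \<pi> i = i \<and> \<pi> j = j \<and> (\<forall>k<2 * m + 1. \<pi> k < 2 * m + 1) \<and> (\<forall>k. \<pi> (\<pi> k) = k) \<and>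
      (\<forall>x. x i = x j \<longrightarrow> fval ?f x = fval ?g (\<lambda>k. x (\<pi> k)))"
  proof (cases "i div 2 = j div 2")
    case True
    moreover have "i = 2 * (i div 2) + i mod 2" "j = 2 * (j div 2) + j mod 2" "i mod 2 < 2" "j mod 2 < 2"
      by simp_all
    ultimately have j: "i = 2 * (i div 2)" "j = 2 * (i div 2) + 1" "i div 2 < m"
      using ij(1,2) by linarith+
    have "fval ?f x = fval ?g x" if "x i = x j" for x
      unfolding fval_design_fun using j that by (intro val_same_pair [OF j(3)]) auto
    then show ?thesis by (intro exI [of _ id]) simp
  next
    case False
    then obtain s where s: "s < m" "s \<noteq> i div 2" "s \<noteq> j div 2"
      "dom s (i div 2) \<noteq> (if j = 2 * m then True else dom s (j div 2))"
      using exists_separating_edge [of i j] ij by auto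
    have less: "swap s k < 2 * m + 1 \<longleftrightarrow> k < 2 * m + 1" for k
      using s(1) by (auto simp: swap_def)
    have "fval ?f x = fval ?g (\<lambda>k. x (swap s k))" if x: "x i = x j" for x
    proof -
      have "{k. k < 2 * m + 1 \<and> x (swap s k)} = swapped s {k. k < 2 * m + 1 \<and> x k}"
        using less by (auto simp: swapped_def)
      then show ?thesis
        unfolding fval_design_fun using val_swapped [OF s(1-4) ij(1), of "{k. k < 2 * m + 1 \<and> x k}" R] ij x
        by auto
    qed
    moreover have "swap s i = i" "swap s j = j" using s by (auto simp: swap_def)
    ultimately show ?thesis using less by (intro exI [of _ "swap s"]) simp
  qed
  then obtain \<pi> where \<pi>: "\<pi> i = i" "\<pi> j = j" "\<And>k. k < 2 * m + 1 \<Longrightarrow> \<pi> k < 2 * m + 1" "\<And>k. \<pi> (\<pi> k) = k"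
    and fg: "\<And>x. x i = x j \<Longrightarrow> fval ?f x = fval ?g (\<lambda>k. x (\<pi> k))"
    by blast
  have gf: "fval ?g x = fval ?f (\<lambda>k. x (\<pi> k))" if "x i = x j" for x
    using fg [of "\<lambda>k. x (\<pi> k)"] that \<pi> by simp
  show "equivalent (ident_minor ?f I) (ident_minor ?g I)"
    unfolding equivalent_def ij(3)
    using minor_ident_minorI [OF arity_design_fun arity_design_fun ij(1,2) \<pi>(1-3) fg]
      minor_ident_minorI [OF arity_design_fun arity_design_fun ij(1,2) \<pi>(1-3) gf]
    by blast
qed

section \<open>Nonequivalence\<close>

text \<open>A minor map \<open>\<sigma>\<close> would be a permutation, so its preimage operation
  \<open>\<theta>\<close> preserves sizes and intersections. It carries the sets of size
  \<open>m + 1\<close> with selector and value false to such sets, hence maps \<open>H False\<close>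
  onto \<open>H True\<close> with the sizes of intersections intact, and would transport a
  dominating set.\<close>

lemma not_minor_design_fun:
  assumes R: "\<not> R True"
  shows "\<not> minor (design_fun R False) (design_fun R True)"
proof
  let ?n = "2 * m + 1"
  assume "minor (design_fun R False) (design_fun R True)"
  then obtain \<sigma> where \<sigma>: "\<And>k. k < ?n \<Longrightarrow> \<sigma> k < ?n"
    "\<And>x. fval (design_fun R False) x = fval (design_fun R True) (\<lambda>k. x (\<sigma> k))"
    unfolding minor_iff arity_design_fun image_subset_iff Ball_def lessThan_iff by blast
  define \<theta> where "\<theta> X = {k. k < ?n \<and> \<sigma> k \<in> X}" for X
  have val: "val R False X = val R True (\<theta> X)" if "X \<subseteq> {..<?n}" for X
  proof -
    have "{i. i < ?n \<and> i \<in> X} = X" using that by auto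
    then show ?thesis using \<sigma>(2) [of "\<lambda>i. i \<in> X"] by (simp add: \<theta>_def)
  qed
  \<comment> \<open>All arguments of \<open>design_fun R False\<close> are essential, so \<open>\<sigma>\<close> is a permutation.\<close>
  have "i \<in> \<sigma> ` {..<?n}" if i: "i < ?n" for i
  proof (rule ccontr)
    assume "i \<notin> \<sigma> ` {..<?n}"
    then have "\<theta> (insert i X) = \<theta> X" for X by (auto simp: \<theta>_def)
    then have same: "val R False (insert i X) = val R False X" if "X \<subseteq> {..<?n}" for X
      using val [of X] val [of "insert i X"] that i by simp
    show False
    proof (cases "i = 2 * m")
      case True
      \<comment> \<open>Neither this set nor its complement lies in \<open>H False\<close>, so both
        are good. Adding the selector changes the value from \<open>R True\<close>, which is false,
        to true.\<close>
      let ?Y = "swapped 0 (edge 0)"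
      have m0: "0 < m" using m_eq by simp
      have Y: "?Y \<subseteq> {..<2 * m}" using swapped_subset edge_subset m0 by blast
      have bad: "good False Y" if "card Y = m" "Y \<notin> H False" for Y
        using that by (simp add: good_def)
      have Y01: "0 \<notin> ?Y" "1 \<in> ?Y"
        using irrefl even_in_edge [OF m0, of 0] odd_in_edge [OF m0, of 0]
        by (auto simp: swapped_def swap_def)
      have "card {t. t < m \<and> dom 0 t} \<noteq> 0" using outdegree m0 h_pos by simp
      then obtain t where t: "t < m" "dom 0 t" by (metis (mono_tags, lifting) card.empty empty_Collect_eq)
      then have t0: "t \<noteq> 0" using irrefl by metis
      then have Yt: "2 * t \<in> ?Y" "2 * t + 1 \<in> ?Y"
        using t by (auto simp: swapped_def swap_def even_in_edge odd_in_edge)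
      \<comment> \<open>The pair \<open>t\<close> lies entirely inside or outside \<open>Z\<close>,
        which rules out transversals. Splitting the pair \<open>{0, 1}\<close> leaves only
        \<open>edge 0\<close>, and that contains both 0 and \<open>2 * t\<close>.\<close>
      have nH: "Z \<notin> H False"
        if "2 * t \<in> Z \<longleftrightarrow> 2 * t + 1 \<in> Z" "0 \<in> Z \<longleftrightarrow> 1 \<notin> Z" "0 \<in> Z \<longrightarrow> 2 * t \<notin> Z" for Z
      proof
        assume "Z \<in> H False"
        moreover have "\<not> transversal Z" using that(1) t by (auto simp: transversal_def)
        ultimately obtain s where s: "s < m" "Z = edge s" by (auto simp: H_def)
        then have "s = 0" using that(2) even_in_edge [OF m0, of s] odd_in_edge [OF m0, of s] by auto
        then show False
          using that(3) s t even_in_edge [OF m0, of s] even_in_edge [OF t(1), of s] by auto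
      qed
      have cY: "card ?Y = m" using card_edge m0 by simp
      have "good False ?Y" using cY nH [of ?Y] Y01 Yt by (intro bad) auto
      moreover have "good False ({..<2 * m} - ?Y)"
      proof (rule bad)
        show "card ({..<2 * m} - ?Y) = m"
          using cY Y finite_subset by (subst card_Diff_subset) auto
        show "{..<2 * m} - ?Y \<notin> H False"
          using Y01 Yt m0 m_eq h_pos t by (intro nH) auto
      qed
      moreover have "2 * m \<notin> ?Y" using Y by auto
      moreover have "?Y \<subseteq> {..<?n}" using Y by auto
      ultimately show False using same [of ?Y] True R by (auto simp: val_def)
    next
      case False
      then have i: "i < 2 * m" using i by simp
      define p where "p = i div 2"
      have p: "p < m" using i by (auto simp: p_def)
      \<comment> \<open>Chosen so that the odd transversal \<open>selection {r}\<close> contains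
        \<open>i\<close>. It is outside \<open>H False\<close>, hence good, and deleting
        \<open>i\<close> makes it too small; the selector is kept in both sets.\<close>
      define r where "r = (if odd i then p else if p = 0 then 1 else 0)"
      have r: "r < m" "odd i \<longleftrightarrow> p = r" using p m_eq h_pos by (auto simp: r_def)
      let ?T = "selection {r}"
      have iT: "i \<in> ?T" using i r by (auto simp: selection_def p_def)
      have T: "transversal ?T" "odd_transversal ?T"
        using transversal_selection odd_transversal_selection [of "{r}"] r(1) by auto
      have Tsub: "?T \<subseteq> {..<2 * m}" using T by (simp add: transversal_def)
      have "?T \<notin> edge ` {..<m}"
      proof
        assume "?T \<in> edge ` {..<m}"
        then obtain s where s: "s < m" "?T = edge s" by auto
        have "odd (card (?T \<inter> edge s))" using card_edge [OF s(1)] s(2) odd_m by simp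
        moreover have "2 * s \<in> ?T" using s by (simp add: edge_def)
        ultimately show False using even_transversal_Int_edge [OF T(1) s(1)] by simp
      qed
      then have "good False ?T" using T card_transversal by (auto simp: good_def H_def)
      moreover have "\<not> good False (?T - {i})"
        using card_transversal [OF T(1)] card_Diff1_less [OF finite_subset [OF Tsub] iT]
        by (simp add: good_def)
      moreover have "insert i (insert (2 * m) (?T - {i})) - {2 * m} = ?T"
        "insert (2 * m) (?T - {i}) - {2 * m} = ?T - {i}"
        using iT Tsub False by auto
      then have "val R False (insert i (insert (2 * m) (?T - {i}))) = good False ?T"
        "val R False (insert (2 * m) (?T - {i})) = good False (?T - {i})"
        unfolding val_def by simp_all
      moreover have "insert (2 * m) (?T - {i}) \<subseteq> {..<?n}" using Tsub by auto
      ultimately show False using same by metis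
    qed
  qed
  then have img: "\<sigma> ` {..<?n} = {..<?n}" using \<sigma>(1) by auto
  then have inj: "inj_on \<sigma> {..<?n}" by (intro eq_card_imp_inj_on) auto
  have image: "\<sigma> ` \<theta> X = X" if "X \<subseteq> {..<?n}" for X
  proof -
    have "x \<in> \<sigma> ` \<theta> X" if "x \<in> X" for x
    proof -
      have "x \<in> \<sigma> ` {..<?n}" unfolding img using \<open>X \<subseteq> {..<?n}\<close> that by (rule subsetD)
      then obtain k where "k < ?n" "x = \<sigma> k" by blast
      then have "k \<in> \<theta> X" using that by (simp add: \<theta>_def)
      with \<open>x = \<sigma> k\<close> show ?thesis by (rule image_eqI)
    qed
    then show ?thesis by (auto simp: \<theta>_def)
  qed
  have card: "card (\<theta> X) = card X" if "X \<subseteq> {..<?n}" for X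
  proof -
    have "inj_on \<sigma> (\<theta> X)" using inj by (rule inj_on_subset) (auto simp: \<theta>_def)
    from card_image [OF this] image [OF that] show ?thesis by simp
  qed
  have \<theta>_image: "\<theta> (\<sigma> ` Z) = Z" if "Z \<subseteq> {..<?n}" for Z
    using inj that by (auto simp: \<theta>_def inj_on_def subset_iff)
  have \<theta>_Int: "\<theta> (X \<inter> Y) = \<theta> X \<inter> \<theta> Y" for X Y by (auto simp: \<theta>_def)
  define K where "K b = {X. X \<subseteq> {..<?n} \<and> 2 * m \<in> X \<and> X - {2 * m} \<in> H b}" for b
  have K_iff: "X \<in> K b \<longleftrightarrow> card X = m + 1 \<and> 2 * m \<in> X \<and> \<not> val R b X" if "X \<subseteq> {..<?n}" for X b
  proof -
    show ?thesis
    proof (cases "2 * m \<in> X")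
      case True
      have "card X = card (X - {2 * m}) + 1"
        using card.remove [OF finite_subset [OF that finite_lessThan] True] by simp
      moreover have "X \<in> K b \<longleftrightarrow> X - {2 * m} \<in> H b" using True that by (simp add: K_def)
      moreover have "val R b X = good b (X - {2 * m})" using True by (simp add: val_def)
      ultimately show ?thesis using card_H [of "X - {2 * m}" b] True unfolding good_def by auto
    qed (simp add: K_def)
  qed
  have K: "X \<in> K False \<longleftrightarrow> \<theta> X \<in> K True" if X: "X \<subseteq> {..<?n}" for X
  proof -
    have \<theta>X: "\<theta> X \<subseteq> {..<?n}" by (auto simp: \<theta>_def)
    \<comment> \<open>If \<open>R\<close> is negation, a set of size \<open>m + 1\<close> without
      selector has a complement of size \<open>m - 1\<close> among the pairs, so its value is true;
      the false value forces the selector. If \<open>R\<close> is constantly false, the selector is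
      the only argument implied by the function, so \<open>\<sigma>\<close> fixes it.\<close>
    have "2 * m \<in> X \<longleftrightarrow> 2 * m \<in> \<theta> X" if c: "card X = m + 1" and nv: "\<not> val R False X"
    proof (cases "R False")
      case True
      have "2 * m \<in> Z" if "Z \<subseteq> {..<?n}" "card Z = m + 1" "\<not> val R b Z" for Z b
      proof (rule ccontr)
        assume z: "2 * m \<notin> Z"
        then have "Z \<subseteq> {..<2 * m}" using that(1) by (auto simp: less_Suc_eq)
        then have "card ({..<2 * m} - Z) = 2 * m - (m + 1)"
          using that(2) finite_subset by (subst card_Diff_subset) auto
        then have "card ({..<2 * m} - Z) < m" using m_eq by linarith
        then have "\<not> good b ({..<2 * m} - Z)" by (simp add: good_def)
        then show False using that(3) z True by (simp add: val_def)
      qed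
      from this [OF X c nv] this [OF \<theta>X, of True] show ?thesis using card [OF X] c nv val [OF X] by simp
    next
      case False
      then have "\<not> R v" for v using R by (cases v) auto
      then have below: "2 * m \<in> Z" if "val R b Z" for Z b using that by (auto simp: val_def split: if_splits)
      have "\<sigma> (2 * m) = 2 * m"
      proof (rule ccontr)
        assume ne: "\<sigma> (2 * m) \<noteq> 2 * m"
        let ?X = "{..<?n} - {\<sigma> (2 * m)}"
        have "\<sigma> (2 * m) < ?n" using \<sigma>(1) by simp
        then have "card (?X - {2 * m}) = 2 * m - 1" using ne by (simp add: card_Diff_subset)
        then have "card (?X - {2 * m}) > m" using m_eq h_pos by linarith
        then have "good False (?X - {2 * m})"
          using card_H [of "?X - {2 * m}" False] by (auto simp: good_def)
        then have "val R False ?X" using ne by (simp add: val_def)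
        then have "val R True (\<theta> ?X)" using val [of ?X] by auto
        then have "2 * m \<in> \<theta> ?X" by (rule below)
        then show False by (simp add: \<theta>_def)
      qed
      then show ?thesis by (simp add: \<theta>_def)
    qed
    then show ?thesis
      unfolding K_iff [OF X] K_iff [OF \<theta>X] card [OF X] val [OF X, symmetric] by blast
  qed
  have cardK: "card (insert (2 * m) A \<inter> insert (2 * m) B) = card (A \<inter> B) + 1" if "A \<in> H b" for A B b
  proof -
    have "insert (2 * m) A \<inter> insert (2 * m) B = insert (2 * m) (A \<inter> B)" by auto
    moreover have "2 * m \<notin> A \<inter> B" "finite (A \<inter> B)"
      using H_subset [OF that] finite_subset by auto
    ultimately show ?thesis by simp
  qed
  \<comment> \<open>This is \<open>\<theta>\<close> seen on the sets without selector. The selector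
    adds exactly 1 to each intersection, on both sides.\<close>
  define \<phi> where "\<phi> A = \<theta> (insert (2 * m) A) - {2 * m}" for A
  have ins: "insert (2 * m) A \<in> K b" "insert (2 * m) A \<subseteq> {..<?n}" if "A \<in> H b" for A b
    using that H_subset [OF that] by (force simp: K_def insert_Diff_if)+
  have \<phi>: "\<phi> A \<in> H True" "insert (2 * m) (\<phi> A) = \<theta> (insert (2 * m) A)" if "A \<in> H False" for A
    using K [OF ins(2) [OF that]] ins(1) [OF that] by (auto simp: \<phi>_def K_def)
  have card_\<phi>: "card (\<phi> A \<inter> \<phi> B) = card (A \<inter> B)" if "A \<in> H False" "B \<in> H False" for A B
  proof -
    have "card (\<phi> A \<inter> \<phi> B) + 1 = card (\<theta> (insert (2 * m) A \<inter> insert (2 * m) B))"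
      unfolding \<theta>_Int \<phi>(2) [OF that(1), symmetric] \<phi>(2) [OF that(2), symmetric]
      by (rule cardK [OF \<phi>(1) [OF that(1)], symmetric])
    also have "\<dots> = card (insert (2 * m) A \<inter> insert (2 * m) B)"
      using ins(2) that by (intro card) blast
    finally show ?thesis using cardK [OF that(1), of B] by simp
  qed
  have surj: "\<exists>A\<in>H False. \<phi> A = B" if "B \<in> H True" for B
  proof -
    let ?X = "\<sigma> ` insert (2 * m) B"
    have sub: "?X \<subseteq> {..<?n}" using ins(2) [OF that] \<sigma>(1) by auto
    have \<theta>X: "\<theta> ?X = insert (2 * m) B" using ins(2) [OF that] by (rule \<theta>_image)
    then have "?X \<in> K False" using K [OF sub] ins(1) [OF that] by simp
    then have "?X - {2 * m} \<in> H False" "insert (2 * m) (?X - {2 * m}) = ?X" by (auto simp: K_def)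
    moreover have "insert (2 * m) B - {2 * m} = B" using H_subset [OF that] by auto
    ultimately show ?thesis using \<theta>X by (intro bexI [of _ "?X - {2 * m}"]) (simp_all add: \<phi>_def)
  qed
  have "dominating (H True) (\<phi> (selection {}))"
    unfolding dominating_def
  proof (intro conjI ballI impI)
    have dom: "dominating (H False) (selection {})" by (rule dominating_H_False)
    then have sel: "selection {} \<in> H False" by (simp add: dominating_def)
    then show "\<phi> (selection {}) \<in> H True" by (rule \<phi>)
    fix A' B' assume "A' \<in> H True" "B' \<in> H True" and ev: "even (card (A' \<inter> B'))"
    then obtain A B where AB: "A \<in> H False" "B \<in> H False" "A' = \<phi> A" "B' = \<phi> B" using surj by metis
    then have "even (card (A \<inter> B))" using ev card_\<phi> by simp
    then have "even (card (selection {} \<inter> A)) \<or> even (card (selection {} \<inter> B))"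
      using dom AB unfolding dominating_def by blast
    then show "even (card (\<phi> (selection {}) \<inter> A')) \<or> even (card (\<phi> (selection {}) \<inter> B'))"
      using AB card_\<phi> sel by simp
  qed
  then show False using not_dominating_H_True by blast
qed

lemma design_fun_False_in_clone:
  assumes "clone C" "ternary C (\<lambda>x y z. x \<and> (y \<or> z))"
  shows "design_fun (\<lambda>_. False) b \<in> C"
proof (rule monotone_below_proj_in_clone [OF assms, of "2 * m"])
  let ?f = "design_fun (\<lambda>_. False) b"
  show "2 * m < arity ?f" by simp
  show "fval ?f y" if "fval ?f x" "\<And>i. x i \<Longrightarrow> y i" for x y
  proof -
    have "val (\<lambda>_. False) b {i. i < 2 * m + 1 \<and> x i}" using that(1) by simp
    from val_mono [OF _ this, of "{i. i < 2 * m + 1 \<and> y i}"] that(2) show ?thesis by auto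
  qed
  show "x (2 * m)" if "fval ?f x" for x
    using that by (simp add: val_def split: if_splits)
  have "{i. i < 2 * m + 1 \<and> True} - {2 * m} = {..<2 * m}" by auto
  then show "fval ?f (\<lambda>_. True)" using good_full by (simp add: val_def)
qed

lemma design_fun_Not_in_clone:
  assumes "clone C" "ternary C maj"
  shows "design_fun Not b \<in> C"
proof (rule selfdual_monotone_in_clone [OF assms])
  let ?f = "design_fun Not b"
  show "fval ?f y" if "fval ?f x" "\<And>i. i < arity ?f \<Longrightarrow> x i \<Longrightarrow> y i" for x y
  proof -
    have "val Not b {i. i < 2 * m + 1 \<and> x i}" using that(1) by simp
    from val_mono [OF _ this, of "{i. i < 2 * m + 1 \<and> y i}"] that(2) show ?thesis by auto
  qed
  show "fval ?f (\<lambda>i. \<not> x i) \<longleftrightarrow> \<not> fval ?f x" for x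
  proof -
    have "{i. i < 2 * m + 1 \<and> \<not> x i} = {..<2 * m + 1} - {i. i < 2 * m + 1 \<and> x i}" by auto
    then show ?thesis using val_selfdual [of "{i. i < 2 * m + 1 \<and> x i}" b] by auto
  qed
qed

end

section \<open>Rotational tournaments and the clones outside the three\<close>

text \<open>The vertices form a cycle of length \<open>2 * h + 1\<close>, on which each dominates
  the next \<open>h\<close>.\<close>

lemma rotational_tournament:
  assumes "odd h"
  shows "tournament (2 * h + 1) h (\<lambda>s t. s < t \<and> t \<le> s + h \<or> t + h < s)"
    (is "tournament _ _ ?dom")
proof
  fix s assume s: "s < 2 * h + 1"
  show "card {t. t < 2 * h + 1 \<and> ?dom s t} = h"
  proof (cases "s \<le> h")
    case True
    then have "{t. t < 2 * h + 1 \<and> ?dom s t} = {s<..s + h}" by auto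
    then show ?thesis by simp
  next
    case False
    then have "{t. t < 2 * h + 1 \<and> ?dom s t} = {s<..2 * h} \<union> {..<s - h}" using s by auto
    moreover have "card ({s<..2 * h} \<union> {..<s - h}) = card {s<..2 * h} + card {..<s - h}"
      by (intro card_Un_disjoint) auto
    ultimately show ?thesis using False s by simp
  qed
next
  fix p q assume pq: "p < 2 * h + 1" "q < 2 * h + 1" "p \<noteq> q"
  have "h \<ge> 1" using assms by (cases h) auto
  \<comment> \<open>The witness lies \<open>h\<close> steps before \<open>p\<close> on the cycle:
    \<open>p\<close> is the last vertex it dominates, and \<open>q\<close>, at most \<open>h\<close>
    steps after \<open>p\<close>, is out of its reach.\<close>
  have *: "\<exists>s<2 * h + 1. s \<noteq> p \<and> s \<noteq> q \<and> ?dom s p \<and> \<not> ?dom s q"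
    if "?dom p q" "p < 2 * h + 1" "q < 2 * h + 1" for p q
    using that \<open>h \<ge> 1\<close>
    by (intro exI [of _ "if h \<le> p then p - h else p + h + 1"]) auto
  have "?dom p q \<or> ?dom q p" using pq by auto
  then show "\<exists>s<2 * h + 1. s \<noteq> p \<and> s \<noteq> q \<and> ?dom s p \<noteq> ?dom s q"
  proof
    assume "?dom p q"
    from * [OF this pq(1,2)] show ?thesis by blast
  next
    assume "?dom q p"
    from * [OF this pq(2,1)] show ?thesis by blast
  qed
qed (use assms in auto)

text \<open>Isolated because it transfers along duality and also refutes weak reconstructibility at
  every arity bound.\<close>

definition large_hypomorphic_pairs :: "boolfun set \<Rightarrow> bool" where
  "large_hypomorphic_pairs C \<longleftrightarrow> (\<forall>N. \<exists>f\<in>C. \<exists>g\<in>C. arity f \<ge> N \<and> arity g = arity f \<and>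
     strongly_hypomorphic f g \<and> \<not> equivalent f g)"

lemma large_hypomorphic_pairsI:
  assumes R: "\<not> R True"
    and C: "\<And>m h dom b. tournament m h dom \<Longrightarrow> tournament.design_fun m dom R b \<in> C"
  shows "large_hypomorphic_pairs C"
  unfolding large_hypomorphic_pairs_def
proof
  fix N :: nat
  \<comment> \<open>Odd, as \<open>tournament\<close> demands; the resulting arity is
    \<open>8 * N + 7\<close>.\<close>
  let ?h = "2 * N + 1"
  let ?dom = "\<lambda>s t. s < t \<and> t \<le> s + ?h \<or> t + ?h < s"
  interpret T: tournament "2 * ?h + 1" ?h ?dom
    by (rule rotational_tournament) simp
  let ?f = "T.design_fun R False" and ?g = "T.design_fun R True"
  have "?f \<in> C" "?g \<in> C" using C [OF T.tournament_axioms] by blast+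
  moreover have "arity ?f \<ge> N" "arity ?g = arity ?f" unfolding T.arity_design_fun by simp_all
  moreover have "strongly_hypomorphic ?f ?g" by (rule T.strongly_hypomorphic_design_fun)
  moreover have "\<not> equivalent ?f ?g"
    using T.not_minor_design_fun [of R] R by (simp add: equivalent_def)
  ultimately show "\<exists>f\<in>C. \<exists>g\<in>C. arity f \<ge> N \<and> arity g = arity f \<and>
      strongly_hypomorphic f g \<and> \<not> equivalent f g" by blast
qed

lemma large_hypomorphic_pairs_meet:
  assumes "clone C" "ternary C (\<lambda>x y z. x \<and> y)" "\<not> C \<subseteq> Lambda_clone"
  shows "large_hypomorphic_pairs C"
  by (rule large_hypomorphic_pairsI [where R = "\<lambda>_. False"])
    (simp_all add: tournament.design_fun_False_in_clone assms(1) not_in_Lambda_meet [OF assms])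

lemma large_hypomorphic_pairs_dual:
  assumes "large_hypomorphic_pairs (dual ` C)"
  shows "large_hypomorphic_pairs C"
  unfolding large_hypomorphic_pairs_def
proof
  fix N
  obtain f g where fg: "f \<in> dual ` C" "g \<in> dual ` C" "arity f \<ge> N" "arity g = arity f"
    "strongly_hypomorphic f g" "\<not> equivalent f g"
    using assms unfolding large_hypomorphic_pairs_def by blast
  have "dual f \<in> C" "dual g \<in> C" using fg(1,2) by auto
  moreover have "arity (dual f) \<ge> N" "arity (dual g) = arity (dual f)" using fg by simp_all
  moreover have "strongly_hypomorphic (dual f) (dual g)" using fg(5) by (rule strongly_hypomorphic_dual)
  moreover have "\<not> equivalent (dual f) (dual g)" using fg(6) by simp
  ultimately show "\<exists>f\<in>C. \<exists>g\<in>C. arity f \<ge> N \<and> arity g = arity f \<and>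
      strongly_hypomorphic f g \<and> \<not> equivalent f g" by blast
qed

text \<open>Outside \<open>L_clone\<close> there is a meet, a join or the majority function. Join
  becomes meet by duality, and majority leads to the self-dual version of the construction.\<close>

lemma large_hypomorphic_pairs:
  assumes C: "clone C" and "\<not> C \<subseteq> Lambda_clone" "\<not> C \<subseteq> V_clone" "\<not> C \<subseteq> L_clone"
  shows "large_hypomorphic_pairs C"
  using not_in_L_cases [OF C assms(4)]
proof (elim disjE)
  assume "ternary C (\<lambda>x y z. x \<and> y)"
  with C show ?thesis using assms(2) by (rule large_hypomorphic_pairs_meet)
next
  assume or: "ternary C (\<lambda>x y z. x \<or> y)"
  have eq: "dual (mk_fun 3 (\<lambda>a. a ! 0 \<or> a ! 1)) = mk_fun 3 (\<lambda>a. a ! 0 \<and> a ! 1)"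
    by (intro fval_eqI) simp_all
  from or have "dual (mk_fun 3 (\<lambda>a. a ! 0 \<or> a ! 1)) \<in> dual ` C"
    unfolding ternary_def by (rule imageI)
  then have "ternary (dual ` C) (\<lambda>x y z. x \<and> y)" by (simp only: eq ternary_def)
  moreover have "\<not> dual ` C \<subseteq> Lambda_clone"
  proof
    assume "dual ` C \<subseteq> Lambda_clone"
    then have "dual ` dual ` C \<subseteq> V_clone" unfolding V_clone_eq by (rule image_mono)
    then show False using assms(3) by (simp add: image_image)
  qed
  ultimately show ?thesis
    by (rule large_hypomorphic_pairs_dual [OF large_hypomorphic_pairs_meet [OF clone_dual [OF C]]])
next
  assume "ternary C maj"
  then show ?thesis
    by (intro large_hypomorphic_pairsI [where R = Not])
      (simp_all add: tournament.design_fun_Not_in_clone C)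
qed

theorem theorem5p4:
  fixes C :: "boolfun set"
  assumes "clone C"
  shows "(C \<subseteq> Lambda_clone \<or> C \<subseteq> V_clone \<or> C \<subseteq> L_clone
            \<longrightarrow> reconstructible (of_arity_ge C 4)) \<and>
         (\<not> (C \<subseteq> Lambda_clone \<or> C \<subseteq> V_clone \<or> C \<subseteq> L_clone)
            \<longrightarrow> (\<forall>n\<ge>1. \<not> weakly_reconstructible (of_arity_ge C n)) \<and>
                (\<forall>N. \<exists>f\<in>C. \<exists>g\<in>C. arity f \<ge> N \<and> arity g = arity f \<and>
                       strongly_hypomorphic f g \<and> \<not> equivalent f g))"
proof (intro conjI impI)
  assume "C \<subseteq> Lambda_clone \<or> C \<subseteq> V_clone \<or> C \<subseteq> L_clone"
  then show "reconstructible (of_arity_ge C 4)" by (rule reconstructible_of_arity_ge_4)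
next
  assume "\<not> (C \<subseteq> Lambda_clone \<or> C \<subseteq> V_clone \<or> C \<subseteq> L_clone)"
  then have "large_hypomorphic_pairs C" using assms by (intro large_hypomorphic_pairs) auto
  then show pairs: "\<forall>N. \<exists>f\<in>C. \<exists>g\<in>C. arity f \<ge> N \<and> arity g = arity f \<and>
      strongly_hypomorphic f g \<and> \<not> equivalent f g"
    unfolding large_hypomorphic_pairs_def .
  show "\<forall>n\<ge>1. \<not> weakly_reconstructible (of_arity_ge C n)"
  proof (intro allI impI)
    fix n :: nat
    obtain f g where fg: "f \<in> C" "g \<in> C" "arity f \<ge> n" "arity g = arity f"
      "strongly_hypomorphic f g" "\<not> equivalent f g"
      using pairs by blast
    have "f \<in> of_arity_ge C n" "g \<in> of_arity_ge C n" using fg by (simp_all add: of_arity_ge_def)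
    then show "\<not> weakly_reconstructible (of_arity_ge C n)"
      using strongly_hypomorphic_imp_hypomorphic [OF fg(5)] fg(6)
      unfolding weakly_reconstructible_def by blast
  qed
qed

end
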